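(* For all $\epsilon>0$ there exists $d_0>1$ such that for all $d>d_0$ and all $\lambda\le(1-\epsilon)/d$, there exists $C=C(d)>0$ such that with probability $1-o(1)$ over the choice of $G\sim G(n,d/n)$, the mixing time of the Glauber dynamics for the hard-core model on $G$ with fugacity $\lambda$ is $O(n^C)$.
   Context: $G(n,d/n)$ is the Erdős–Rényi random graph with edge probability $d/n$. The hard-core model on $G$ with fugacity $\lambda>0$ is the distribution on independent sets $I$ of $G$ with $\mu(I)\propto\lambda^{|I|}$. Its (heat-bath) Glauber dynamics: from the current independent set, choose a uniformly random vertex $v$; if some neighbor of $v$ is in the set, $v$ is made unoccupied; otherwise $v$ is made occupied with probability $\lambda/(1+\lambda)$ and unoccupied otherwise; other vertices are unchanged. The mixing time is the minimum number of steps after which, from the worst initial state, the distribution is within total variation distance $1/4$ of $\mu$. *)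

theory Defs
  imports "HOL-Probability.Probability"
begin

text \<open>Graphs on the vertex set {0..<n}: an edge set is a set of pairs (i,j) with i < j < n.\<close>

definition vertex_pairs :: "nat \<Rightarrow> (nat \<times> nat) set" where
  "vertex_pairs n = {(i, j). i < j \<and> j < n}"

definition adj :: "(nat \<times> nat) set \<Rightarrow> nat \<Rightarrow> nat \<Rightarrow> bool" where
  "adj E u v \<longleftrightarrow> (u, v) \<in> E \<or> (v, u) \<in> E"

text \<open>Erdos-Renyi random graph G(n,p): each of the n choose 2 pairs is an edge
  independently with probability p (bernoulli_pmf clamps p to [0,1]).\<close>

definition erdos_renyi :: "nat \<Rightarrow> real \<Rightarrow> (nat \<times> nat) set pmf" where
  "erdos_renyi n p =
     map_pmf (\<lambda>f. {e \<in> vertex_pairs n. f e})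
             (Pi_pmf (vertex_pairs n) False (\<lambda>_. bernoulli_pmf p))"

definition indep_sets :: "nat \<Rightarrow> (nat \<times> nat) set \<Rightarrow> nat set set" where
  "indep_sets n E = {I. I \<subseteq> {0..<n} \<and> (\<forall>u\<in>I. \<forall>v\<in>I. \<not> adj E u v)}"

definition partition_fn :: "nat \<Rightarrow> (nat \<times> nat) set \<Rightarrow> real \<Rightarrow> real" where
  "partition_fn n E lam = (\<Sum>I\<in>indep_sets n E. lam ^ card I)"

definition hardcore :: "nat \<Rightarrow> (nat \<times> nat) set \<Rightarrow> real \<Rightarrow> nat set pmf" where
  "hardcore n E lam =
     embed_pmf (\<lambda>I. if I \<in> indep_sets n E then lam ^ card I / partition_fn n E lam else 0)"

definition glauber_step :: "nat \<Rightarrow> (nat \<times> nat) set \<Rightarrow> real \<Rightarrow> nat set \<Rightarrow> nat set pmf" where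
  "glauber_step n E lam I =
     bind_pmf (pmf_of_set {0..<n}) (\<lambda>v.
       if \<exists>u\<in>I. adj E u v then return_pmf (I - {v})
       else map_pmf (\<lambda>b. if b then insert v I else I - {v})
                    (bernoulli_pmf (lam / (1 + lam))))"

definition glauber_dist :: "nat \<Rightarrow> (nat \<times> nat) set \<Rightarrow> real \<Rightarrow> nat \<Rightarrow> nat set \<Rightarrow> nat set pmf" where
  "glauber_dist n E lam t I =
     ((\<lambda>D. bind_pmf D (glauber_step n E lam)) ^^ t) (return_pmf I)"

definition tv_dist :: "'a pmf \<Rightarrow> 'a pmf \<Rightarrow> real" where
  "tv_dist p q = (SUP A. \<bar>measure_pmf.prob p A - measure_pmf.prob q A\<bar>)"

definition mixing_time :: "nat \<Rightarrow> (nat \<times> nat) set \<Rightarrow> real \<Rightarrow> nat" where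
  "mixing_time n E lam =
     (LEAST t. \<forall>I\<in>indep_sets n E.
        tv_dist (glauber_dist n E lam t I) (hardcore n E lam) \<le> 1 / 4)"

end

theory Submission
  imports Defs "HOL-Real_Asymp.Real_Asymp"
begin

text \<open>
  The vertices in parts of unusually large average degree are put into one block \<open>H\<close>: fix \<open>D = (1 + e) d\<close>, and
  let \<open>H\<close> be the union of the connected sets whose average degree exceeds \<open>D\<close>. The dynamics that
  resamples all of \<open>H\<close> or one vertex outside \<open>H\<close> contracts a weighted Lipschitz seminorm: a
  disagreement at \<open>x \<notin> H\<close> spreads into \<open>H\<close> along self-avoiding paths, and the expected number of
  exits is at most the maximum over these paths of the product of \<open>\<lambda> deg(v)\<close>, which is less than \<open>1\<close>
  because \<open>\<lambda> D < 1\<close> and, by AM-GM and the choice of \<open>H\<close>, the product of \<open>deg(v) / D\<close> is at most \<open>1\<close>. For a reversible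
  chain such a contraction gives a spectral gap, by log-convexity of \<open>t \<mapsto> \<parallel>T\<^sup>t f\<parallel>\<^sup>2\<close>.

  It remains to compare a block update with single-site updates, that is, to prove a Poincare
  inequality on \<open>H\<close>. Its constant grows by a factor of at most \<open>1 + 2\<lambda>\<close> when a vertex is added and
  does not grow under disjoint unions without edges in between, so it is exponential in the tree-depth
  only. With high probability the components of \<open>H\<close> have diameter \<open>O(log n)\<close> (a long geodesic
  together with a Vitali subfamily of the sets of large average degree along it would be a connected
  set that is too dense) and at most one cycle; hence their tree-depth is \<open>O(log n)\<close> and the constant
  is polynomial in \<open>n\<close>.
\<close>

section \<open>Conditional expectations of functions on independent sets\<close>

text \<open>The obstacle is the unbounded maximum degree: for \<lambda> near 1/d, single-site path
  coupling fails at vertices of degree well above d. A union of heavy sets is the right block to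
  absorb them, because a vertex outside it cannot be added to a connected part of it without the
  average degree staying at most \<open>D\<close>; this is exactly what the contraction started from
  an outside vertex uses. The room between \<lambda> d and 1 is spent twice: one factor 1 + e goes
  into \<open>D\<close> and produces the large-deviation exponent for heavy sets, the other is the
  contraction itself. Taking e to be half of \<epsilon> leaves enough for both. A spectral gap is
  the target because Dirichlet forms of block and single-site updates can be compared directly.
  Passing from mean square to the worst start costs a factor exponential in n, that is O(n)
  relaxation times, which a polynomial bound absorbs. Depth O(log n / (e^2 d)) and a factor 3 per
  level give an exponent depending on d and \<epsilon> only; \<lambda> enters the prefactor.\<close>

lemma adj_sym: "adj E u v = adj E v u"
  by (auto simp: adj_def)

locale hardcore_graph =
  fixes n :: nat and E :: "(nat \<times> nat) set" and lam :: real
  assumes E_sub: "E \<subseteq> vertex_pairs n" and lam_pos: "0 < lam"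
begin

abbreviation V :: "nat set" where "V \<equiv> {0..<n}"
abbreviation \<I> :: "nat set set" where "\<I> \<equiv> indep_sets n E"

definition wt :: "nat set \<Rightarrow> real" where "wt s = lam ^ card s"

text \<open>Equality outside \<open>B\<close> is the conditioning: a fibre collects the
  configurations that resampling the block \<open>B\<close> can reach from \<open>s\<close>.\<close>

definition fib :: "nat set \<Rightarrow> nat set \<Rightarrow> nat set set" where
  "fib B s = {r \<in> \<I>. r - B = s - B}"

definition wsum :: "nat set set \<Rightarrow> (nat set \<Rightarrow> real) \<Rightarrow> real" where
  "wsum X f = (\<Sum>r\<in>X. wt r * f r)"

text \<open>Conditional expectation given the configuration outside \<open>B\<close>, which is the
  heat-bath operator of the block. The partition function cancels in the quotient, so unnormalised
  weights suffice.\<close>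

definition ex :: "nat set \<Rightarrow> (nat set \<Rightarrow> real) \<Rightarrow> nat set \<Rightarrow> real" where
  "ex B f s = wsum (fib B s) f / wsum (fib B s) (\<lambda>_. 1)"

definition var :: "nat set \<Rightarrow> (nat set \<Rightarrow> real) \<Rightarrow> nat set \<Rightarrow> real" where
  "var B f s = ex B (\<lambda>r. (f r)\<^sup>2) s - (ex B f s)\<^sup>2"

lemma adj_irrefl: "\<not> adj E u u"
  using E_sub by (auto simp: adj_def vertex_pairs_def)

lemma adj_V: "adj E u v \<Longrightarrow> u \<in> V \<and> v \<in> V"
  using E_sub by (auto simp: adj_def vertex_pairs_def)

lemma finite_I [simp]: "finite \<I>"
  by (rule finite_subset[of _ "Pow V"]) (auto simp: indep_sets_def)

lemma I_sub: "s \<in> \<I> \<Longrightarrow> s \<subseteq> V"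
  by (auto simp: indep_sets_def)

lemma I_finite: "s \<in> \<I> \<Longrightarrow> finite s"
  using I_sub finite_subset by blast

lemma I_down: "s \<in> \<I> \<Longrightarrow> q \<subseteq> s \<Longrightarrow> q \<in> \<I>"
  by (auto simp: indep_sets_def)

lemma empty_I [simp]: "{} \<in> \<I>"
  by (auto simp: indep_sets_def)

lemma insert_I: "insert u s \<in> \<I> \<longleftrightarrow> s \<in> \<I> \<and> u \<in> V \<and> (\<forall>v\<in>s. \<not> adj E u v)"
  using adj_irrefl by (auto simp: indep_sets_def adj_sym)

lemma wt_pos [simp]: "0 < wt s"
  using lam_pos by (simp add: wt_def)

lemma wt_nonneg [simp]: "0 \<le> wt s"
  using wt_pos[of s] by linarith

lemma wt_insert: "finite s \<Longrightarrow> u \<notin> s \<Longrightarrow> wt (insert u s) = lam * wt s"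
  by (simp add: wt_def)

lemma fib_finite [simp]: "finite (fib B s)"
  by (auto simp: fib_def)

lemma fib_sub: "fib B s \<subseteq> \<I>"
  by (auto simp: fib_def)

lemma fib_I: "r \<in> fib B s \<Longrightarrow> r \<in> \<I>"
  by (auto simp: fib_def)

lemma fib_self: "s \<in> \<I> \<Longrightarrow> s \<in> fib B s"
  by (auto simp: fib_def)

lemma fib_eq: "r \<in> fib B s \<Longrightarrow> fib B r = fib B s"
  by (auto simp: fib_def)

lemma fib_V: "s \<in> \<I> \<Longrightarrow> fib V s = \<I>"
  using I_sub unfolding fib_def by blast

lemma fib_trace: "A \<subseteq> B \<Longrightarrow> r \<in> fib B s \<Longrightarrow> fib A r = {q \<in> fib B s. q - A = r - A}"
  unfolding fib_def by blast

lemma wsum_pos: "finite X \<Longrightarrow> X \<noteq> {} \<Longrightarrow> 0 < wsum X (\<lambda>_. 1)"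
  unfolding wsum_def by (rule sum_pos) auto

lemma W_pos: "s \<in> \<I> \<Longrightarrow> 0 < wsum (fib B s) (\<lambda>_. 1)"
  using fib_self by (intro wsum_pos) auto

lemma wsum_ex: "s \<in> \<I> \<Longrightarrow> wsum (fib B s) f = wsum (fib B s) (\<lambda>_. 1) * ex B f s"
  using W_pos[of s B] by (simp add: ex_def)

lemma ex_fib: "r \<in> fib B s \<Longrightarrow> ex B f r = ex B f s"
  by (simp add: ex_def fib_eq)

lemma var_fib: "r \<in> fib B s \<Longrightarrow> var B f r = var B f s"
  by (simp add: var_def ex_fib)

lemma ex_minus_B: "ex B f (s - B) = ex B f s"
  by (simp add: ex_def fib_def)

lemma wsum_mono: "(\<And>r. r \<in> X \<Longrightarrow> f r \<le> g r) \<Longrightarrow> wsum X f \<le> wsum X g"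
  unfolding wsum_def by (intro sum_mono mult_left_mono) auto

lemma wsum_cong: "(\<And>r. r \<in> X \<Longrightarrow> f r = g r) \<Longrightarrow> wsum X f = wsum X g"
  unfolding wsum_def by (intro sum.cong) auto

lemma wsum_add: "wsum X (\<lambda>r. f r + g r) = wsum X f + wsum X g"
  by (simp add: wsum_def sum.distrib algebra_simps)

lemma wsum_diff: "wsum X (\<lambda>r. f r - g r) = wsum X f - wsum X g"
  by (simp add: wsum_def sum_subtractf algebra_simps)

lemma wsum_cmult: "wsum X (\<lambda>r. c * f r) = c * wsum X f"
  by (simp add: wsum_def sum_distrib_left algebra_simps)

lemma wsum_sum: "wsum X (\<lambda>r. \<Sum>i\<in>A. f i r) = (\<Sum>i\<in>A. wsum X (f i))"
  by (simp add: wsum_def sum_distrib_left sum.swap[of _ X A])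

lemma wsum_nonneg: "(\<And>r. r \<in> X \<Longrightarrow> 0 \<le> f r) \<Longrightarrow> 0 \<le> wsum X f"
  unfolding wsum_def by (intro sum_nonneg mult_nonneg_nonneg) auto

lemma ex_mono: "(\<And>r. r \<in> fib B s \<Longrightarrow> f r \<le> g r) \<Longrightarrow> ex B f s \<le> ex B g s"
  unfolding ex_def by (intro divide_right_mono wsum_mono wsum_nonneg) auto

lemma ex_cong: "(\<And>r. r \<in> fib B s \<Longrightarrow> f r = g r) \<Longrightarrow> ex B f s = ex B g s"
  unfolding ex_def by (auto cong: wsum_cong)

lemma ex_add: "ex B (\<lambda>r. f r + g r) s = ex B f s + ex B g s"
  by (simp add: ex_def wsum_add add_divide_distrib)

lemma ex_diff: "ex B (\<lambda>r. f r - g r) s = ex B f s - ex B g s"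
  by (simp add: ex_def wsum_diff diff_divide_distrib)

lemma ex_cmult: "ex B (\<lambda>r. c * f r) s = c * ex B f s"
  by (simp add: ex_def wsum_cmult)

lemma ex_sum: "ex B (\<lambda>r. \<Sum>i\<in>A. f i r) s = (\<Sum>i\<in>A. ex B (f i) s)"
  by (simp add: ex_def wsum_sum sum_divide_distrib)

lemma ex_const: "s \<in> \<I> \<Longrightarrow> ex B (\<lambda>_. c) s = c"
  using W_pos[of s B] wsum_cmult[of "fib B s" c "\<lambda>_. 1"] by (simp add: ex_def)

lemma ex_const_on: "s \<in> \<I> \<Longrightarrow> (\<And>r. r \<in> fib B s \<Longrightarrow> f r = c) \<Longrightarrow> ex B f s = c"
  using ex_cong[of B s f "\<lambda>_. c"] ex_const by simp

lemma ex_nonneg: "(\<And>r. r \<in> fib B s \<Longrightarrow> 0 \<le> f r) \<Longrightarrow> 0 \<le> ex B f s"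
  unfolding ex_def by (intro divide_nonneg_nonneg wsum_nonneg) auto

text \<open>With respect to \<open>wt\<close> the operator has the kernel \<open>K\<close>, constant
  on classes of equal trace outside \<open>A\<close> and hence symmetric. Taking \<open>g\<close>
  constant gives the tower property; taking \<open>B = V\<close> gives reversibility.\<close>

lemma ex_local_sa:
  assumes "A \<subseteq> B"
  shows "wsum (fib B s) (\<lambda>r. g r * ex A f r) = wsum (fib B s) (\<lambda>r. ex A g r * f r)"
proof -
  let ?X = "fib B s"
  define W where "W r = wsum (fib A r) (\<lambda>_. 1)" for r
  define K where "K q r = (if q - A = r - A then 1 / W r else 0)" for q r
  have W: "W q = W r" if "q - A = r - A" for q r
    using that by (simp add: W_def fib_def)
  have Ks: "K q r = K r q" for q r
    unfolding K_def by (metis W)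
  have e: "ex A f r = (\<Sum>q\<in>?X. wt q * K q r * f q)" if "r \<in> ?X" for f r
  proof -
    have "ex A f r = (\<Sum>q\<in>{q \<in> ?X. q - A = r - A}. wt q * f q) / W r"
      by (simp add: ex_def W_def wsum_def fib_trace[OF assms that])
    also have "\<dots> = (\<Sum>q\<in>{q \<in> ?X. q - A = r - A}. wt q * K q r * f q)"
      by (simp add: sum_divide_distrib K_def)
    also have "\<dots> = (\<Sum>q\<in>?X. wt q * K q r * f q)"
      by (rule sum.mono_neutral_left) (auto simp: K_def)
    finally show ?thesis .
  qed
  have "wsum ?X (\<lambda>r. g r * ex A f r) = (\<Sum>r\<in>?X. \<Sum>q\<in>?X. wt r * g r * (wt q * K q r * f q))"
    by (simp add: wsum_def e sum_distrib_left mult.assoc)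
  also have "\<dots> = (\<Sum>q\<in>?X. \<Sum>r\<in>?X. wt r * g r * (wt q * K q r * f q))"
    by (rule sum.swap)
  also have "\<dots> = (\<Sum>q\<in>?X. wt q * ((\<Sum>r\<in>?X. wt r * K r q * g r) * f q))"
    by (simp add: sum_distrib_left sum_distrib_right Ks algebra_simps)
  also have "\<dots> = wsum ?X (\<lambda>r. ex A g r * f r)"
    by (simp add: wsum_def e)
  finally show ?thesis .
qed

lemma ex_tower:
  assumes "A \<subseteq> B"
  shows "ex B (ex A f) s = ex B f s"
proof -
  have "wsum (fib B s) (ex A f) = wsum (fib B s) (\<lambda>r. ex A (\<lambda>_. 1) r * f r)"
    using ex_local_sa[OF assms, of s "\<lambda>_. 1" f] by simp
  also have "\<dots> = wsum (fib B s) f"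
    by (rule wsum_cong) (auto simp: ex_const fib_I)
  finally show ?thesis by (simp add: ex_def)
qed

lemma var_alt:
  assumes "s \<in> \<I>"
  shows "var B f s = ex B (\<lambda>r. (f r - ex B f r)\<^sup>2) s"
proof -
  have "ex B (\<lambda>r. (f r - ex B f r)\<^sup>2) s
      = ex B (\<lambda>r. (f r)\<^sup>2 - 2 * (ex B f s) * f r + (ex B f s)\<^sup>2) s"
    by (rule ex_cong) (simp add: ex_fib power2_diff algebra_simps)
  also have "\<dots> = ex B (\<lambda>r. (f r)\<^sup>2) s - 2 * ex B f s * ex B f s + (ex B f s)\<^sup>2"
    by (simp add: ex_add ex_diff ex_cmult ex_const[OF assms])
  finally show ?thesis by (simp add: var_def power2_eq_square)
qed

lemma var_nonneg: "s \<in> \<I> \<Longrightarrow> 0 \<le> var B f s"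
  by (simp add: var_alt ex_nonneg)

lemma ex_sq_le: "s \<in> \<I> \<Longrightarrow> (ex B f s)\<^sup>2 \<le> ex B (\<lambda>r. (f r)\<^sup>2) s"
  using var_nonneg[of s B f] by (simp add: var_def)

text \<open>Law of total variance for nested blocks.\<close>

lemma var_split:
  assumes "A \<subseteq> B"
  shows "var B f s = ex B (var A f) s + var B (ex A f) s"
proof -
  have "ex B (var A f) s = ex B (ex A (\<lambda>r. (f r)\<^sup>2)) s - ex B (\<lambda>r. (ex A f r)\<^sup>2) s"
    by (simp add: var_def[abs_def] ex_diff)
  then show ?thesis
    by (simp add: var_def ex_tower[OF assms])
qed

text \<open>The boundary condition is split off as a separate argument \<open>t\<close>, so that for
  two non-adjacent blocks the admissible interiors form a product set.\<close>

definition ext :: "nat set \<Rightarrow> nat set \<Rightarrow> nat set set" where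
  "ext B t = {S. S \<subseteq> B \<and> S \<union> t \<in> \<I>}"

lemma wsum_ext:
  assumes "s \<in> \<I>"
  shows "wsum (fib B s) f = wt (s - B) * (\<Sum>S\<in>ext B (s - B). wt S * f (S \<union> (s - B)))"
proof -
  have split_at: "r - B = s - B \<Longrightarrow> (r \<inter> B) \<union> (s - B) = r" "S \<subseteq> B \<Longrightarrow> (S \<union> (s - B)) \<inter> B = S" for r S
    by blast+
  have "wsum (fib B s) f = (\<Sum>S\<in>ext B (s - B). wt (S \<union> (s - B)) * f (S \<union> (s - B)))"
    unfolding wsum_def
    by (rule sum.reindex_bij_witness[of _ "\<lambda>S. S \<union> (s - B)" "\<lambda>r. r \<inter> B"])
       (auto simp: fib_def ext_def split_at)
  also have "\<dots> = (\<Sum>S\<in>ext B (s - B). wt (s - B) * (wt S * f (S \<union> (s - B))))"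
  proof (rule sum.cong[OF refl])
    fix S assume S: "S \<in> ext B (s - B)"
    have "finite S" "finite (s - B)"
      using S I_finite[of "S \<union> (s - B)"] by (auto simp: ext_def)
    then have "wt (S \<union> (s - B)) = wt S * wt (s - B)"
      using S by (subst wt_def, subst card_Un_disjoint) (auto simp: ext_def wt_def power_add)
    then show "wt (S \<union> (s - B)) * f (S \<union> (s - B)) = wt (s - B) * (wt S * f (S \<union> (s - B)))"
      by simp
  qed
  finally show ?thesis by (simp add: sum_distrib_left)
qed

lemma ex_ext:
  assumes "s \<in> \<I>"
  shows "ex B f s = (\<Sum>S\<in>ext B (s - B). wt S * f (S \<union> (s - B))) / (\<Sum>S\<in>ext B (s - B). wt S)"
  using wt_pos[of "s - B"] unfolding ex_def wsum_ext[OF assms] by (simp del: wt_pos)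


section \<open>Local Poincare inequalities\<close>

text \<open>Poincare inequality for the dynamics restricted to \<open>B\<close>, uniform in the
  boundary condition. The local variances are summed and not averaged over \<open>B\<close>, which
  is why disjoint unions leave \<open>c\<close> unchanged.\<close>

definition PC :: "nat set \<Rightarrow> real \<Rightarrow> bool" where
  "PC B c \<longleftrightarrow> (\<forall>f. \<forall>s\<in>\<I>. var B f s \<le> c * (\<Sum>v\<in>B. ex B (var {v} f) s))"

lemma PC_mono: "PC B c \<Longrightarrow> c \<le> c' \<Longrightarrow> PC B c'"
  unfolding PC_def
proof (intro allI ballI)
  fix f s
  assume a: "\<forall>f. \<forall>s\<in>\<I>. var B f s \<le> c * (\<Sum>v\<in>B. ex B (var {v} f) s)" and c: "c \<le> c'" and s: "s \<in> \<I>"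
  have "var B f s \<le> c * (\<Sum>v\<in>B. ex B (var {v} f) s)" using a s by blast
  also have "\<dots> \<le> c' * (\<Sum>v\<in>B. ex B (var {v} f) s)"
    using c by (intro mult_right_mono sum_nonneg ex_nonneg var_nonneg) (auto intro: fib_I)
  finally show "var B f s \<le> c' * (\<Sum>v\<in>B. ex B (var {v} f) s)" .
qed

lemma PC_empty: "PC {} c"
proof -
  have "fib {} s = {s}" if "s \<in> \<I>" for s
    using that by (auto simp: fib_def)
  then show ?thesis by (auto simp: PC_def var_def ex_def wsum_def)
qed

section \<open>Poincare constants when one vertex is added to a block\<close>

lemma wsum_jensen: "(wsum Y g)\<^sup>2 \<le> wsum Y (\<lambda>_. 1) * wsum Y (\<lambda>r. (g r)\<^sup>2)"
proof -
  have "(\<Sum>r\<in>Y. sqrt (wt r) * (sqrt (wt r) * g r))\<^sup>2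
      \<le> (\<Sum>r\<in>Y. (sqrt (wt r))\<^sup>2) * (\<Sum>r\<in>Y. (sqrt (wt r) * g r)\<^sup>2)"
    by (rule Cauchy_Schwarz_ineq_sum)
  then show ?thesis
    by (simp add: wsum_def power_mult_distrib flip: mult.assoc)
qed

lemma wvar_eq:
  assumes "s \<in> \<I>"
  shows "wsum (fib B s) (\<lambda>_. 1) * var B f s
    = wsum (fib B s) (\<lambda>r. (f r)\<^sup>2) - (wsum (fib B s) f)\<^sup>2 / wsum (fib B s) (\<lambda>_. 1)"
  using W_pos[OF assms, of B] by (simp add: var_def ex_def field_simps power2_eq_square)

lemma split_variance:
  fixes w0 w1 S0 S1 q0 q1 :: real
  assumes "w0 > 0" "w1 > 0"
  shows "q0 + q1 - (S0 + S1)\<^sup>2 / (w0 + w1)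
     = (q0 - S0\<^sup>2 / w0) + (q1 - S1\<^sup>2 / w1) + w0 * w1 / (w0 + w1) * (S1 / w1 - S0 / w0)\<^sup>2"
proof -
  have "w0 + w1 \<noteq> 0" using assms by simp
  then show ?thesis using assms
    by (simp add: divide_simps) (simp add: algebra_simps power2_eq_square)
qed

lemma diff_del_out: "v \<in> B \<Longrightarrow> (r - (B - {v}) = (s - B) - (B - {v})) \<longleftrightarrow> (r - B = s - B \<and> v \<notin> r)"
  unfolding set_eq_iff by auto

lemma diff_del_in: "v \<in> B \<Longrightarrow> (r - (B - {v}) = insert v (s - B) - (B - {v})) \<longleftrightarrow> (r - B = s - B \<and> v \<in> r)"
  unfolding set_eq_iff by auto

text \<open>Pinning the state of \<open>v\<close> is a boundary condition for
  \<open>B - {v}\<close>. Since \<open>PC\<close> is uniform in the boundary, it applies to both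
  halves of a fibre.\<close>

lemma fib_del_out:
  assumes "v \<in> B" "s \<in> \<I>"
  shows "fib (B - {v}) (s - B) = {r \<in> fib B s. v \<notin> r}"
  using diff_del_out[OF assms(1)] by (auto simp: fib_def)

lemma fib_del_in:
  assumes "v \<in> B" "insert v (s - B) \<in> \<I>"
  shows "fib (B - {v}) (insert v (s - B)) = {r \<in> fib B s. v \<in> r}"
  using diff_del_in[OF assms(1)] by (auto simp: fib_def)

lemma fib_in_image:
  assumes "v \<in> B" "s \<in> \<I>"
  shows "{r \<in> fib B s. v \<in> r} = insert v ` {r \<in> fib B s. v \<notin> r \<and> insert v r \<in> \<I>}"
proof -
  have "r \<in> insert v ` {r \<in> fib B s. v \<notin> r \<and> insert v r \<in> \<I>}" if "r \<in> fib B s" "v \<in> r" for r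
  proof -
    have "r - {v} \<in> fib B s" "insert v (r - {v}) = r"
      using that assms I_down[of r "r - {v}"] by (auto simp: fib_def)
    then show ?thesis using that by (intro image_eqI[of _ _ "r - {v}"]) (auto simp: fib_def)
  qed
  moreover have "insert v r \<in> fib B s" if "r \<in> fib B s" "insert v r \<in> \<I>" for r
    using that assms by (simp add: fib_def)
  ultimately show ?thesis by blast
qed

text \<open>Adding \<open>v\<close> is injective and multiplies every weight by \<open>lam\<close>.
  This exact factor gives the cancellation in \<open>PC_delete\<close> and the bound
  \<open>p\<close> on occupation probabilities in \<open>ex_influence\<close>.\<close>

lemma wsum_in_image:
  assumes "v \<in> B" "s \<in> \<I>"
  shows "wsum {r \<in> fib B s. v \<in> r} f
     = lam * wsum {r \<in> fib B s. v \<notin> r \<and> insert v r \<in> \<I>} (\<lambda>r. f (insert v r))"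
proof -
  let ?A = "{r \<in> fib B s. v \<notin> r \<and> insert v r \<in> \<I>}"
  have "inj_on (insert v) ?A"
    by (rule inj_onI) (auto dest: insert_ident)
  then have "wsum {r \<in> fib B s. v \<in> r} f = (\<Sum>r\<in>?A. wt (insert v r) * f (insert v r))"
    by (simp add: fib_in_image[OF assms] wsum_def sum.reindex)
  also have "\<dots> = (\<Sum>r\<in>?A. lam * (wt r * f (insert v r)))"
    by (rule sum.cong) (auto simp: wt_insert I_finite fib_I)
  finally show ?thesis by (simp add: wsum_def sum_distrib_left)
qed

lemma wsum_split: "wsum (fib B s) f = wsum {r \<in> fib B s. v \<notin> r} f + wsum {r \<in> fib B s. v \<in> r} f"
  unfolding wsum_def
  by (subst sum.union_disjoint[symmetric]) (auto intro: sum.cong)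

lemma var_single:
  assumes "r \<in> \<I>" "v \<notin> r" "insert v r \<in> \<I>"
  shows "var {v} f r = lam / (1 + lam)\<^sup>2 * (f (insert v r) - f r)\<^sup>2"
proof -
  have fb: "fib {v} r = {r, insert v r}"
    using assms by (auto simp: fib_def)
  have ne: "insert v r \<noteq> r" "r \<noteq> insert v r" using assms by auto
  have w: "wt (insert v r) = lam * wt r"
    using assms by (simp add: wt_insert I_finite)
  have e: "ex {v} g r = (g r + lam * g (insert v r)) / (1 + lam)" for g
  proof -
    have "ex {v} g r = (wt r * (g r + lam * g (insert v r))) / (wt r * (1 + lam))"
      using ne by (simp add: ex_def fb wsum_def w algebra_simps)
    then show ?thesis using wt_pos[of r] by (simp del: wt_pos)
  qed
  have "1 + lam \<noteq> 0" using lam_pos by simp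
  then show ?thesis
    unfolding var_def e by (simp add: divide_simps) (simp add: algebra_simps power2_eq_square)
qed

text \<open>The variance splits into the variances given \<open>v\<close> out and \<open>v\<close> in, plus a term proportional to the
  squared difference of the two means. The latter is compared with the mean over the configurations
  without \<open>v\<close> to which \<open>v\<close> can be added; although this event may have small probability, so does \<open>v\<close>
  itself, and the two cancel.\<close>

lemma PC_delete:
  assumes PC: "PC (B - {v}) c" and v: "v \<in> B" and fin: "finite B"
    and c: "(1 + 2 * lam) * c \<le> c'" "2 * (1 + lam) \<le> c'" "0 \<le> c"
  shows "PC B c'"
  unfolding PC_def
proof (intro allI ballI)
  fix f s assume s: "s \<in> \<I>"
  define X0 where "X0 = {r \<in> fib B s. v \<notin> r}"
  define X1 where "X1 = {r \<in> fib B s. v \<in> r}"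
  define XA where "XA = {r \<in> fib B s. v \<notin> r \<and> insert v r \<in> \<I>}"
  let ?w = "\<lambda>Y. wsum Y (\<lambda>_. 1)"
  let ?B = "B - {v}"
  define G where "G Y = (\<Sum>u\<in>?B. wsum Y (var {u} f))" for Y
  define D where "D = wsum XA (\<lambda>r. (f (insert v r) - f r)\<^sup>2)"
  define wv where "wv Y = wsum Y (\<lambda>r. (f r)\<^sup>2) - (wsum Y f)\<^sup>2 / ?w Y" for Y
  have fins: "finite X0" "finite X1" "finite XA"
    by (auto simp: X0_def X1_def XA_def)
  have sB: "s - B \<in> \<I>" by (rule I_down[OF s]) auto
  have X0: "X0 = fib ?B (s - B)" using fib_del_out[OF v s] by (simp add: X0_def)
  have w0: "?w X0 > 0" unfolding X0 by (rule W_pos[OF sB])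
  have im: "wsum X1 h = lam * wsum XA (\<lambda>r. h (insert v r))" for h
    unfolding X1_def XA_def by (rule wsum_in_image[OF v s])
  have sp: "wsum (fib B s) h = wsum X0 h + wsum X1 h" for h
    unfolding X0_def X1_def by (rule wsum_split)
  have G0: "G Y \<ge> 0" if "Y \<subseteq> \<I>" for Y
    unfolding G_def using that by (intro sum_nonneg wsum_nonneg var_nonneg) auto
  have PC': "wv (fib ?B t) \<le> c * G (fib ?B t)" if "t \<in> \<I>" for t
  proof -
    have "?w (fib ?B t) * var ?B f t \<le> ?w (fib ?B t) * (c * (\<Sum>u\<in>?B. ex ?B (var {u} f) t))"
      using PC that W_pos[OF that, of ?B] unfolding PC_def by (intro mult_left_mono) auto
    also have "\<dots> = c * G (fib ?B t)"
      by (simp add: G_def wsum_ex[OF that, of _ "var {u} f" for u] sum_distrib_left algebra_simps)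
    finally show ?thesis using wvar_eq[OF that] by (simp add: wv_def)
  qed
  have PC0: "wv X0 \<le> c * G X0" unfolding X0 by (rule PC'[OF sB])
  have main: "wv (fib B s) \<le> (1 + 2 * lam) * c * G (fib B s) + 2 * lam * D"
  proof (cases "XA = {}")
    case True
    then have z: "wsum X1 h = 0" for h unfolding im by (simp add: wsum_def)
    then have "wv (fib B s) = wv X0" "G (fib B s) = G X0" "D = 0"
      using True by (simp_all add: wv_def G_def sp z) (simp add: D_def wsum_def)
    moreover have "c * G X0 \<le> (1 + 2 * lam) * (c * G X0)"
      using c lam_pos G0[of X0] fib_sub by (auto simp: X0 algebra_simps)
    ultimately show ?thesis using PC0 lam_pos by (smt (verit) mult.assoc zero_le_mult_iff)
  next
    case False
    then obtain r where r: "r \<in> XA" by blast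
    then have ins: "insert v (s - B) \<in> \<I>"
      by (intro I_down[of "insert v r" "insert v (s - B)"]) (auto simp: XA_def fib_def)
    have X1: "X1 = fib ?B (insert v (s - B))"
      using fib_del_in[OF v ins] by (simp add: X1_def)
    have w1: "?w X1 > 0" unfolding X1 by (rule W_pos[OF ins])
    have wA: "?w XA > 0" using False fins by (intro wsum_pos) auto
    have w1A: "?w X1 = lam * ?w XA" using im[of "\<lambda>_. 1"] by simp
    have PC1: "wv X1 \<le> c * G X1" unfolding X1 by (rule PC'[OF ins])
    define m0 where "m0 = wsum X0 f / ?w X0"
    define m1 where "m1 = wsum X1 f / ?w X1"
    define mA where "mA = wsum XA f / ?w XA"
    \<comment> \<open>Jensen on \<open>XA\<close>, then the sum is enlarged to \<open>X0\<close>.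
      Without normalisation the weight of \<open>XA\<close> stays on the left, however unlikely
      \<open>XA\<close> is inside \<open>X0\<close>.\<close>
    have i: "?w XA * (mA - m0)\<^sup>2 \<le> wv X0"
    proof -
      have d: "wsum Y (\<lambda>r. f r - m0) = wsum Y f - m0 * ?w Y" for Y
        using wsum_cmult[of Y m0 "\<lambda>_. 1"] by (simp add: wsum_diff)
      have "?w XA * (mA - m0)\<^sup>2 = (wsum XA (\<lambda>r. f r - m0))\<^sup>2 / ?w XA"
        using wA by (simp add: d mA_def field_simps power2_eq_square)
      also have "\<dots> \<le> wsum XA (\<lambda>r. (f r - m0)\<^sup>2)"
        using wsum_jensen[of XA "\<lambda>r. f r - m0"] wA by (simp add: divide_le_eq mult.commute)
      also have "\<dots> \<le> wsum X0 (\<lambda>r. (f r - m0)\<^sup>2)"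
        unfolding wsum_def by (rule sum_mono2) (auto simp: fins X0_def XA_def)
      also have "\<dots> = wsum X0 (\<lambda>r. ((f r)\<^sup>2 - (2 * m0) * f r) + m0\<^sup>2 * 1)"
        by (rule wsum_cong) (simp add: power2_diff algebra_simps)
      also have "\<dots> = wsum X0 (\<lambda>r. (f r)\<^sup>2) - 2 * m0 * wsum X0 f + m0\<^sup>2 * ?w X0"
        by (simp only: wsum_add wsum_diff wsum_cmult)
      also have "\<dots> = wv X0"
        using w0 by (simp add: wv_def m0_def field_simps power2_eq_square)
      finally show ?thesis .
    qed
    \<comment> \<open>\<open>insert v\<close> carries \<open>XA\<close> onto \<open>X1\<close> with
      constant weight ratio, so \<open>m1\<close> is also the mean of \<open>f (insert v r)\<close>
      over \<open>XA\<close>.\<close>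
    have ii: "?w XA * (m1 - mA)\<^sup>2 \<le> D"
    proof -
      have "m1 - mA = wsum XA (\<lambda>r. f (insert v r) - f r) / ?w XA"
        using wA lam_pos by (simp add: m1_def mA_def im[of f] w1A wsum_diff diff_divide_distrib)
      then have "?w XA * (m1 - mA)\<^sup>2 = (wsum XA (\<lambda>r. f (insert v r) - f r))\<^sup>2 / ?w XA"
        using wA by (simp add: power_divide) (simp add: power2_eq_square)
      also have "\<dots> \<le> D"
        using wsum_jensen[of XA "\<lambda>r. f (insert v r) - f r"] wA
        by (simp add: D_def divide_le_eq mult.commute)
      finally show ?thesis .
    qed
    have "?w X0 * ?w X1 / (?w X0 + ?w X1) \<le> ?w X1"
      using w0 w1 by (simp add: divide_le_eq algebra_simps)
    then have "?w X0 * ?w X1 / (?w X0 + ?w X1) * (m1 - m0)\<^sup>2 \<le> lam * ?w XA * (m1 - m0)\<^sup>2"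
      unfolding w1A by (intro mult_right_mono) auto
    also have "\<dots> \<le> lam * ?w XA * (2 * (mA - m0)\<^sup>2 + 2 * (m1 - mA)\<^sup>2)"
    proof (intro mult_left_mono)
      have "0 \<le> ((mA - m0) - (m1 - mA))\<^sup>2" by simp
      then show "(m1 - m0)\<^sup>2 \<le> 2 * (mA - m0)\<^sup>2 + 2 * (m1 - mA)\<^sup>2"
        by (simp add: power2_eq_square algebra_simps)
    qed (use lam_pos wA in auto)
    also have "\<dots> = 2 * lam * (?w XA * (mA - m0)\<^sup>2 + ?w XA * (m1 - mA)\<^sup>2)"
      by (simp add: algebra_simps)
    also have "\<dots> \<le> 2 * lam * (wv X0 + D)"
      using i ii lam_pos by (intro mult_left_mono add_mono) auto
    finally have "wv (fib B s) \<le> wv X0 + wv X1 + 2 * lam * (wv X0 + D)"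
      using split_variance[OF w0 w1] by (simp add: wv_def sp m0_def m1_def)
    also have "\<dots> \<le> (1 + 2 * lam) * (c * G X0) + (1 + 2 * lam) * (c * G X1) + 2 * lam * D"
    proof -
      have "(1 + 2 * lam) * wv X0 \<le> (1 + 2 * lam) * (c * G X0)"
        using PC0 lam_pos by (intro mult_left_mono) auto
      moreover have "1 * wv X1 \<le> (1 + 2 * lam) * (c * G X1)"
        using PC1 lam_pos c G0[of X1] fib_sub
        by (intro order_trans[OF _ mult_right_mono[of 1 "1 + 2 * lam" "c * G X1"]]) (auto simp: X1)
      ultimately show ?thesis by (simp add: algebra_simps)
    qed
    also have "\<dots> = (1 + 2 * lam) * c * G (fib B s) + 2 * lam * D"
      by (simp add: G_def sp sum.distrib algebra_simps)
    finally show ?thesis .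
  qed
  \<comment> \<open>A pair \<open>r\<close>, \<open>insert v r\<close> with \<open>r\<close> in
    \<open>XA\<close> has weight \<open>(1 + lam) * wt r\<close> and local variance
    \<open>lam / (1 + lam)\<^sup>2\<close> times the squared difference; all other configurations
    contribute at least 0. Multiplied by \<open>2 * (1 + lam)\<close> this pays for
    \<open>2 * lam * D\<close>, which is the second condition on \<open>c'\<close>.\<close>
  have v': "lam / (1 + lam) * D \<le> wsum (fib B s) (var {v} f)"
  proof -
    have sub: "XA \<subseteq> X0" by (auto simp: XA_def X0_def)
    have XI: "X0 \<subseteq> \<I>" by (auto simp: X0_def fib_def)
    have "wsum XA (var {v} f) \<le> wsum X0 (var {v} f)"
      unfolding wsum_def using sub XI var_nonneg
      by (intro sum_mono2) (auto simp: fins intro!: mult_nonneg_nonneg)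
    moreover have "wsum X1 (var {v} f) = lam * wsum XA (var {v} f)"
      unfolding im
    proof (intro arg_cong[of _ _ "(*) lam"] wsum_cong)
      fix r assume "r \<in> XA"
      then have "insert v r \<in> fib {v} r" by (auto simp: XA_def fib_def)
      then show "var {v} f (insert v r) = var {v} f r" by (rule var_fib)
    qed
    moreover have "wsum XA (var {v} f) = lam / (1 + lam)\<^sup>2 * D"
    proof -
      have "wsum XA (var {v} f) = wsum XA (\<lambda>r. lam / (1 + lam)\<^sup>2 * (f (insert v r) - f r)\<^sup>2)"
        by (rule wsum_cong) (use var_single fib_I in \<open>auto simp: XA_def\<close>)
      then show ?thesis by (simp only: wsum_cmult D_def)
    qed
    moreover have "(1 + lam) * (lam / (1 + lam)\<^sup>2 * D) = lam / (1 + lam) * D"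
      using lam_pos by (simp add: power2_eq_square)
    ultimately show ?thesis by (simp add: sp algebra_simps add_divide_distrib)
  qed
  have "wv (fib B s) \<le> (1 + 2 * lam) * c * G (fib B s) + 2 * (1 + lam) * (lam / (1 + lam) * D)"
  proof -
    have "2 * (1 + lam) * (lam / (1 + lam) * D) = 2 * lam * D"
      using lam_pos by (simp add: field_simps)
    then show ?thesis using main by simp
  qed
  also have "\<dots> \<le> c' * G (fib B s) + c' * wsum (fib B s) (var {v} f)"
  proof (intro add_mono mult_right_mono)
    show "2 * (1 + lam) * (lam / (1 + lam) * D) \<le> c' * wsum (fib B s) (var {v} f)"
      using v' c lam_pos
      by (intro mult_mono) (auto simp: D_def intro!: mult_nonneg_nonneg divide_nonneg_nonneg wsum_nonneg)
  qed (use c G0[OF fib_sub] in auto)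
  also have "\<dots> = c' * (\<Sum>u\<in>B. wsum (fib B s) (var {u} f))"
    unfolding G_def using sum.remove[OF fin v, of "\<lambda>u. wsum (fib B s) (var {u} f)"]
    by (simp add: algebra_simps)
  also have "\<dots> = ?w (fib B s) * (c' * (\<Sum>u\<in>B. ex B (var {u} f) s))"
    by (simp add: wsum_ex[OF s, of _ "var {u} f" for u] sum_distrib_left algebra_simps)
  finally have "?w (fib B s) * var B f s \<le> ?w (fib B s) * (c' * (\<Sum>u\<in>B. ex B (var {u} f) s))"
    using wvar_eq[OF s] by (simp add: wv_def)
  then show "var B f s \<le> c' * (\<Sum>u\<in>B. ex B (var {u} f) s)"
    using W_pos[OF s, of B] by simp
qed

section \<open>Conditional independence and tensorisation over non-adjacent blocks\<close>

lemma ext_Un: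
  assumes dj: "B1 \<inter> B2 = {}" and ne: "\<And>u v. u \<in> B1 \<Longrightarrow> v \<in> B2 \<Longrightarrow> \<not> adj E u v"
    and S2: "S2 \<in> ext B2 t"
  shows "ext B1 (S2 \<union> t) = ext B1 t"
proof -
  have "S1 \<union> (S2 \<union> t) \<in> \<I> \<longleftrightarrow> S1 \<union> t \<in> \<I>" if "S1 \<subseteq> B1" for S1
  proof
    assume a: "S1 \<union> t \<in> \<I>"
    have b: "S2 \<union> t \<in> \<I>" "S2 \<subseteq> B2" using S2 by (auto simp: ext_def)
    have "\<not> adj E u v" if "u \<in> S1" "v \<in> S2" for u v
      using ne that \<open>S1 \<subseteq> B1\<close> b by blast
    then show "S1 \<union> (S2 \<union> t) \<in> \<I>"
      using a b adj_sym[of E] unfolding indep_sets_def by blast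
  qed (erule I_down, blast)
  then show ?thesis by (auto simp: ext_def)
qed

text \<open>Without edges between them the blocks are independent given the rest: the admissible
  interiors form a product and the weights multiply. The statement is symmetric in the blocks, so
  the two operators commute.\<close>

lemma ex_commute:
  assumes dj: "B1 \<inter> B2 = {}" and ne: "\<And>u v. u \<in> B1 \<Longrightarrow> v \<in> B2 \<Longrightarrow> \<not> adj E u v"
    and s: "s \<in> \<I>" and fin: "finite B1" "finite B2"
  shows "ex B2 (ex B1 f) s = ex (B1 \<union> B2) f s"
proof -
  define t where "t = s - B1 - B2"
  define s1 where "s1 = s \<inter> B1"
  have ts: "s1 \<union> t \<in> \<I>" "t \<union> s1 = s - B2" "s - B2 = s1 \<union> t" "s - (B1 \<union> B2) = t"
    using I_down[OF s, of "s1 \<union> t"] dj by (auto simp: t_def s1_def)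
  have s1: "s1 \<in> ext B1 t" using ts by (auto simp: ext_def s1_def)
  have ne': "\<And>u v. u \<in> B2 \<Longrightarrow> v \<in> B1 \<Longrightarrow> \<not> adj E u v"
    using ne adj_sym[of E] by blast
  let ?Z = "\<lambda>B. \<Sum>S\<in>ext B t. wt S"
  have e1: "ex B1 f (S2 \<union> (s1 \<union> t)) = (\<Sum>S1\<in>ext B1 t. wt S1 * f (S1 \<union> (S2 \<union> t))) / ?Z B1"
    if S2: "S2 \<in> ext B2 t" for S2
  proof -
    have "S2 \<in> ext B2 (s1 \<union> t)" 
      using ext_Un[of B2 B1 s1 t] ne' dj s1 S2 by blast
    then have I: "S2 \<union> (s1 \<union> t) \<in> \<I>" by (auto simp: ext_def)
    have m: "(S2 \<union> (s1 \<union> t)) - B1 = S2 \<union> t"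
      using S2 dj by (auto simp: ext_def s1_def t_def)
    show ?thesis
      unfolding ex_ext[OF I] m using ext_Un[OF dj ne S2] by simp
  qed
  have "ex B2 (ex B1 f) s
     = (\<Sum>S2\<in>ext B2 t. wt S2 * ((\<Sum>S1\<in>ext B1 t. wt S1 * f (S1 \<union> (S2 \<union> t))) / ?Z B1)) / ?Z B2"
    unfolding ex_ext[OF s] ts(3)
    using ext_Un[of B2 B1 s1 t] ne' dj s1 by (simp add: Int_commute e1)
  also have "\<dots> = (\<Sum>S2\<in>ext B2 t. \<Sum>S1\<in>ext B1 t. wt S1 * wt S2 * f (S1 \<union> S2 \<union> t)) / (?Z B1 * ?Z B2)"
    by (simp add: sum_distrib_left sum_divide_distrib algebra_simps Un_assoc)
  finally have L: "ex B2 (ex B1 f) s = (\<Sum>S2\<in>ext B2 t. \<Sum>S1\<in>ext B1 t. wt S1 * wt S2 * f (S1 \<union> S2 \<union> t)) / (?Z B1 * ?Z B2)" .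
  have prod: "(\<Sum>S\<in>ext (B1 \<union> B2) t. wt S * h S) = (\<Sum>S2\<in>ext B2 t. \<Sum>S1\<in>ext B1 t. wt S1 * wt S2 * h (S1 \<union> S2))" for h
  proof -
    have "(\<Sum>S2\<in>ext B2 t. \<Sum>S1\<in>ext B1 t. wt S1 * wt S2 * h (S1 \<union> S2))
        = (\<Sum>(S2,S1)\<in>ext B2 t \<times> ext B1 t. wt S1 * wt S2 * h (S1 \<union> S2))"
      by (simp add: sum.cartesian_product)
    also have "\<dots> = (\<Sum>S\<in>ext (B1 \<union> B2) t. wt S * h S)"
    proof (rule sum.reindex_bij_witness[of _ "\<lambda>S. (S \<inter> B2, S \<inter> B1)" "\<lambda>(S2,S1). S1 \<union> S2"])
      fix p assume "p \<in> ext B2 t \<times> ext B1 t"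
      then obtain S1 S2 where p: "p = (S2, S1)" "S2 \<in> ext B2 t" "S1 \<in> ext B1 t" by auto
      have sub: "S1 \<subseteq> B1" "S2 \<subseteq> B2" using p by (auto simp: ext_def)
      show "((case p of (S2, S1) \<Rightarrow> S1 \<union> S2) \<inter> B2, (case p of (S2, S1) \<Rightarrow> S1 \<union> S2) \<inter> B1) = p"
        using sub dj by (auto simp: p)
      have "S1 \<in> ext B1 (S2 \<union> t)" using ext_Un[OF dj ne p(2)] p(3) by blast
      then show "(case p of (S2, S1) \<Rightarrow> S1 \<union> S2) \<in> ext (B1 \<union> B2) t"
        using sub by (auto simp: p ext_def Un_assoc)
      have "finite S1" "finite S2" "S1 \<inter> S2 = {}"
        using sub fin finite_subset dj by blast+
      then have "wt (S1 \<union> S2) = wt S1 * wt S2"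
        by (simp add: wt_def card_Un_disjoint power_add)
      then show "wt (case p of (S2, S1) \<Rightarrow> S1 \<union> S2) * h (case p of (S2, S1) \<Rightarrow> S1 \<union> S2)
         = (case p of (S2, S1) \<Rightarrow> wt S1 * wt S2 * h (S1 \<union> S2))"
        by (simp add: p)
    next
      fix S assume S: "S \<in> ext (B1 \<union> B2) t"
      then show "(case (S \<inter> B2, S \<inter> B1) of (S2, S1) \<Rightarrow> S1 \<union> S2) = S"
        by (auto simp: ext_def)
      have "S \<inter> B1 \<union> t \<in> \<I>" "S \<inter> B2 \<union> t \<in> \<I>"
        using S by (auto simp: ext_def intro!: I_down[of "S \<union> t"])
      then show "(S \<inter> B2, S \<inter> B1) \<in> ext B2 t \<times> ext B1 t"
        by (auto simp: ext_def)
    qed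
    finally show ?thesis by simp
  qed
  have "ex (B1 \<union> B2) f s = (\<Sum>S2\<in>ext B2 t. \<Sum>S1\<in>ext B1 t. wt S1 * wt S2 * f (S1 \<union> S2 \<union> t)) / (?Z B1 * ?Z B2)"
    unfolding ex_ext[OF s] ts(4) prod[of "\<lambda>S. f (S \<union> t)"]
    using prod[of "\<lambda>_. 1"]
    by (simp add: sum_distrib_left sum_distrib_right algebra_simps)
  then show ?thesis by (simp add: L)
qed

text \<open>Efron-Stein inequality for two conditionally independent blocks: by Jensen, averaging
  over \<open>B1\<close> first can only lower the variance along \<open>B2\<close>, so the two
  contributions add and the constant does not grow.\<close>

lemma PC_union:
  assumes dj: "B1 \<inter> B2 = {}" and ne: "\<And>u v. u \<in> B1 \<Longrightarrow> v \<in> B2 \<Longrightarrow> \<not> adj E u v"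
    and fin: "finite B1" "finite B2" and PC: "PC B1 c" "PC B2 c"
  shows "PC (B1 \<union> B2) c"
  unfolding PC_def
proof (intro allI ballI)
  fix f s assume s: "s \<in> \<I>"
  let ?B = "B1 \<union> B2"
  have ne': "\<And>u v. u \<in> B2 \<Longrightarrow> v \<in> B1 \<Longrightarrow> \<not> adj E u v"
    using ne adj_sym[of E] by blast
  have c21: "ex B2 (ex B1 g) t = ex ?B g t" if "t \<in> \<I>" for g t
    using ex_commute[OF dj ne that fin] .
  have c12: "ex B1 (ex B2 g) t = ex ?B g t" if "t \<in> \<I>" for g t
    using ex_commute[of B2 B1, OF _ ne' that fin(2,1)] dj by (simp add: Un_commute Int_commute)
  have ivl: "ex ?B (ex B1 g) s = ex B2 (ex B1 g) s" for g
    using ex_tower[of B1 ?B g s] c21[OF s] by simp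
  have part: "ex ?B (var A f) s \<le> c * (\<Sum>v\<in>A. ex ?B (var {v} f) s)" if "PC A c" "A \<subseteq> ?B" for A
  proof -
    have "ex ?B (var A f) s \<le> ex ?B (\<lambda>r. c * (\<Sum>v\<in>A. ex A (var {v} f) r)) s"
      using that fib_I by (intro ex_mono) (auto simp: PC_def)
    also have "\<dots> = c * (\<Sum>v\<in>A. ex ?B (var {v} f) s)"
      using that by (simp add: ex_cmult ex_sum ex_tower)
    finally show ?thesis .
  qed
  have "var ?B (ex B1 f) s \<le> ex ?B (var B2 f) s"
  proof -
    have inv: "ex B1 f r = ex B1 f q" if "r \<in> fib B1 q" for r q
      using that by (rule ex_fib)
    have "ex ?B (\<lambda>r. (ex B1 f r)\<^sup>2) s = ex B2 (\<lambda>r. (ex B1 f r)\<^sup>2) s"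
    proof -
      have "ex ?B (\<lambda>r. (ex B1 f r)\<^sup>2) s = ex B2 (ex B1 (\<lambda>r. (ex B1 f r)\<^sup>2)) s"
        using c21[OF s] by simp
      also have "\<dots> = ex B2 (\<lambda>r. (ex B1 f r)\<^sup>2) s"
        by (rule ex_cong, rule ex_const_on) (simp_all add: inv fib_I[of _ B2 s])
      finally show ?thesis .
    qed
    then have "var ?B (ex B1 f) s = var B2 (ex B1 f) s"
      by (simp add: var_def ivl)
    also have "\<dots> = ex B2 (\<lambda>r. (ex B1 f r - ex B2 (ex B1 f) r)\<^sup>2) s"
      by (rule var_alt[OF s])
    also have "\<dots> = ex B2 (\<lambda>r. (ex B1 (\<lambda>q. f q - ex B2 f q) r)\<^sup>2) s"
      by (rule ex_cong) (simp add: ex_diff c12 c21 fib_I)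
    also have "\<dots> \<le> ex B2 (ex B1 (\<lambda>q. (f q - ex B2 f q)\<^sup>2)) s"
      by (rule ex_mono, rule ex_sq_le) (rule fib_I)
    also have "\<dots> = ex ?B (ex B2 (\<lambda>q. (f q - ex B2 f q)\<^sup>2)) s"
      by (simp add: c21[OF s] ex_tower)
    also have "\<dots> = ex ?B (var B2 f) s"
      by (rule ex_cong) (simp add: var_alt fib_I)
    finally show ?thesis .
  qed
  then have "var ?B f s \<le> ex ?B (var B1 f) s + ex ?B (var B2 f) s"
    using var_split[of B1 ?B f s] by simp
  also have "\<dots> \<le> c * (\<Sum>v\<in>B1. ex ?B (var {v} f) s) + c * (\<Sum>v\<in>B2. ex ?B (var {v} f) s)"
    using part[OF PC(1)] part[OF PC(2)] by auto
  also have "\<dots> = c * (\<Sum>v\<in>?B. ex ?B (var {v} f) s)"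
    using fin dj by (simp add: sum.union_disjoint distrib_left)
  finally show "var ?B f s \<le> c * (\<Sum>v\<in>?B. ex ?B (var {v} f) s)" .
qed

end

section \<open>Propagation of a disagreement\<close>

text \<open>Connected finite vertex sets, generated by attaching one neighbour at a time, so that
  rule induction runs along a spanning tree.\<close>

inductive conn :: "(nat \<times> nat) set \<Rightarrow> nat set \<Rightarrow> bool" for E where
  single: "conn E {v}"
| step: "conn E U \<Longrightarrow> u \<in> U \<Longrightarrow> adj E u v \<Longrightarrow> v \<notin> U \<Longrightarrow> conn E (insert v U)"

definition deg :: "(nat \<times> nat) set \<Rightarrow> nat \<Rightarrow> nat" where
  "deg E v = card {u. adj E v u}"

lemma conn_finite: "conn E U \<Longrightarrow> finite U"
  by (induction rule: conn.induct) auto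

lemma conn_nonempty: "conn E U \<Longrightarrow> U \<noteq> {}"
  by (induction rule: conn.induct) auto

lemma conn_insert: "conn E U \<Longrightarrow> u \<in> U \<Longrightarrow> adj E u v \<Longrightarrow> conn E (insert v U)"
  by (cases "v \<in> U") (auto simp: insert_absorb intro: conn.step)

context hardcore_graph
begin

text \<open>The exponent counts levels, not vertices: removing a root at the lowest level costs one
  factor \<open>1 + 2 * lam \<le> 3\<close> for its whole tree, and distinct trees are combined by
  \<open>PC_union\<close> for free. The 4 covers the condition \<open>2 * (1 + lam) \<le> c'\<close>
  of \<open>PC_delete\<close>.\<close>

lemma PC_forest:
  assumes lam1: "lam \<le> 1"
    and edge: "\<And>u v. u \<in> A \<Longrightarrow> v \<in> A \<Longrightarrow> adj E u v \<Longrightarrow>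
      par u = v \<and> h u = Suc (h v) \<or> par v = u \<and> h v = Suc (h u)"
  shows "B \<subseteq> A \<Longrightarrow> finite B \<Longrightarrow> (\<And>x. x \<in> B \<Longrightarrow> a \<le> h x \<and> h x < a + k) \<Longrightarrow> PC B (4 * 3 ^ k)"
proof (induction k arbitrary: a B)
  case 0
  then have "B = {}" by force
  then show ?case by (simp add: PC_empty)
next
  case (Suc k)
  from Suc.prems show ?case
  proof (induction "card B" arbitrary: B rule: less_induct)
    case less
    show ?case
    proof (cases "\<exists>r\<in>B. h r = a")
      case False
      have "PC B (4 * 3 ^ k)"
        by (rule Suc.IH[of B "Suc a"]) (use less.prems False in \<open>auto simp: Suc_le_eq le_neq_implies_less\<close>)
      then show ?thesis by (rule PC_mono) simp
    next
      case True
      then obtain r where r: "r \<in> B" "h r = a" by blast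
      \<comment> \<open>Parent steps inside \<open>B\<close> only; \<open>D\<close> is the tree
        hanging below \<open>r\<close>. An edge between \<open>D\<close> and the rest of
        \<open>B\<close> would be a parent edge and put both ends into \<open>D\<close>, or place a
        vertex below level \<open>a\<close>.\<close>
      define R where "R = {(y, z). y \<in> B \<and> z \<in> B \<and> par y = z \<and> h y = Suc (h z)}"
      define D where "D = {y \<in> B. (y, r) \<in> R\<^sup>*}"
      have lev: "y = r \<or> a < h y" if "(y, r) \<in> R\<^sup>*" for y
        using that by (induction rule: converse_rtrancl_induct) (use r in \<open>auto simp: R_def\<close>)
      have rD: "r \<in> D" using r by (auto simp: D_def)
      have DB: "D \<subseteq> B" by (auto simp: D_def)
      have finD: "finite D" using DB less.prems finite_subset by blast
      have "PC (D - {r}) (4 * 3 ^ k)"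
      proof (rule Suc.IH[of _ "Suc a"])
        fix x assume "x \<in> D - {r}"
        then show "Suc a \<le> h x \<and> h x < Suc a + k"
          using lev[of x] less.prems(3)[of x] by (auto simp: D_def)
      qed (use DB less.prems finD in auto)
      then have PD: "PC D (4 * 3 ^ Suc k)"
      proof (rule PC_delete[OF _ rD finD])
        have "(1 + 2 * lam) * (4 * 3 ^ k) \<le> 3 * (4 * 3 ^ k)"
          using lam1 by (intro mult_right_mono) auto
        then show "(1 + 2 * lam) * (4 * 3 ^ k) \<le> 4 * 3 ^ Suc k" by simp
        have "(1::real) \<le> 3 ^ Suc k" by (rule one_le_power) simp
        then have "4 * (1::real) \<le> 4 * 3 ^ Suc k" by (intro mult_left_mono) auto
        then show "2 * (1 + lam) \<le> 4 * 3 ^ Suc k" using lam1 by argo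
      qed simp
      have "card (B - D) < card B"
        using r rD less.prems by (intro psubset_card_mono) auto
      then have PB: "PC (B - D) (4 * 3 ^ Suc k)"
        by (rule less.hyps) (use less.prems in auto)
      have ne: "\<not> adj E u v" if uv: "u \<in> D" "v \<in> B - D" for u v
      proof
        assume "adj E u v"
        then consider "par u = v" "h u = Suc (h v)" | "par v = u" "h v = Suc (h u)"
          using edge[of u v] uv DB less.prems by blast
        then show False
        proof cases
          case 1
          have "u \<noteq> r" using 1 r uv less.prems(3)[of v] by auto
          moreover have "(u, r) \<in> R\<^sup>*" using uv by (auto simp: D_def)
          ultimately obtain z where "(u, z) \<in> R" "(z, r) \<in> R\<^sup>*"
            by (meson converse_rtranclE)
          then show False using 1 uv by (auto simp: R_def D_def)
        next
          case 2
          then have "(v, u) \<in> R" using uv DB by (auto simp: R_def)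
          then show False using uv by (auto simp: D_def intro: converse_rtrancl_into_rtrancl)
        qed
      qed
      have "PC (D \<union> (B - D)) (4 * 3 ^ Suc k)"
        by (rule PC_union) (use ne PD PB finD less.prems in auto)
      then show ?thesis using DB by (simp add: Un_absorb1)
    qed
  qed
qed

abbreviation p :: real where "p \<equiv> lam / (1 + lam)"

lemma p_pos: "0 < p"
  using lam_pos by simp

text \<open>\<open>psi a k B x\<close> is the sum over the self-avoiding paths of length between \<open>1\<close> and \<open>k\<close> that start in \<open>x\<close>
  and then stay in \<open>B\<close> of \<open>p ^ length * a (endpoint)\<close>.\<close>

primrec psi :: "(nat \<Rightarrow> real) \<Rightarrow> nat \<Rightarrow> nat set \<Rightarrow> nat \<Rightarrow> real" where
  "psi a 0 B x = 0"
| "psi a (Suc k) B x = (\<Sum>u\<in>{u \<in> B. adj E x u}. p * (a u + psi a k (B - {u}) u))"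

lemma psi_nonneg: "(\<And>y. 0 \<le> a y) \<Longrightarrow> 0 \<le> psi a k B x"
  by (induction k arbitrary: B x)
     (use lam_pos in \<open>auto intro!: sum_nonneg mult_nonneg_nonneg add_nonneg_nonneg divide_nonneg_nonneg\<close>)

lemma psi_mono:
  assumes a: "\<And>y. 0 \<le> a y"
  shows "A \<subseteq> B \<Longrightarrow> finite B \<Longrightarrow> psi a k A x \<le> psi a k B x"
proof (induction k arbitrary: A B x)
  case (Suc k)
  have "(\<Sum>u\<in>{u \<in> A. adj E x u}. p * (a u + psi a k (A - {u}) u))
      \<le> (\<Sum>u\<in>{u \<in> A. adj E x u}. p * (a u + psi a k (B - {u}) u))"
    using Suc.prems p_pos by (intro sum_mono mult_left_mono add_left_mono Suc.IH) auto
  also have "\<dots> \<le> (\<Sum>u\<in>{u \<in> B. adj E x u}. p * (a u + psi a k (B - {u}) u))"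
    using Suc.prems p_pos a psi_nonneg[of a, OF a]
    by (intro sum_mono2) (auto intro!: mult_nonneg_nonneg add_nonneg_nonneg simp del: times_divide_eq_left)
  finally show ?case by simp
qed simp

text \<open>The conditional law inside \<open>B\<close> does not see \<open>x\<close>, so the same
  interior \<open>S\<close> can be used with and without \<open>x\<close>.\<close>

lemma ex_nonadjacent:
  assumes s: "s \<in> \<I>" "x \<in> s" "x \<notin> B" and nb: "\<And>u. u \<in> B \<Longrightarrow> \<not> adj E x u"
    and osc: "\<And>r. r \<in> \<I> \<Longrightarrow> x \<in> r \<Longrightarrow> \<bar>f r - f (r - {x})\<bar> \<le> c"
  shows "\<bar>ex B f s - ex B f (s - {x})\<bar> \<le> c"
proof -
  have t: "s - {x} \<in> \<I>" by (rule I_down[OF s(1)]) auto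
  have "S \<union> (s - B) \<in> \<I> \<longleftrightarrow> S \<union> (s - {x} - B) \<in> \<I>" if "S \<subseteq> B" for S
  proof -
    have "S \<union> (s - B) = insert x (S \<union> (s - {x} - B))" using s by auto
    moreover have "x \<in> V" "\<forall>v\<in>S \<union> (s - {x} - B). \<not> adj E x v"
      using s nb that by (auto simp: indep_sets_def)
    ultimately show ?thesis by (simp add: insert_I)
  qed
  then have e: "ext B (s - {x} - B) = ext B (s - B)" by (auto simp: ext_def)
  let ?Y = "ext B (s - B)"
  have Y: "?Y = (\<lambda>r. r \<inter> B) ` fib B s"
  proof -
    have "S \<in> (\<lambda>r. r \<inter> B) ` fib B s" if "S \<in> ?Y" for S
      by (rule image_eqI[of _ _ "S \<union> (s - B)"]) (use that in \<open>auto simp: ext_def fib_def\<close>)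
    moreover have "r \<inter> B \<in> ?Y" if "r \<in> fib B s" for r
    proof -
      have "s - B = r - B" "r \<in> \<I>" using that by (auto simp: fib_def)
      moreover have "r \<inter> B \<union> (r - B) = r" by blast
      ultimately show ?thesis by (simp add: ext_def)
    qed
    ultimately show ?thesis by blast
  qed
  have finY: "finite ?Y" unfolding Y by simp
  have Ypos: "0 < sum wt ?Y"
    using finY fib_self[OF s(1)] by (intro sum_pos) (auto simp: Y)
  have "ex B f s - ex B f (s - {x}) = (\<Sum>S\<in>?Y. wt S * (f (S \<union> (s - B)) - f (S \<union> (s - {x} - B)))) / sum wt ?Y"
    unfolding ex_ext[OF s(1)] ex_ext[OF t] e by (simp add: diff_divide_distrib sum_subtractf right_diff_distrib)
  moreover have "\<bar>\<Sum>S\<in>?Y. wt S * (f (S \<union> (s - B)) - f (S \<union> (s - {x} - B)))\<bar> \<le> (\<Sum>S\<in>?Y. wt S * c)"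
  proof (rule order_trans[OF sum_abs sum_mono])
    fix S assume S: "S \<in> ?Y"
    then have "S \<union> (s - B) - {x} = S \<union> (s - {x} - B)" "S \<union> (s - B) \<in> \<I>" "x \<in> S \<union> (s - B)"
      using s by (auto simp: ext_def)
    then have "\<bar>f (S \<union> (s - B)) - f (S \<union> (s - {x} - B))\<bar> \<le> c"
      using osc by metis
    then show "\<bar>wt S * (f (S \<union> (s - B)) - f (S \<union> (s - {x} - B)))\<bar> \<le> wt S * c"
      by (simp add: abs_mult mult_left_mono)
  qed
  ultimately show ?thesis
    using Ypos by (simp add: divide_le_eq sum_distrib_left mult.commute)
qed

text \<open>Reveal the neighbours of \<open>x\<close> in \<open>B\<close> one at a time. With
  \<open>x\<close> present, a neighbour \<open>u\<close> is forced out; with \<open>x\<close>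
  absent, it is in with probability at most \<open>p\<close>. The difference therefore splits into
  the same question for \<open>x\<close> on \<open>B - {u}\<close> and, with a factor at most
  \<open>p\<close>, a new disagreement at \<open>u\<close> on \<open>B - {u}\<close>. Removing
  \<open>u\<close> from the block keeps the paths self-avoiding, and \<open>card B \<le> k\<close>
  ensures that none is cut off.\<close>

lemma ex_influence:
  assumes a: "\<And>y. 0 \<le> a y"
    and osc: "\<And>r y. r \<in> \<I> \<Longrightarrow> y \<in> r \<Longrightarrow> \<bar>f r - f (r - {y})\<bar> \<le> a y"
  shows "finite B \<Longrightarrow> card B \<le> k \<Longrightarrow> s \<in> \<I> \<Longrightarrow> x \<in> s \<Longrightarrow> x \<notin> B \<Longrightarrow>
    \<bar>ex B f s - ex B f (s - {x})\<bar> \<le> a x + psi a k B x"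
proof (induction "card B" arbitrary: B k s x rule: less_induct)
  case less
  show ?case
  proof (cases "\<exists>u\<in>B. adj E x u")
    case False
    then have "\<bar>ex B f s - ex B f (s - {x})\<bar> \<le> a x"
      using less.prems osc by (intro ex_nonadjacent) auto
    then show ?thesis using psi_nonneg[of a k B x, OF a] by linarith
  next
    case True
    then obtain u where u: "u \<in> B" "adj E x u" by blast
    define B' where "B' = B - {u}"
    have cB: "card B' < card B" "finite B'"
      using u less.prems card_Diff1_less[of B u] by (auto simp: B'_def)
    obtain k' where k: "k = Suc k'" using less.prems cB by (cases k) auto
    have ck: "card B' \<le> k'" "card B' \<le> k" using cB less.prems k by auto
    have sB: "s - B \<in> \<I>" "x \<in> s - B" using less.prems I_down[of s "s - B"] by auto
    define t where "t = s - {x}"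
    define t0 where "t0 = t - B"
    have tI: "t \<in> \<I>" unfolding t_def by (rule I_down[OF less.prems(3)]) auto
    have t0I: "t0 \<in> \<I>" unfolding t0_def by (rule I_down[OF tI]) auto
    have t0: "t0 = s - B - {x}" by (auto simp: t0_def t_def)
    have "u \<notin> r" if "r \<in> fib B s" for r
    proof -
      have "x \<in> r" "r \<in> \<I>" using that less.prems by (auto simp: fib_def)
      then show ?thesis using u by (auto simp: indep_sets_def)
    qed
    then have "fib B' (s - B) = fib B s"
      unfolding B'_def fib_del_out[OF u(1) less.prems(3)] by auto
    then have exs: "ex B f s = ex B' f (s - B)" by (simp add: ex_def)
    have IH1: "\<bar>ex B' f (s - B) - ex B' f t0\<bar> \<le> a x + psi a k B' x"
      unfolding t0 using cB ck sB by (intro less.hyps) (auto simp: B'_def)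
    \<comment> \<open>Paths from \<open>x\<close> are sorted by whether they begin with
      \<open>u\<close>; the others may be restricted to \<open>B - {u}\<close>, which only lowers
      the sum.\<close>
    have split: "psi a k B' x + p * (a u + psi a k' B' u) \<le> psi a k B x"
    proof -
      have "psi a k B' x \<le> (\<Sum>w\<in>{w \<in> B. adj E x w} - {u}. p * (a w + psi a k' (B - {w}) w))"
      proof -
        have "psi a k B' x = (\<Sum>w\<in>{w \<in> B. adj E x w} - {u}. p * (a w + psi a k' (B' - {w}) w))"
          by (auto simp: k B'_def intro!: sum.cong)
        also have "\<dots> \<le> (\<Sum>w\<in>{w \<in> B. adj E x w} - {u}. p * (a w + psi a k' (B - {w}) w))"
          using p_pos less.prems a by (intro sum_mono mult_left_mono add_left_mono psi_mono) (auto simp: B'_def)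
        finally show ?thesis .
      qed
      moreover have "psi a k B x = p * (a u + psi a k' B' u) + (\<Sum>w\<in>{w \<in> B. adj E x w} - {u}. p * (a w + psi a k' (B - {w}) w))"
        unfolding k B'_def psi.simps using u less.prems by (intro sum.remove) auto
      ultimately show ?thesis by linarith
    qed
    have a': "0 \<le> p * (a u + psi a k' B' u)"
      using p_pos a psi_nonneg[of a, OF a] by (intro mult_nonneg_nonneg add_nonneg_nonneg) auto
    have X0: "fib B' t0 = {r \<in> fib B t. u \<notin> r}"
      unfolding B'_def t0_def by (rule fib_del_out[OF u(1) tI])
    have "\<bar>ex B' f t0 - ex B f t\<bar> \<le> p * (a u + psi a k' B' u)"
    proof (cases "insert u t0 \<in> \<I>")
      case False
      have "u \<notin> r" if r: "r \<in> fib B t" for r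
      proof
        assume "u \<in> r"
        then have "insert u t0 \<subseteq> r" using r by (auto simp: fib_def t0_def)
        then show False using False r I_down fib_I by blast
      qed
      then have "fib B' t0 = fib B t" using X0 by auto
      then show ?thesis using a' by (simp add: ex_def)
    next
      case True
      have X1: "fib B' (insert u t0) = {r \<in> fib B t. u \<in> r}"
        using fib_del_in[of u B t] u True by (simp add: B'_def t0_def)
      define w0 where "w0 = wsum (fib B' t0) (\<lambda>_. 1)"
      define w1 where "w1 = wsum (fib B' (insert u t0)) (\<lambda>_. 1)"
      have w: "0 < w0" "0 < w1" unfolding w0_def w1_def using t0I True by (auto intro: W_pos)
      have "w1 = lam * wsum {r \<in> fib B t. u \<notin> r \<and> insert u r \<in> \<I>} (\<lambda>_. 1)"
        unfolding w1_def X1 by (rule wsum_in_image[OF u(1) tI])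
      also have "\<dots> \<le> lam * w0"
        using lam_pos unfolding w0_def X0 wsum_def by (intro mult_left_mono sum_mono2) auto
      finally have w1: "w1 \<le> lam * w0" .
      \<comment> \<open>The conditional probability that \<open>u\<close> is occupied once
        \<open>x\<close> is removed. It is at most \<open>p\<close>, since each configuration with
        \<open>u\<close> comes from one without it at the cost of a factor
        \<open>lam\<close>.\<close>
      define q where "q = w1 / (w0 + w1)"
      have "w1 * (1 + lam) \<le> lam * (w0 + w1)" using w1 by (simp add: algebra_simps)
      then have q: "0 \<le> q" "q \<le> p"
        using w lam_pos by (auto simp: q_def divide_simps algebra_simps)
      have sp: "wsum (fib B t) g = wsum (fib B' t0) g + wsum (fib B' (insert u t0)) g" for g
        unfolding X0 X1 by (rule wsum_split)
      have "ex B f t = (w0 * ex B' f t0 + w1 * ex B' f (insert u t0)) / (w0 + w1)"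
        unfolding ex_def[of B] sp using wsum_ex[OF t0I, of B' f] wsum_ex[OF True, of B' f]
        by (simp add: w0_def w1_def)
      then have "ex B' f t0 - ex B f t = - q * (ex B' f (insert u t0) - ex B' f t0)"
        using w by (simp add: q_def field_simps)
      then have "\<bar>ex B' f t0 - ex B f t\<bar> = q * \<bar>ex B' f (insert u t0) - ex B' f (insert u t0 - {u})\<bar>"
        using q u by (simp add: abs_mult t0_def)
      also have "\<dots> \<le> p * (a u + psi a k' B' u)"
        by (intro mult_mono less.hyps) (use q cB ck True p_pos in \<open>auto simp: B'_def\<close>)
      finally show ?thesis .
    qed
    then show ?thesis using exs IH1 split unfolding t_def by linarith
  qed
qed

definition out :: "nat set \<Rightarrow> nat \<Rightarrow> nat" where
  "out H x = card {u \<in> V - H. adj E x u}"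

lemma finite_nb: "finite {u. adj E x u}"
  by (rule finite_subset[of _ V]) (use adj_V in auto)

lemma out_le_deg: "out H x \<le> deg E x"
  unfolding out_def deg_def by (rule card_mono[OF finite_nb]) auto

lemma deg_le_exp:
  fixes d D :: real
  assumes "D > 0"
  shows "d \<le> D * exp (d / D - 1)"
proof -
  have "d / D \<le> exp (d / D - 1)" using exp_ge_add_one_self[of "d / D - 1"] by simp
  then show ?thesis using assms by (simp add: field_simps)
qed

text \<open>The weights \<open>a\<close> count the exits from \<open>H\<close>. The hypothesis on \<open>t\<close> bounds the product of \<open>deg v / D\<close>
  along each path, by \<open>y \<le> exp (y - 1)\<close>.\<close>

lemma psi_super:
  assumes D: "D > 0" and del: "del > 0" and pD: "p * D * (1 + del) \<le> 1" and c: "c \<ge> 0"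
    and HV: "H \<subseteq> V"
    and a: "\<And>u. a u = c * (p * out H u + del / (1 + del))"
  shows "B \<subseteq> H \<Longrightarrow> x \<notin> B \<Longrightarrow>
    (\<And>U. conn E U \<Longrightarrow> x \<in> U \<Longrightarrow> U \<subseteq> insert x B \<Longrightarrow> (\<Sum>v\<in>U. deg E v / D - 1) \<le> t) \<Longrightarrow>
    psi a k B x + c * p * out H x \<le> c * exp t / (1 + del)"
proof (induction k arbitrary: B x t)
  case 0
  have "deg E x / D - 1 \<le> t" using 0(3)[of "{x}"] by (auto intro: conn.single)
  then have "real (deg E x) \<le> D * exp t"
    using deg_le_exp[OF D, of "deg E x"] D by (meson exp_le_cancel_iff mult_left_mono order_trans less_imp_le)
  then have "p * out H x \<le> p * (D * exp t)"
    using p_pos out_le_deg[of H x] by (intro mult_left_mono) auto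
  also have "\<dots> = p * D * exp t" by simp
  also have "\<dots> \<le> (1 / (1 + del)) * exp t"
    using pD del by (intro mult_right_mono) (auto simp: pos_le_divide_eq)
  finally have "c * (p * out H x) \<le> c * ((1 / (1 + del)) * exp t)"
    using c by (rule mult_left_mono)
  then show ?case by (simp add: mult.assoc)
next
  case (Suc k)
  define d where "d = real (deg E x)"
  define N where "N = {u \<in> B. adj E x u}"
  define M where "M = {u \<in> V - H. adj E x u}"
  have finM: "finite N" "finite M" by (auto simp: N_def M_def intro!: finite_subset[OF _ finite_nb[of x]])
  show ?case
  proof (cases "deg E x = 0")
    case True
    then have "{u. adj E x u} = {}" using finite_nb[of x] by (simp add: deg_def)
    then have "N = {}" "out H x = 0" using out_le_deg[of H x] True by (auto simp: N_def)
    then show ?thesis using c del by (simp flip: N_def)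
  next
    case False
    then have d: "d > 0" by (simp add: d_def)
    have t: "d / D - 1 \<le> t" using Suc.prems(3)[of "{x}"] by (auto intro: conn.single simp: d_def)
    \<comment> \<open>The allowance per neighbour of \<open>x\<close>, divided by \<open>c\<close>:
      the target bound shared equally among \<open>d\<close> neighbours. Neighbours inside
      \<open>B\<close> (\<open>N\<close>) and outside \<open>H\<close> (\<open>M\<close>) each get
      it, so the mixture of the two kinds does not matter.\<close>
    define Z where "Z = exp t / ((1 + del) * d)"
    have Zt: "p * exp (t - (d / D - 1)) \<le> Z"
    proof -
      have "exp (t - (d / D - 1)) = exp t / exp (d / D - 1)" by (rule exp_diff)
      also have "\<dots> \<le> exp t / (d / D)"
        using d D deg_le_exp[OF D, of d] by (intro divide_left_mono) (auto simp: field_simps)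
      finally have "p * exp (t - (d / D - 1)) \<le> p * (exp t / (d / D))"
        using p_pos by (intro mult_left_mono) auto
      also have "\<dots> = (p * D) * (exp t / d)" by simp
      also have "\<dots> \<le> (1 / (1 + del)) * (exp t / d)"
        using pD del d by (intro mult_right_mono) (auto simp: pos_le_divide_eq)
      finally show ?thesis by (simp add: Z_def)
    qed
    have "p * exp 0 \<le> p * exp (t - (d / D - 1))" using t p_pos by (intro mult_left_mono) auto
    then have pZ: "p \<le> Z" using Zt by simp
    have Z0: "0 \<le> Z" using pZ p_pos by linarith
    have trm: "p * (a u + psi a k (B - {u}) u) \<le> c * Z" if u: "u \<in> N" for u
    proof -
      \<comment> \<open>Stepping to \<open>u\<close> spends the share \<open>d / D - 1\<close> of
        \<open>x\<close>: a connected set through \<open>u\<close> that avoids \<open>x\<close> can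
        be enlarged by \<open>x\<close> and is then covered by the budget \<open>t\<close>.\<close>
      have "psi a k (B - {u}) u + c * p * out H u \<le> c * exp (t - (d / D - 1)) / (1 + del)"
      proof (rule Suc.IH)
        fix U assume U: "conn E U" "u \<in> U" "U \<subseteq> insert u (B - {u})"
        have xU: "x \<notin> U" using U u Suc.prems(2) by (auto simp: N_def)
        have "conn E (insert x U)"
          using U u by (intro conn_insert[of E U u]) (auto simp: N_def adj_sym)
        then have "(\<Sum>v\<in>insert x U. deg E v / D - 1) \<le> t"
          using U u by (intro Suc.prems) (auto simp: N_def)
        then show "(\<Sum>v\<in>U. deg E v / D - 1) \<le> t - (d / D - 1)"
          using xU conn_finite[OF U(1)] by (simp add: d_def)
      qed (use Suc.prems in auto)
      \<comment> \<open>The exits in \<open>a u\<close> are already contained in the induction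
        hypothesis. What remains is \<open>del / (1 + del)\<close>, which completes
        \<open>1 / (1 + del)\<close> to 1.\<close>
      then have "a u + psi a k (B - {u}) u \<le> c * (exp (t - (d / D - 1)) / (1 + del) + del / (1 + del))"
        by (simp add: a algebra_simps)
      then have "p * (a u + psi a k (B - {u}) u) \<le> p * (c * (exp (t - (d / D - 1)) / (1 + del) + del / (1 + del)))"
        using p_pos by (intro mult_left_mono) auto
      also have "\<dots> = c * ((p * exp (t - (d / D - 1))) / (1 + del) + p * del / (1 + del))"
        by (simp add: algebra_simps)
      also have "\<dots> \<le> c * (Z / (1 + del) + Z * del / (1 + del))"
        using c del Zt pZ by (intro mult_left_mono add_mono divide_right_mono mult_right_mono) auto
      also have "Z / (1 + del) + Z * del / (1 + del) = Z * (1 + del) / (1 + del)"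
        by (simp add: distrib_left add_divide_distrib)
      also have "\<dots> = Z" using del by simp
      finally show ?thesis .
    qed
    have "psi a (Suc k) B x + c * p * out H x = (\<Sum>u\<in>N. p * (a u + psi a k (B - {u}) u)) + (\<Sum>u\<in>M. c * p)"
      by (simp add: N_def M_def out_def)
    also have "\<dots> \<le> (\<Sum>u\<in>N. c * Z) + (\<Sum>u\<in>M. c * Z)"
      using c pZ by (intro add_mono sum_mono trm mult_left_mono) auto
    also have "\<dots> = real (card (N \<union> M)) * (c * Z)"
      using finM Suc.prems by (subst card_Un_disjoint) (auto simp: N_def M_def algebra_simps)
    also have "\<dots> \<le> d * (c * Z)"
      using c Z0 unfolding d_def deg_def
      by (intro mult_right_mono of_nat_mono card_mono[OF finite_nb]) (auto simp: N_def M_def)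
    also have "\<dots> = c * exp t / (1 + del)"
      using d by (simp add: Z_def)
    finally show ?thesis .
  qed
qed


section \<open>Spectral gap\<close>

definition ip :: "(nat set \<Rightarrow> real) \<Rightarrow> (nat set \<Rightarrow> real) \<Rightarrow> real" where
  "ip f g = wsum \<I> (\<lambda>s. f s * g s)"

lemma ip_commute: "ip f g = ip g f"
  by (simp add: ip_def mult.commute)

lemma ip_nonneg: "0 \<le> ip f f"
  unfolding ip_def by (intro wsum_nonneg) simp

lemma ip_CS: "(ip f g)\<^sup>2 \<le> ip f f * ip g g"
proof -
  have "(\<Sum>s\<in>\<I>. (sqrt (wt s) * f s) * (sqrt (wt s) * g s))\<^sup>2
      \<le> (\<Sum>s\<in>\<I>. (sqrt (wt s) * f s)\<^sup>2) * (\<Sum>s\<in>\<I>. (sqrt (wt s) * g s)\<^sup>2)"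
    by (rule Cauchy_Schwarz_ineq_sum)
  moreover have "sqrt (wt s) * f s * (sqrt (wt s) * g s) = wt s * (f s * g s)" for s
    by (simp add: algebra_simps flip: mult.assoc[of "sqrt (wt s)" "sqrt (wt s)"])
  ultimately show ?thesis
    by (simp add: ip_def wsum_def power_mult_distrib power2_eq_square[of "f _"] power2_eq_square[of "g _"])
qed

lemma ip_ex: "B \<subseteq> V \<Longrightarrow> ip f (ex B g) = ip (ex B f) g"
  using ex_local_sa[of B V "{}" f g] by (simp add: ip_def fib_V)

lemma wsum_I_ex: "B \<subseteq> V \<Longrightarrow> wsum \<I> (ex B f) = wsum \<I> f"
  using ex_tower[of B V f "{}"] W_pos[OF empty_I, of V] by (simp add: ex_def[of V] fib_V)

lemma ip_var:
  assumes "B \<subseteq> V"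
  shows "ip f f - ip f (ex B f) = wsum \<I> (var B f)"
proof -
  have "ip f (ex B f) = ip f (ex B (ex B f))"
    unfolding ip_def by (rule wsum_cong) (simp add: ex_tower)
  also have "\<dots> = ip (ex B f) (ex B f)" by (rule ip_ex[OF assms])
  finally show ?thesis
    unfolding var_def[abs_def] wsum_diff wsum_I_ex[OF assms] by (simp add: ip_def power2_eq_square)
qed

text \<open>For self-adjoint \<open>T\<close> Cauchy-Schwarz makes the ratios of successive squared
  norms nondecreasing, so a first ratio above \<open>\<rho>\<^sup>2\<close> would persist and
  eventually beat any \<open>C\<close>. As \<open>C\<close> may depend on \<open>f\<close>, the
  comparison between the Lipschitz seminorm and the norm costs nothing in the gap.\<close>

lemma iterate_bound_imp_contraction:
  assumes sa: "\<And>f g. ip f (T g) = ip (T f) g" and rho: "\<rho> > 0"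
    and bound: "\<And>t. ip ((T ^^ t) f) ((T ^^ t) f) \<le> C * \<rho> ^ (2 * t)"
  shows "ip (T f) (T f) \<le> \<rho>\<^sup>2 * ip f f"
proof (rule ccontr)
  define a where "a t = ip ((T ^^ t) f) ((T ^^ t) f)" for t
  assume "\<not> ip (T f) (T f) \<le> \<rho>\<^sup>2 * ip f f"
  then have a1: "a 1 > \<rho>\<^sup>2 * a 0" by (simp add: a_def)
  have nn: "a t \<ge> 0" for t by (simp add: a_def ip_nonneg)
  have lc: "(a (Suc t))\<^sup>2 \<le> a t * a (Suc (Suc t))" for t
    using ip_CS[of "(T ^^ t) f" "T (T ((T ^^ t) f))"] by (simp add: a_def sa)
  have a0: "a 0 > 0"
  proof (rule ccontr)
    assume "\<not> a 0 > 0"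
    then have "a 0 = 0" using nn[of 0] by simp
    then show False using lc[of 0] a1 by simp
  qed
  define r where "r = a 1 / a 0"
  have r: "r > \<rho>\<^sup>2" using a1 a0 by (simp add: r_def less_divide_eq)
  have rpos: "r > 0" using r by (meson less_trans rho zero_less_power)
  have step: "a t > 0 \<and> a (Suc t) \<ge> r * a t" for t
  proof (induction t)
    case 0 then show ?case using a0 by (simp add: r_def)
  next
    case (Suc t)
    have p1: "a (Suc t) > 0" using Suc rpos by (smt (verit) mult_pos_pos)
    have "(r * a t) * a (Suc t) \<le> a (Suc t) * a (Suc t)"
      using Suc p1 by (intro mult_right_mono) auto
    also have "\<dots> \<le> a t * a (Suc (Suc t))" using lc[of t] by (simp add: power2_eq_square)
    finally have "a t * (r * a (Suc t)) \<le> a t * a (Suc (Suc t))" by (simp add: algebra_simps)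
    then show ?case using p1 Suc by simp
  qed
  have low: "a t \<ge> r ^ t * a 0" for t
  proof (induction t)
    case (Suc t)
    have "r ^ Suc t * a 0 = r * (r ^ t * a 0)" by simp
    also have "\<dots> \<le> r * a t" using Suc rpos by (intro mult_left_mono) auto
    finally show ?case using step[of t] by linarith
  qed simp
  have "r / \<rho>\<^sup>2 > 1" using r rho by (simp add: less_divide_eq)
  then obtain t where t: "C / a 0 < (r / \<rho>\<^sup>2) ^ t" using real_arch_pow by blast
  have "r ^ t * a 0 \<le> C * (\<rho>\<^sup>2) ^ t"
    using low[of t] bound[of t] by (simp add: a_def power_mult)
  then have "(r / \<rho>\<^sup>2) ^ t \<le> C / a 0"
    using a0 rho by (simp add: power_divide field_simps)
  then show False using t by linarith
qed

section \<open>Weighted Lipschitz seminorm and contraction of the block dynamics\<close>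

definition lip :: "(nat \<Rightarrow> real) \<Rightarrow> real \<Rightarrow> (nat set \<Rightarrow> real) \<Rightarrow> bool" where
  "lip w L f \<longleftrightarrow> (\<forall>s\<in>\<I>. \<forall>x\<in>s. \<bar>f s - f (s - {x})\<bar> \<le> L * w x)"

lemma lip_exists:
  assumes w: "\<And>x. w x > 0"
  shows "\<exists>L\<ge>0. lip w L f"
proof -
  define S where "S = (\<lambda>(s, x). \<bar>f s - f (s - {x})\<bar> / w x) ` (\<I> \<times> V)"
  have fin: "finite S" by (simp add: S_def)
  define L where "L = Max (insert 0 S)"
  have "\<bar>f s - f (s - {x})\<bar> \<le> L * w x" if s: "s \<in> \<I>" "x \<in> s" for s x
  proof -
    have "(s, x) \<in> \<I> \<times> V" using s I_sub by blast
    then have "\<bar>f s - f (s - {x})\<bar> / w x \<in> insert 0 S" by (force simp: S_def)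
    then have "\<bar>f s - f (s - {x})\<bar> / w x \<le> L" using fin by (simp add: L_def)
    then show ?thesis using w[of x] by (simp add: divide_le_eq)
  qed
  moreover have "L \<ge> 0" using fin by (simp add: L_def)
  ultimately show ?thesis by (auto simp: lip_def)
qed

text \<open>Subsets of independent sets are independent, so every configuration can be emptied
  vertex by vertex inside \<I>.\<close>

lemma lip_base:
  assumes lip: "lip w L f" and w: "\<And>x. w x \<ge> 0" and L: "L \<ge> 0" and s: "s \<in> \<I>"
  shows "\<bar>f s - f {}\<bar> \<le> L * (\<Sum>x\<in>V. w x)"
proof -
  have "s \<in> \<I> \<Longrightarrow> \<bar>f s - f {}\<bar> \<le> L * (\<Sum>x\<in>s. w x)"
    using I_finite[OF s]
  proof (induction rule: finite_induct)
    case (insert x s)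
    have "s \<in> \<I>" using insert.prems I_down by blast
    then have "\<bar>f s - f {}\<bar> \<le> L * (\<Sum>x\<in>s. w x)" by (rule insert.IH)
    moreover have "\<bar>f (insert x s) - f (insert x s - {x})\<bar> \<le> L * w x"
      using lip insert.prems unfolding lip_def by blast
    ultimately show ?case using insert by (simp add: algebra_simps)
  qed simp
  also have "L * (\<Sum>x\<in>s. w x) \<le> L * (\<Sum>x\<in>V. w x)"
    using L w I_sub[OF s] by (intro mult_left_mono sum_mono2) auto
  finally show ?thesis using s by simp
qed

lemma lip_mean_zero:
  assumes lip: "lip w L f" and w: "\<And>x. w x \<ge> 0" and L: "L \<ge> 0"
    and zero: "wsum \<I> f = 0"
  shows "ip f f \<le> wsum \<I> (\<lambda>_. 1) * (2 * L * (\<Sum>x\<in>V. w x))\<^sup>2"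
proof -
  let ?b = "L * (\<Sum>x\<in>V. w x)"
  have W: "wsum \<I> (\<lambda>_. 1) > 0" by (intro wsum_pos) (use empty_I in \<open>auto simp del: empty_I\<close>)
  have "\<bar>wsum \<I> (\<lambda>_. 1) * f {}\<bar> \<le> wsum \<I> (\<lambda>_. 1) * ?b"
  proof -
    have "wsum \<I> (\<lambda>_. 1) * f {} = wsum \<I> (\<lambda>s. f {} * 1) - wsum \<I> f"
      unfolding wsum_cmult using zero by simp
    also have "\<dots> = (\<Sum>s\<in>\<I>. wt s * (f {} - f s))"
      unfolding wsum_diff[symmetric] by (simp add: wsum_def)
    also have "\<bar>\<dots>\<bar> \<le> (\<Sum>s\<in>\<I>. wt s * ?b)"
    proof (rule order_trans[OF sum_abs sum_mono])
      fix s assume "s \<in> \<I>"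
      then have "\<bar>f {} - f s\<bar> \<le> ?b" using lip_base[OF lip w L, of s] by simp
      then show "\<bar>wt s * (f {} - f s)\<bar> \<le> wt s * ?b"
        by (simp only: abs_mult abs_of_nonneg[OF wt_nonneg] mult_left_mono wt_nonneg)
    qed
    finally show ?thesis by (simp add: wsum_def sum_distrib_right)
  qed
  then have f0: "\<bar>f {}\<bar> \<le> ?b" using W by (simp add: abs_mult)
  have "(f s)\<^sup>2 \<le> (2 * L * (\<Sum>x\<in>V. w x))\<^sup>2" if "s \<in> \<I>" for s
  proof (rule abs_le_square_iff[THEN iffD1])
    have "\<bar>f s\<bar> \<le> 2 * ?b" using lip_base[OF lip w L that] f0 by linarith
    then show "\<bar>f s\<bar> \<le> \<bar>2 * L * (\<Sum>x\<in>V. w x)\<bar>" by (simp add: mult.assoc)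
  qed
  then have "ip f f \<le> wsum \<I> (\<lambda>_. (2 * L * (\<Sum>x\<in>V. w x))\<^sup>2 * 1)"
    unfolding ip_def by (intro wsum_mono) (simp add: power2_eq_square)
  then show ?thesis unfolding wsum_cmult by (simp add: mult.commute)
qed

lemma psi_cong: "(\<And>u. u \<in> B \<Longrightarrow> a u = b u) \<Longrightarrow> psi a k B x = psi b k B x"
proof (induction k arbitrary: B x)
  case (Suc k)
  have "psi a k (B - {u}) u = psi b k (B - {u}) u" for u
    using Suc.prems by (intro Suc.IH) auto
  then show ?case using Suc.prems by (auto intro!: sum.cong)
qed simp

lemma psi_single: "psi a (Suc 0) {v} x = (if adj E x v then p * a v else 0)"
proof -
  have "{u \<in> {v}. adj E x u} = (if adj E x v then {v} else {})" by auto
  then show ?thesis by simp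
qed

definition T :: "nat set \<Rightarrow> (nat set \<Rightarrow> real) \<Rightarrow> nat set \<Rightarrow> real" where
  "T H f s = (ex H f s + (\<Sum>v\<in>V - H. ex {v} f s)) / (1 + real (card (V - H)))"

lemma ip_T_gen: "ip f (T H g) = (ip f (ex H g) + (\<Sum>v\<in>V - H. ip f (ex {v} g))) / (1 + real (card (V - H)))"
proof -
  let ?m = "1 + real (card (V - H))"
  have "ip f (T H g) = wsum \<I> (\<lambda>s. inverse ?m * (f s * ex H g s + (\<Sum>v\<in>V - H. f s * ex {v} g s)))"
    unfolding ip_def T_def
    by (intro wsum_cong) (simp add: divide_inverse sum_distrib_left sum_distrib_right distrib_left distrib_right mult.commute mult.left_commute)
  also have "\<dots> = inverse ?m * (ip f (ex H g) + (\<Sum>v\<in>V - H. ip f (ex {v} g)))"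
    unfolding wsum_cmult wsum_add wsum_sum ip_def ..
  finally show ?thesis by (simp add: divide_inverse mult.commute)
qed

lemma ip_T: "H \<subseteq> V \<Longrightarrow> ip f (T H g) = ip (T H f) g"
  unfolding ip_commute[of "T H f"] ip_T_gen
  by (simp add: ip_ex ip_commute[of g])

lemma wsum_T: "H \<subseteq> V \<Longrightarrow> wsum \<I> (T H f) = wsum \<I> f"
proof -
  assume H: "H \<subseteq> V"
  have "wsum \<I> (T H f) = ip (\<lambda>_. 1) (T H f)" by (simp add: ip_def)
  also have "\<dots> = wsum \<I> f"
    unfolding ip_T_gen using H by (simp add: ip_def wsum_I_ex) (simp add: field_simps)
  finally show ?thesis .
qed

text \<open>The weights balance two cases. A disagreement inside \<open>H\<close> is erased by the
  block update and spawns at most \<open>p * out H x\<close> outside, so its weight has to exceed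
  that number. One outside is erased by its own update, but spawns new ones in \<open>H\<close>,
  measured by \<open>psi\<close>, and at its outside neighbours; \<open>psi_super\<close> bounds the
  two together. The factor \<open>sqrt (1 + del)\<close> shares the slack \<open>1 + del\<close>
  equally between the cases. The term \<open>del / (1 + del)\<close> keeps \<open>w\<close> positive
  at vertices without exits.\<close>

lemma lip_T:
  assumes H: "H \<subseteq> V" and D: "D > 0" and del: "del > 0" and pD: "p * D * (1 + del) \<le> 1"
    and light: "\<And>x U. x \<in> V - H \<Longrightarrow> conn E U \<Longrightarrow> x \<in> U \<Longrightarrow> U \<subseteq> insert x H \<Longrightarrow>
      (\<Sum>v\<in>U. deg E v / D - 1) \<le> 0"
    and w: "w = (\<lambda>x. if x \<in> H then sqrt (1 + del) * (p * out H x + del / (1 + del)) else 1)"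
    and L: "L \<ge> 0" and lip: "lip w L f"
  shows "lip w ((1 - (1 - 1 / sqrt (1 + del)) / (1 + real (card (V - H)))) * L) (T H f)"
  unfolding lip_def
proof (intro ballI)
  fix s x assume s: "s \<in> \<I>" "x \<in> s"
  let ?r = "sqrt (1 + del)"
  let ?m = "1 + real (card (V - H))"
  have r: "?r > 1" "?r * ?r = 1 + del" using del by auto
  have w0: "w y \<ge> 0" for y using lam_pos del r by (auto simp: w intro!: mult_nonneg_nonneg add_nonneg_nonneg divide_nonneg_nonneg)
  define a where "a y = L * w y" for y
  have a0: "a y \<ge> 0" for y using w0 L by (simp add: a_def)
  have osc: "\<bar>f q - f (q - {y})\<bar> \<le> a y" if "q \<in> \<I>" "y \<in> q" for q y
    using lip that by (simp add: lip_def a_def)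
  define df where "df B = \<bar>ex B f s - ex B f (s - {x})\<bar>" for B
  have inB: "df B = 0" if "x \<in> B" for B
  proof -
    have "s - B = s - {x} - B" using that by auto
    then show ?thesis using ex_minus_B[of B f s] ex_minus_B[of B f "s - {x}"] by (simp add: df_def)
  qed
  have notB: "df B \<le> a x + psi a (card B) B x" if "x \<notin> B" "finite B" for B
    unfolding df_def using that s by (intro ex_influence a0 osc) auto
  have sing: "df {v} \<le> L * w x + (if adj E x v then p * L else 0)" if "v \<in> V - H" "v \<noteq> x" for v
    using notB[of "{v}"] that by (auto simp: psi_single a_def w simp del: psi.simps split: if_splits)
  have outsum: "(\<Sum>v\<in>V - H. if adj E x v then p * L else 0) = p * L * out H x"
  proof -
    have "(\<Sum>v\<in>V - H. if adj E x v then p * L else 0) = (\<Sum>v\<in>{v \<in> V - H. adj E x v}. p * L)"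
      by (rule sum.inter_filter[symmetric]) simp
    then show ?thesis by (simp add: out_def)
  qed
  have tot: "df H + (\<Sum>v\<in>V - H. df {v}) \<le> (?m - 1 + 1 / ?r) * L * w x"
  proof (cases "x \<in> H")
    case True
    have "(\<Sum>v\<in>V - H. df {v}) \<le> (\<Sum>v\<in>V - H. L * w x + (if adj E x v then p * L else 0))"
      using True by (intro sum_mono sing) auto
    also have "\<dots> = (?m - 1) * L * w x + L * (p * out H x)"
      by (simp add: sum.distrib outsum)
    also have "\<dots> \<le> (?m - 1) * L * w x + L * (w x / ?r)"
    proof (intro add_left_mono mult_left_mono)
      show "p * out H x \<le> w x / ?r" using True r del by (simp add: w)
    qed (use L in auto)
    finally show ?thesis using inB[OF True] by (simp add: algebra_simps)
  next
    case False
    have xV: "x \<in> V - H" using s I_sub False by blast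
    have wx: "w x = 1" using False by (simp add: w)
    have finH: "finite H" using H finite_subset by blast
    define b where "b u = (L * ?r) * (p * out H u + del / (1 + del))" for u
    have "psi a (card H) H x = psi b (card H) H x"
      by (rule psi_cong) (simp add: a_def b_def w)
    \<comment> \<open>\<open>light\<close> says that the budget \<open>t = 0\<close> suffices for a
      start outside \<open>H\<close>.\<close>
    also have "psi b (card H) H x + (L * ?r) * p * out H x \<le> (L * ?r) * exp 0 / (1 + del)"
      by (rule psi_super[OF D del pD _ H])
         (use False xV L r light in \<open>auto simp: b_def\<close>)
    finally have ps: "psi a (card H) H x + ?r * (L * (p * out H x)) \<le> L * (?r / (1 + del))"
      by (simp add: algebra_simps)
    have rr: "?r / (1 + del) = 1 / ?r" using r del by (simp add: field_simps)
    have "1 * (L * (p * out H x)) \<le> ?r * (L * (p * out H x))"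
      using r L p_pos by (intro mult_right_mono mult_nonneg_nonneg) auto
    then have dH: "df H \<le> L + L / ?r - L * (p * out H x)"
      using notB[OF False finH] ps by (simp add: a_def wx rr)
    have "(\<Sum>v\<in>V - H. df {v}) = (\<Sum>v\<in>V - H - {x}. df {v})"
      using xV by (subst sum.remove[of _ x]) (auto simp: inB)
    also have "\<dots> \<le> (\<Sum>v\<in>V - H - {x}. L * w x + (if adj E x v then p * L else 0))"
      by (intro sum_mono sing) auto
    also have "\<dots> = (\<Sum>v\<in>V - H - {x}. L) + (\<Sum>v\<in>V - H - {x}. if adj E x v then p * L else 0)"
      by (simp add: sum.distrib wx)
    also have "(\<Sum>v\<in>V - H - {x}. if adj E x v then p * L else 0) = (\<Sum>v\<in>V - H. if adj E x v then p * L else 0)"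
      using xV adj_irrefl[of x] by (subst (2) sum.remove[of _ x]) auto
    \<comment> \<open>\<open>?m\<close> counts the block and every outside vertex; the block is
      treated in \<open>dH\<close>, and the update of \<open>x\<close> itself contributes 0.\<close>
    also have "(\<Sum>v\<in>V - H - {x}. L) = (?m - 2) * L"
    proof -
      have "card (V - H) \<ge> 1" using xV by (simp add: Suc_le_eq card_gt_0_iff) (auto simp: subset_iff)
      then show ?thesis using xV by (simp add: card_Diff_singleton of_nat_diff)
    qed
    finally show ?thesis using dH outsum by (simp add: wx algebra_simps)
  qed
  have "T H f s - T H f (s - {x})
    = ((ex H f s - ex H f (s - {x})) + (\<Sum>v\<in>V - H. ex {v} f s - ex {v} f (s - {x}))) / ?m"
    by (simp add: T_def diff_divide_distrib[symmetric] sum_subtractf)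
  also have "\<bar>\<dots>\<bar> \<le> (df H + (\<Sum>v\<in>V - H. df {v})) / ?m"
    unfolding df_def abs_divide
    by (simp add: divide_right_mono order_trans[OF abs_triangle_ineq add_left_mono[OF sum_abs]])
  also have "\<dots> \<le> (?m - 1 + 1 / ?r) * L * w x / ?m"
    using tot by (intro divide_right_mono) auto
  also have "\<dots> = (1 - (1 - 1 / ?r) / ?m) * L * w x"
  proof -
    have "(m - 1 + z) / m = 1 - (1 - z) / m" if "m > 0" for m z :: real
      using that by (simp add: field_simps)
    from this[of ?m "1 / ?r"] have "(?m - 1 + 1 / ?r) / ?m = 1 - (1 - 1 / ?r) / ?m" by simp
    then show ?thesis by (metis times_divide_eq_left)
  qed
  finally show "\<bar>T H f s - T H f (s - {x})\<bar> \<le> (1 - (1 - 1 / ?r) / ?m) * L * w x" .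
qed

text \<open>The seminorm contraction bounds all iterates of a mean-zero function, which by
  self-adjointness yields a contraction in norm and by Cauchy-Schwarz a bound on the Dirichlet form
  of \<open>T H\<close>. The number of possible updates divides both the rate and the form and
  cancels. Finally \<open>PC\<close> replaces the block variance by single-site variances.\<close>

lemma glauber_gap:
  assumes H: "H \<subseteq> V" and D: "D > 0" and del: "del > 0" and pD: "p * D * (1 + del) \<le> 1"
    and light: "\<And>x U. x \<in> V - H \<Longrightarrow> conn E U \<Longrightarrow> x \<in> U \<Longrightarrow> U \<subseteq> insert x H \<Longrightarrow>
      (\<Sum>v\<in>U. deg E v / D - 1) \<le> 0"
    and PC: "PC H c" "c \<ge> 1" and zero: "wsum \<I> f = 0"
  shows "(1 - 1 / sqrt (1 + del)) * ip f f \<le> c * (\<Sum>v\<in>V. wsum \<I> (var {v} f))"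
proof -
  let ?r = "sqrt (1 + del)"
  let ?m = "1 + real (card (V - H))"
  define \<rho> where "\<rho> = 1 - (1 - 1 / ?r) / ?m"
  have r: "?r > 1" using del by auto
  have "0 \<le> 1 - 1 / ?r" using r by simp
  then have "(1 - 1 / ?r) / ?m \<le> (1 - 1 / ?r) / 1" by (intro divide_left_mono) auto
  also have "\<dots> < 1" using r by simp
  finally have rho: "\<rho> > 0" by (simp only: \<rho>_def diff_gt_0_iff_gt)
  define w where "w = (\<lambda>x. if x \<in> H then ?r * (p * out H x + del / (1 + del)) else 1)"
  have w: "w x > 0" for x
    using r del lam_pos by (auto simp: w_def intro!: mult_pos_pos add_nonneg_pos divide_nonneg_nonneg)
  have w0: "w x \<ge> 0" for x using w[of x] by linarith
  obtain L where L: "L \<ge> 0" "lip w L f" using lip_exists[of w f, OF w] by blast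
  have it: "lip w (\<rho> ^ t * L) ((T H ^^ t) f) \<and> wsum \<I> ((T H ^^ t) f) = 0" for t
  proof (induction t)
    case (Suc t)
    have "lip w (\<rho> * (\<rho> ^ t * L)) (T H ((T H ^^ t) f))"
      unfolding \<rho>_def
      by (rule lip_T[OF H D del pD light w_def]) (use Suc L rho in \<open>auto simp: \<rho>_def\<close>)
    then show ?case using Suc by (simp add: wsum_T[OF H] mult.assoc)
  qed (use L zero in auto)
  have "ip (T H f) (T H f) \<le> \<rho>\<^sup>2 * ip f f"
  proof (rule iterate_bound_imp_contraction[OF ip_T[OF H] rho])
    fix t
    have "ip ((T H ^^ t) f) ((T H ^^ t) f) \<le> wsum \<I> (\<lambda>_. 1) * (2 * (\<rho> ^ t * L) * (\<Sum>x\<in>V. w x))\<^sup>2"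
      using it[of t] rho L by (intro lip_mean_zero w0) auto
    also have "\<dots> = wsum \<I> (\<lambda>_. 1) * (2 * L * (\<Sum>x\<in>V. w x))\<^sup>2 * \<rho> ^ (2 * t)"
      by (simp add: power_mult_distrib power_mult[symmetric] mult.commute)
    finally show "ip ((T H ^^ t) f) ((T H ^^ t) f) \<le> wsum \<I> (\<lambda>_. 1) * (2 * L * (\<Sum>x\<in>V. w x))\<^sup>2 * \<rho> ^ (2 * t)" .
  qed
  then have "ip f f * ip (T H f) (T H f) \<le> ip f f * (\<rho>\<^sup>2 * ip f f)"
    by (rule mult_left_mono[OF _ ip_nonneg])
  then have "(ip f (T H f))\<^sup>2 \<le> (\<rho> * ip f f)\<^sup>2"
    using ip_CS[of f "T H f"] by (simp add: power_mult_distrib power2_eq_square[of "ip f f"] algebra_simps)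
  then have "ip f (T H f) \<le> \<rho> * ip f f"
    using rho ip_nonneg[of f] power2_le_imp_le by (meson mult_nonneg_nonneg less_imp_le)
  then have "(1 - 1 / ?r) / ?m * ip f f \<le> ip f f - ip f (T H f)"
    by (simp add: \<rho>_def algebra_simps)
  also have "\<dots> = ((ip f f - ip f (ex H f)) + (\<Sum>v\<in>V - H. ip f f - ip f (ex {v} f))) / ?m"
    unfolding ip_T_gen by (simp add: sum_subtractf field_simps)
  also have "\<dots> = (wsum \<I> (var H f) + (\<Sum>v\<in>V - H. wsum \<I> (var {v} f))) / ?m"
    using H by (simp add: ip_var)
  finally have "(1 - 1 / ?r) * ip f f \<le> wsum \<I> (var H f) + (\<Sum>v\<in>V - H. wsum \<I> (var {v} f))"
    by (simp add: divide_le_cancel)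
  also have "wsum \<I> (var H f) \<le> wsum \<I> (\<lambda>s. c * (\<Sum>v\<in>H. ex H (var {v} f) s))"
    using PC by (intro wsum_mono) (auto simp: PC_def)
  also have "\<dots> = c * (\<Sum>v\<in>H. wsum \<I> (var {v} f))"
    unfolding wsum_cmult wsum_sum using H by (simp add: wsum_I_ex)
  also have "(\<Sum>v\<in>V - H. wsum \<I> (var {v} f)) \<le> c * (\<Sum>v\<in>V - H. wsum \<I> (var {v} f))"
  proof -
    have "0 \<le> (\<Sum>v\<in>V - H. wsum \<I> (var {v} f))"
      by (intro sum_nonneg wsum_nonneg var_nonneg)
    then show ?thesis using PC(2) mult_right_mono[of 1 c] by fastforce
  qed
  also have "c * (\<Sum>v\<in>H. wsum \<I> (var {v} f)) + c * (\<Sum>v\<in>V - H. wsum \<I> (var {v} f)) = c * (\<Sum>v\<in>V. wsum \<I> (var {v} f))"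
    using sum.subset_diff[OF H, of "\<lambda>v. wsum \<I> (var {v} f)"] by (simp add: distrib_left add.commute)
  finally show ?thesis by simp
qed


section \<open>Mixing time of the Glauber dynamics\<close>

definition P :: "(nat set \<Rightarrow> real) \<Rightarrow> nat set \<Rightarrow> real" where
  "P f s = (\<Sum>v\<in>V. ex {v} f s) / real n"

lemma ex_single_blocked:
  assumes "s \<in> \<I>" "\<exists>u\<in>s. adj E u v"
  shows "ex {v} f s = f s"
proof (rule ex_const_on[OF assms(1)])
  fix r assume r: "r \<in> fib {v} s"
  obtain u where u: "u \<in> s" "adj E u v" using assms by blast
  have "v \<notin> s" using u assms(1) by (auto simp: indep_sets_def)
  moreover have "u \<in> r" using r u adj_irrefl by (auto simp: fib_def)
  then have "v \<notin> r" using u fib_I[OF r] by (auto simp: indep_sets_def)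
  ultimately have "r = s" using r by (auto simp: fib_def)
  then show "f r = f s" by simp
qed

lemma ex_single_free:
  assumes s: "s \<in> \<I>" "\<not> (\<exists>u\<in>s. adj E u v)" "v \<in> V"
  shows "ex {v} f s = f (insert v s) * p + f (s - {v}) * (1 - p)"
proof -
  define t where "t = s - {v}"
  have t: "t \<in> \<I>" "v \<notin> t" "insert v s = insert v t"
    using I_down[OF s(1), of t] by (auto simp: t_def)
  have "insert v s \<in> \<I>" using s by (auto simp: insert_I adj_sym)
  then have i: "insert v t \<in> \<I>" using t by simp
  have fb: "fib {v} s = {t, insert v t}"
    using s t i by (auto simp: fib_def t_def)
  have ne: "t \<noteq> insert v t" using t by blast
  have "ex {v} f s = (wt t * (f t + lam * f (insert v t))) / (wt t * (1 + lam))"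
    using ne t by (simp add: ex_def fb wsum_def wt_insert I_finite algebra_simps)
  also have "\<dots> = (f t + lam * f (insert v t)) / (1 + lam)"
    using wt_pos[of t] by (simp del: wt_pos)
  also have "\<dots> = f (insert v t) * p + f t * (1 / (1 + lam))"
    by (simp add: add_divide_distrib)
  also have "1 / (1 + lam) = 1 - p"
    using lam_pos by (simp add: field_simps)
  finally show ?thesis unfolding t(3) t_def .
qed

lemma step_closed:
  assumes n: "n > 0" and s: "s \<in> \<I>"
  shows "set_pmf (glauber_step n E lam s) \<subseteq> \<I>"
proof
  fix r assume "r \<in> set_pmf (glauber_step n E lam s)"
  then obtain v where v: "v < n" and r: "r = s - {v} \<or> (\<not> (\<exists>u\<in>s. adj E u v) \<and> r = insert v s)"
    using n by (auto simp: glauber_step_def set_pmf_of_set split: if_splits)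
  show "r \<in> \<I>"
    using r I_down[OF s, of "s - {v}"] s v by (auto simp: insert_I adj_sym)
qed

lemma step_expectation:
  assumes n: "n > 0" and s: "s \<in> \<I>"
  shows "measure_pmf.expectation (glauber_step n E lam s) f = P f s"
proof -
  define K where "K v = (if \<exists>u\<in>s. adj E u v then return_pmf (s - {v})
       else map_pmf (\<lambda>b. if b then insert v s else s - {v}) (bernoulli_pmf p))" for v
  have fin: "finite (set_pmf (K v))" for v by (simp add: K_def)
  have Kv: "measure_pmf.expectation (K v) f = ex {v} f s" if v: "v \<in> V" for v
  proof (cases "\<exists>u\<in>s. adj E u v")
    case True
    then have "v \<notin> s" using s by (auto simp: indep_sets_def)
    then show ?thesis using True by (simp add: K_def ex_single_blocked[OF s True])
  next
    case False
    have "0 \<le> p" "p \<le> 1" using lam_pos by auto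
    then show ?thesis using False by (simp add: K_def ex_single_free[OF s False v])
  qed
  have "measure_pmf.expectation (glauber_step n E lam s) f
      = measure_pmf.expectation (pmf_of_set V \<bind> K) f"
    by (simp add: glauber_step_def K_def[abs_def])
  also have "\<dots> = (\<Sum>v\<in>V. measure_pmf.expectation (K v) f /\<^sub>R real (card V))"
    using n fin by (intro pmf_expectation_bind_pmf_of_set) auto
  also have "\<dots> = (\<Sum>v\<in>V. ex {v} f s / real n)"
    by (intro sum.cong) (simp_all add: Kv divide_inverse mult.commute)
  finally show ?thesis by (simp add: P_def sum_divide_distrib)
qed

lemma glauber_closed:
  assumes n: "n > 0" and s: "s \<in> \<I>"
  shows "set_pmf (glauber_dist n E lam t s) \<subseteq> \<I>"
proof (induction t)
  case 0 then show ?case using s by (simp add: glauber_dist_def)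
next
  case (Suc t)
  then show ?case using step_closed[OF n] by (auto simp: glauber_dist_def)
qed

lemma glauber_expectation:
  assumes n: "n > 0" and s: "s \<in> \<I>"
  shows "measure_pmf.expectation (glauber_dist n E lam t s) f = (P ^^ t) f s"
proof (induction t arbitrary: f)
  case 0 then show ?case by (simp add: glauber_dist_def)
next
  case (Suc t)
  let ?D = "glauber_dist n E lam t s"
  have "measure_pmf.expectation (glauber_dist n E lam (Suc t) s) f
      = measure_pmf.expectation (?D \<bind> glauber_step n E lam) f"
    by (simp add: glauber_dist_def)
  also have "\<dots> = (\<Sum>r\<in>\<I>. pmf ?D r *\<^sub>R measure_pmf.expectation (glauber_step n E lam r) f)"
    using step_closed[OF n] glauber_closed[OF n s] finite_I finite_subset
    by (intro pmf_expectation_bind) blast+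
  also have "\<dots> = (\<Sum>r\<in>\<I>. pmf ?D r *\<^sub>R P f r)"
    by (intro sum.cong) (simp_all add: step_expectation[OF n])
  also have "\<dots> = measure_pmf.expectation ?D (P f)"
    using glauber_closed[OF n s] by (intro integral_measure_pmf[symmetric] finite_I) blast
  also have "\<dots> = (P ^^ Suc t) f s" by (simp add: Suc funpow_swap1)
  finally show ?case .
qed

section \<open>Stationary measure and decay to equilibrium\<close>

lemma partition_wsum: "partition_fn n E lam = wsum \<I> (\<lambda>_. 1)"
  by (simp add: partition_fn_def wsum_def wt_def)

lemma W_I_pos: "wsum \<I> (\<lambda>_. 1) > 0"
  using W_pos[OF empty_I, of V] by (simp add: fib_V)

lemma hardcore_pmf: "pmf (hardcore n E lam) s = (if s \<in> \<I> then wt s / wsum \<I> (\<lambda>_. 1) else 0)"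
  unfolding hardcore_def partition_wsum
proof (subst pmf_embed_pmf)
  let ?g = "\<lambda>s. if s \<in> \<I> then lam ^ card s / wsum \<I> (\<lambda>_. 1) else 0"
  show nn: "0 \<le> ?g s" for s using lam_pos W_I_pos by auto
  have "(\<integral>\<^sup>+s. ennreal (?g s) \<partial>count_space UNIV) = (\<Sum>s\<in>\<I>. ennreal (?g s))"
    by (intro nn_integral_count_space'[of \<I>]) (auto simp: nn)
  also have "\<dots> = ennreal (\<Sum>s\<in>\<I>. ?g s)" by (intro sum_ennreal nn)
  also have "(\<Sum>s\<in>\<I>. ?g s) = 1"
    using W_I_pos by (simp add: wsum_def wt_def sum_divide_distrib[symmetric])
  finally show "(\<integral>\<^sup>+s. ennreal (?g s) \<partial>count_space UNIV) = 1" by simp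
qed (simp add: wt_def)

lemma hardcore_prob:
  "measure_pmf.prob (hardcore n E lam) A = wsum \<I> (indicator A) / wsum \<I> (\<lambda>_. 1)"
proof -
  have "measure_pmf.prob (hardcore n E lam) A = measure_pmf.expectation (hardcore n E lam) (indicator A)"
    by simp
  also have "\<dots> = (\<Sum>s\<in>\<I>. indicator A s * pmf (hardcore n E lam) s)"
    by (rule integral_measure_pmf_real) (auto simp: set_pmf_iff hardcore_pmf split: if_splits)
  also have "\<dots> = (\<Sum>s\<in>\<I>. wt s * indicator A s / wsum \<I> (\<lambda>_. 1))"
    by (intro sum.cong) (simp_all add: hardcore_pmf)
  finally show ?thesis by (simp only: wsum_def sum_divide_distrib)
qed

lemma P_sub: "P (\<lambda>r. f r - g r) s = P f s - P g s"
  by (simp add: P_def ex_diff sum_subtractf diff_divide_distrib)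

lemma P_const: "n > 0 \<Longrightarrow> s \<in> \<I> \<Longrightarrow> P (\<lambda>_. c) s = c"
  by (simp add: P_def ex_const)

lemma P_cong: "(\<And>r. r \<in> \<I> \<Longrightarrow> f r = g r) \<Longrightarrow> P f s = P g s"
  unfolding P_def using fib_I by (metis (mono_tags, lifting) ex_cong sum.cong)

lemma P_pow_sub_const:
  assumes n: "n > 0"
  shows "s \<in> \<I> \<Longrightarrow> (P ^^ t) (\<lambda>r. f r - c) s = (P ^^ t) f s - c"
proof (induction t arbitrary: s)
  case (Suc t)
  have "(P ^^ Suc t) (\<lambda>r. f r - c) s = P (\<lambda>r. (P ^^ t) f r - c) s"
    by (simp, rule P_cong) (simp add: Suc)
  then show ?case using Suc.prems n by (simp add: P_sub P_const)
qed simp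

text \<open>Each \<open>ex {v}\<close> is an orthogonal projection, so convexity of the square
  bounds the squared norm of \<open>P f\<close> by the average of
  \<open>ip f f - wsum \<I> (var {v} f)\<close>. The Dirichlet form thus controls the norm directly,
  without a separate treatment of negative eigenvalues.\<close>

lemma P_contract:
  fixes g :: real
  assumes n: "n > 0"
    and gap: "\<And>f. wsum \<I> f = 0 \<Longrightarrow> g * n * ip f f \<le> (\<Sum>v\<in>V. wsum \<I> (var {v} f))"
    and zero: "wsum \<I> f = 0"
  shows "ip (P f) (P f) \<le> (1 - g) * ip f f" "wsum \<I> (P f) = 0"
proof -
  have lin: "wsum \<I> (\<lambda>s. h s * P k s) = (\<Sum>v\<in>V. wsum \<I> (\<lambda>s. h s * ex {v} k s)) / n" for h k
  proof -
    have "wsum \<I> (\<lambda>s. h s * P k s) = wsum \<I> (\<lambda>s. inverse n * (\<Sum>v\<in>V. h s * ex {v} k s))"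
      by (intro wsum_cong) (simp add: P_def divide_inverse sum_distrib_left sum_distrib_right mult_ac)
    then show ?thesis unfolding wsum_cmult wsum_sum by (simp add: divide_inverse mult.commute)
  qed
  show "wsum \<I> (P f) = 0"
    using lin[of "\<lambda>_. 1" f] zero by (simp add: wsum_I_ex)
  have "ip (P f) (P f) \<le> wsum \<I> (\<lambda>s. inverse n * (\<Sum>v\<in>V. (ex {v} f s)\<^sup>2))"
    unfolding ip_def
  proof (rule wsum_mono)
    fix s
    have "(\<Sum>v\<in>V. 1 * ex {v} f s)\<^sup>2 \<le> (\<Sum>v\<in>V. 1\<^sup>2) * (\<Sum>v\<in>V. (ex {v} f s)\<^sup>2)"
      by (rule Cauchy_Schwarz_ineq_sum)
    then have "(\<Sum>v\<in>V. ex {v} f s)\<^sup>2 / n\<^sup>2 \<le> (n * (\<Sum>v\<in>V. (ex {v} f s)\<^sup>2)) / n\<^sup>2"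
      by (intro divide_right_mono) auto
    also have "\<dots> = inverse n * (\<Sum>v\<in>V. (ex {v} f s)\<^sup>2)"
      using n by (simp add: power2_eq_square divide_inverse)
    finally show "P f s * P f s \<le> inverse n * (\<Sum>v\<in>V. (ex {v} f s)\<^sup>2)"
      by (simp add: P_def power2_eq_square)
  qed
  also have "\<dots> = (\<Sum>v\<in>V. ip (ex {v} f) (ex {v} f)) / n"
    unfolding wsum_cmult wsum_sum by (simp add: ip_def power2_eq_square divide_inverse mult.commute)
  also have "\<dots> = (\<Sum>v\<in>V. ip f f - wsum \<I> (var {v} f)) / n"
  proof -
    have "ip (ex {v} f) (ex {v} f) = ip f f - wsum \<I> (var {v} f)" if "v \<in> V" for v
    proof -
      have "ip (ex {v} f) (ex {v} f) = ip f (ex {v} (ex {v} f))"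
        using that by (simp add: ip_ex)
      also have "\<dots> = ip f (ex {v} f)"
        unfolding ip_def by (rule wsum_cong) (simp add: ex_tower)
      finally show ?thesis using ip_var[of "{v}" f] that by simp
    qed
    then show ?thesis by simp
  qed
  also have "\<dots> = ip f f - (\<Sum>v\<in>V. wsum \<I> (var {v} f)) / n"
    using n by (simp add: sum_subtractf diff_divide_distrib)
  also have "\<dots> \<le> ip f f - (g * n * ip f f) / n"
    using gap[OF zero] by (intro diff_left_mono divide_right_mono) auto
  also have "\<dots> = (1 - g) * ip f f" using n by (simp add: algebra_simps)
  finally show "ip (P f) (P f) \<le> (1 - g) * ip f f" .
qed

lemma W_le: "lam \<le> 1 \<Longrightarrow> wsum \<I> (\<lambda>_. 1) \<le> 2 ^ n"
proof -
  assume lam: "lam \<le> 1"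
  have "wsum \<I> (\<lambda>_. 1) \<le> (\<Sum>s\<in>\<I>. 1)"
    unfolding wsum_def wt_def using lam lam_pos by (intro sum_mono) (auto intro: power_le_one)
  also have "\<dots> = real (card \<I>)" by simp
  also have "\<dots> \<le> real (card (Pow V))"
    by (intro of_nat_mono card_mono) (auto simp: indep_sets_def)
  finally show ?thesis by (simp add: card_Pow)
qed

lemma wt_ge: "lam \<le> 1 \<Longrightarrow> s \<in> \<I> \<Longrightarrow> lam ^ n \<le> wt s"
  unfolding wt_def using lam_pos card_mono[OF _ I_sub, of s] by (intro power_decreasing) auto

text \<open>Evaluating a mean square at one starting point costs at most
  \<open>(2 / lam) ^ n\<close>: total weight at most \<open>2 ^ n\<close> against a single weight at
  least \<open>lam ^ n\<close>. Its logarithm is the term \<open>n * ln (2 / lam)\<close>, and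
  \<open>ln 16\<close> turns what is left into \<open>(1 / 4)\<^sup>2\<close>.\<close>

lemma tv_bound:
  fixes g :: real
  assumes n: "n > 0" and lam: "lam \<le> 1" and g: "0 < g" "g \<le> 1"
    and gap: "\<And>f. wsum \<I> f = 0 \<Longrightarrow> g * n * ip f f \<le> (\<Sum>v\<in>V. wsum \<I> (var {v} f))"
    and t: "real t \<ge> (n * ln (2 / lam) + ln 16) / g" and s: "s \<in> \<I>"
  shows "tv_dist (glauber_dist n E lam t s) (hardcore n E lam) \<le> 1 / 4"
  unfolding tv_dist_def
proof (rule cSUP_least)
  fix A :: "nat set set"
  let ?W = "wsum \<I> (\<lambda>_. 1)"
  define c where "c = wsum \<I> (indicator A) / ?W"
  define f where "f = (\<lambda>s. indicator A s - c)"
  have c: "0 \<le> c" "c \<le> 1"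
  proof -
    show "0 \<le> c" unfolding c_def using W_I_pos by (intro divide_nonneg_pos wsum_nonneg) auto
    have "wsum \<I> (indicator A) \<le> ?W" by (intro wsum_mono) (auto simp: indicator_def)
    then show "c \<le> 1" using W_I_pos by (simp add: c_def)
  qed
  have zero: "wsum \<I> f = 0"
    using W_I_pos wsum_cmult[of \<I> c "\<lambda>_. 1"] by (simp add: f_def wsum_diff c_def)
  have f1: "ip f f \<le> ?W"
    unfolding ip_def
  proof (intro wsum_mono)
    fix r
    have "\<bar>f r\<bar> \<le> 1" using c by (auto simp: f_def indicator_def)
    then show "f r * f r \<le> 1" using abs_square_le_1[of "f r"] by (simp add: power2_eq_square)
  qed
  have it: "ip ((P ^^ k) f) ((P ^^ k) f) \<le> (1 - g) ^ k * ip f f \<and> wsum \<I> ((P ^^ k) f) = 0" for k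
  proof (induction k)
    case (Suc k)
    have "ip (P ((P ^^ k) f)) (P ((P ^^ k) f)) \<le> (1 - g) * ip ((P ^^ k) f) ((P ^^ k) f)"
      using Suc by (intro P_contract[OF n gap]) auto
    also have "\<dots> \<le> (1 - g) * ((1 - g) ^ k * ip f f)"
      using Suc g by (intro mult_left_mono) auto
    finally show ?case using Suc P_contract(2)[OF n gap] by (simp add: mult.assoc)
  qed (use zero in simp)
  have "wt s * ((P ^^ t) f s * (P ^^ t) f s) \<le> ip ((P ^^ t) f) ((P ^^ t) f)"
    unfolding ip_def wsum_def using s
    by (intro member_le_sum[of s \<I> "\<lambda>s. wt s * ((P ^^ t) f s * (P ^^ t) f s)"]) auto
  also have "\<dots> \<le> (1 - g) ^ t * 2 ^ n"
    using it[of t] f1 W_le[OF lam] g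
    by (meson order_trans mult_left_mono zero_le_power diff_ge_0_iff_ge)
  finally have b: "wt s * ((P ^^ t) f s)\<^sup>2 \<le> (1 - g) ^ t * 2 ^ n"
    by (simp add: power2_eq_square)
  have "lam ^ n * ((P ^^ t) f s)\<^sup>2 \<le> wt s * ((P ^^ t) f s)\<^sup>2"
    using wt_ge[OF lam s] by (intro mult_right_mono) auto
  with b have "lam ^ n * ((P ^^ t) f s)\<^sup>2 \<le> (1 - g) ^ t * 2 ^ n" by linarith
  also have "\<dots> \<le> exp (- g) ^ t * 2 ^ n"
    using g exp_ge_add_one_self[of "- g"] by (intro mult_right_mono power_mono) auto
  also have "exp (- g) ^ t = exp (- (g * t))" by (simp add: exp_of_nat_mult[symmetric] mult.commute)
  also have "\<dots> \<le> exp (- (n * ln (2 / lam) + ln 16))"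
    using t g by (simp add: divide_le_eq mult.commute)
  also have "\<dots> = (lam / 2) ^ n / 16"
  proof -
    have "exp (n * ln (2 / lam)) = (2 / lam) ^ n" using lam_pos by (simp add: exp_of_nat_mult)
    then show ?thesis
      using lam_pos by (simp add: exp_minus exp_add exp_diff power_divide field_simps)
  qed
  finally have "lam ^ n * ((P ^^ t) f s)\<^sup>2 \<le> lam ^ n * (1 / 16)"
    by (simp add: power_divide)
  then have "((P ^^ t) f s)\<^sup>2 \<le> (1 / 4)\<^sup>2"
    using lam_pos by (simp add: power2_eq_square)
  then have fin: "\<bar>(P ^^ t) f s\<bar> \<le> 1 / 4"
    using abs_le_square_iff[of "(P ^^ t) f s" "1/4"] by simp
  have "measure_pmf.prob (glauber_dist n E lam t s) A = measure_pmf.expectation (glauber_dist n E lam t s) (indicator A)"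
    by simp
  also have "\<dots> = (P ^^ t) (indicator A) s" by (rule glauber_expectation[OF n s])
  finally have "measure_pmf.prob (glauber_dist n E lam t s) A - measure_pmf.prob (hardcore n E lam) A = (P ^^ t) f s"
    using P_pow_sub_const[OF n s, of t "indicator A" c] by (simp add: hardcore_prob f_def c_def)
  then show "\<bar>measure_pmf.prob (glauber_dist n E lam t s) A - measure_pmf.prob (hardcore n E lam) A\<bar> \<le> 1 / 4"
    using fin by simp
qed simp

theorem mixing_time_le:
  fixes c :: real
  assumes n: "n > 0" and lam: "lam \<le> 1"
    and H: "H \<subseteq> V" and D: "D > 0" and del: "del > 0" and pD: "p * D * (1 + del) \<le> 1"
    and light: "\<And>x U. x \<in> V - H \<Longrightarrow> conn E U \<Longrightarrow> x \<in> U \<Longrightarrow> U \<subseteq> insert x H \<Longrightarrow>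
      (\<Sum>v\<in>U. deg E v / D - 1) \<le> 0"
    and PC: "PC H c" "c \<ge> 1"
    and t: "real t \<ge> (n * ln (2 / lam) + ln 16) * (c * n / (1 - 1 / sqrt (1 + del)))"
  shows "mixing_time n E lam \<le> t"
proof -
  define k where "k = 1 - 1 / sqrt (1 + del)"
  have k: "0 < k" "k \<le> 1" using del by (auto simp: k_def)
  \<comment> \<open>\<open>glauber_gap\<close> speaks of the sum over all sites, while a step
    updates one of \<open>n\<close>; hence the extra \<open>n\<close>.\<close>
  define g where "g = k / (c * n)"
  have cn: "c * n \<ge> 1" using PC(2) n mult_mono[of 1 c 1 "real n"] by simp
  have g: "0 < g" "g \<le> 1" using k cn by (auto simp: g_def divide_le_eq)
  have "tv_dist (glauber_dist n E lam t s) (hardcore n E lam) \<le> 1 / 4" if s: "s \<in> \<I>" for s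
  proof (rule tv_bound[OF n lam g _ _ s])
    fix f assume "wsum \<I> f = 0"
    then have "k * ip f f \<le> c * (\<Sum>v\<in>V. wsum \<I> (var {v} f))"
      unfolding k_def by (intro glauber_gap[OF H D del pD light PC]) auto
    then show "g * n * ip f f \<le> (\<Sum>v\<in>V. wsum \<I> (var {v} f))"
      using PC(2) n by (simp add: g_def field_simps)
  next
    show "real t \<ge> (n * ln (2 / lam) + ln 16) / g"
      using t k by (simp add: g_def k_def)
  qed
  then show ?thesis unfolding mixing_time_def by (intro Least_le) auto
qed

end

section \<open>Shape of the components of the dense part\<close>

lemma conn_Un:
  assumes "conn E B"
  shows "conn E A \<Longrightarrow> A \<inter> B \<noteq> {} \<Longrightarrow> conn E (A \<union> B)"
  using assms
proof (induction arbitrary: A rule: conn.induct)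
  case (single v)
  then show ?case by (simp add: insert_absorb)
next
  case (step U u v)
  show ?case
  proof (cases "A \<inter> U = {}")
    case False
    then have "conn E (A \<union> U)" using step by blast
    then have "conn E (insert v (A \<union> U))" using step by (intro conn_insert[of E _ u]) auto
    then show ?thesis by simp
  next
    case True
    then have v: "v \<in> A" using step.prems by blast
    then have "conn E (insert u A)"
      using step by (intro conn_insert[of E A v]) (auto simp: adj_sym)
    then have "conn E (insert u A \<union> U)" using step by blast
    moreover have "insert u A \<union> U = A \<union> insert v U" using v step.hyps by blast
    ultimately show ?thesis by simp
  qed
qed

lemma conn_Union:
  assumes "finite G" "conn E Q" "\<And>B. B \<in> G \<Longrightarrow> conn E B \<and> Q \<inter> B \<noteq> {}"
  shows "conn E (Q \<union> \<Union>G)"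
  using assms
proof (induction rule: finite_induct)
  case (insert B G)
  have "conn E ((Q \<union> \<Union>G) \<union> B)"
    by (rule conn_Un) (use insert in auto)
  then show ?case by (simp add: Un_ac)
qed simp

text \<open>Attaching a vertex widens the range of levels by at most one.\<close>

lemma conn_levels:
  fixes h :: "nat \<Rightarrow> nat"
  assumes "conn E U"
  shows "(\<And>u v. u \<in> U \<Longrightarrow> v \<in> U \<Longrightarrow> adj E u v \<Longrightarrow> h u \<le> Suc (h v)) \<Longrightarrow>
    a \<in> U \<Longrightarrow> b \<in> U \<Longrightarrow> h a + 1 \<le> h b + card U"
  using assms
proof (induction arbitrary: a b rule: conn.induct)
  case (step U u v)
  have fin: "finite U" using conn_finite step.hyps by blast
  have IH: "h a + 1 \<le> h b + card U" if "a \<in> U" "b \<in> U" for a b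
    using step.IH[of a b] step.prems(1) that by blast
  have c: "card (insert v U) = Suc (card U)" using fin step.hyps by simp
  have "h u \<le> Suc (h v)" "h v \<le> Suc (h u)"
    using step.prems(1)[of u v] step.prems(1)[of v u] step.hyps adj_sym[of E] by auto
  then have A: "h v + 1 \<le> h b + Suc (card U) \<and> h b + 1 \<le> h v + Suc (card U)" if "b \<in> U" for b
    using IH[of u b] IH[of b u] that step.hyps by auto
  show ?case
    unfolding c using step.prems(2,3) A[of a] A[of b] IH[of a b] by auto
qed simp

text \<open>Greedy choice: take a set of maximal size, discard everything that meets it, and repeat
  on the rest.\<close>

lemma vitali_finite:
  assumes "finite F" "\<And>A. A \<in> F \<Longrightarrow> finite A \<and> A \<noteq> {}"
  shows "\<exists>G \<subseteq> F. pairwise disjnt G \<and> (\<forall>A\<in>F. \<exists>B\<in>G. A \<inter> B \<noteq> {} \<and> card A \<le> card B)"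
  using assms
proof (induction "card F" arbitrary: F rule: less_induct)
  case less
  show ?case
  proof (cases "F = {}")
    case False
    have "finite (card ` F)" "card ` F \<noteq> {}" using less.prems False by auto
    then obtain B where B: "B \<in> F" "card B = Max (card ` F)" using Max_in by (metis imageE)
    have mx: "card A \<le> card B" if "A \<in> F" for A using that less.prems B by simp
    define F' where "F' = {A \<in> F. A \<inter> B = {}}"
    have "F' \<subset> F" using B less.prems by (auto simp: F'_def)
    then have c: "card F' < card F" "finite F'" using less.prems by (auto intro: psubset_card_mono finite_subset)
    have ne: "finite A \<and> A \<noteq> {}" if "A \<in> F'" for A
      using less.prems(2)[of A] that by (simp add: F'_def)
    have "\<exists>G \<subseteq> F'. pairwise disjnt G \<and> (\<forall>A\<in>F'. \<exists>B\<in>G. A \<inter> B \<noteq> {} \<and> card A \<le> card B)"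
      by (rule less.hyps[OF c]) (rule ne)
    then obtain G where G: "G \<subseteq> F'" "pairwise disjnt G" "\<forall>A\<in>F'. \<exists>B\<in>G. A \<inter> B \<noteq> {} \<and> card A \<le> card B"
      by (elim exE conjE) (rule that)
    have "pairwise disjnt (insert B G)"
      using G by (auto simp: pairwise_insert F'_def disjnt_def)
    moreover have "\<exists>C\<in>insert B G. A \<inter> C \<noteq> {} \<and> card A \<le> card C" if "A \<in> F" for A
      using G mx that by (cases "A \<inter> B = {}") (auto simp: F'_def)
    moreover have "insert B G \<subseteq> F" using G B by (auto simp: F'_def)
    ultimately show ?thesis by blast
  qed auto
qed

lemma card_le_spread:
  fixes X :: "nat set"
  assumes "finite X" "\<And>a b. a \<in> X \<Longrightarrow> b \<in> X \<Longrightarrow> a + 1 \<le> b + m"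
  shows "card X \<le> m"
proof (cases "X = {}")
  case False
  have "X \<subseteq> {Min X ..< Min X + m}"
    using assms(1) assms(2)[OF _ Min_in[OF assms(1) False]] by (auto simp: Suc_le_eq)
  then have "card X \<le> card {Min X ..< Min X + m}" by (intro card_mono) auto
  then show ?thesis by simp
qed simp

section \<open>Heavy sets and the two sparsity properties\<close>

definition heavy :: "nat \<Rightarrow> (nat \<times> nat) set \<Rightarrow> real \<Rightarrow> nat set \<Rightarrow> bool" where
  "heavy n E D U \<longleftrightarrow> conn E U \<and> U \<subseteq> {0..<n} \<and> D * card U < (\<Sum>v\<in>U. deg E v)"

definition hset :: "nat \<Rightarrow> (nat \<times> nat) set \<Rightarrow> real \<Rightarrow> nat set" where
  "hset n E D = \<Union>{U. heavy n E D U}"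

text \<open>\<open>U\<close> need not be connected, only a fixed fraction of a connected
  \<open>S\<close>: a long path joins many disjoint heavy sets, and the degree condition is known on
  these alone.\<close>

definition dense_free :: "nat \<Rightarrow> (nat \<times> nat) set \<Rightarrow> real \<Rightarrow> nat \<Rightarrow> bool" where
  "dense_free n E D L \<longleftrightarrow> \<not> (\<exists>S U. conn E S \<and> S \<subseteq> {0..<n} \<and> U \<subseteq> S \<and> card S \<le> 4 * card U \<and>
     L \<le> card S \<and> D * card U < (\<Sum>v\<in>U. deg E v))"

text \<open>\<open>card S + 1\<close> edges are two more than a spanning tree has, so a connected
  set of size up to \<open>M\<close> carries at most one independent cycle.\<close>

definition bicycle_free :: "nat \<Rightarrow> (nat \<times> nat) set \<Rightarrow> nat \<Rightarrow> bool" where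
  "bicycle_free n E M \<longleftrightarrow> \<not> (\<exists>S. conn E S \<and> S \<subseteq> {0..<n} \<and> card S \<le> M \<and> card S + 1 \<le> card (E \<inter> S \<times> S))"

text \<open>Otherwise \<open>U\<close> would be heavy and its element \<open>x\<close> would belong
  to \<open>hset n E D\<close>.\<close>

lemma hset_light:
  assumes D: "D > 0" and x: "x \<in> {0..<n} - hset n E D" and U: "conn E U" "x \<in> U" "U \<subseteq> insert x (hset n E D)"
  shows "(\<Sum>v\<in>U. deg E v / D - 1) \<le> 0"
proof -
  have "U \<subseteq> {0..<n}" using U x by (auto simp: hset_def heavy_def)
  then have "\<not> D * card U < (\<Sum>v\<in>U. deg E v)"
    using U x unfolding hset_def heavy_def by blast
  then have "(\<Sum>v\<in>U. real (deg E v)) / D \<le> card U" using D by (simp add: divide_le_eq mult.commute)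
  then show ?thesis by (simp add: sum_subtractf sum_divide_distrib)
qed

context hardcore_graph
begin

section \<open>Breadth-first layers of one component\<close>

context
  fixes D :: real and L :: nat and r :: nat
  assumes lam1: "lam \<le> 1" and L: "1 \<le> L"
    and dense: "dense_free n E D L" and bicycle: "bicycle_free n E (4 * L)"
    and rH: "r \<in> hset n E D"
begin

definition "H = hset n E D"
definition "R = {(u, v). u \<in> H \<and> v \<in> H \<and> adj E u v}"
definition "K = R\<^sup>* `` {r}"
definition "h x = (LEAST k. (r, x) \<in> R ^^ k)"

lemma HV: "H \<subseteq> V"
  by (auto simp: H_def hset_def heavy_def)

lemma KH: "K \<subseteq> H"
proof
  fix x assume "x \<in> K"
  then have "(r, x) \<in> R\<^sup>*" by (simp add: K_def)
  then show "x \<in> H" using rH by (induction rule: rtrancl_induct) (auto simp: R_def H_def)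
qed

lemma finite_K: "finite K"
  by (rule finite_subset[OF subset_trans[OF KH HV]]) simp

lemma K_step: "x \<in> K \<Longrightarrow> (x, y) \<in> R \<Longrightarrow> y \<in> K"
  unfolding K_def by (auto intro: rtrancl_into_rtrancl)

lemma r_K: "r \<in> K"
  by (simp add: K_def)

lemma h_pow: "x \<in> K \<Longrightarrow> (r, x) \<in> R ^^ h x"
  unfolding h_def K_def by (rule LeastI_ex) (auto dest: rtrancl_imp_relpow)

lemma h_le: "(r, x) \<in> R ^^ k \<Longrightarrow> h x \<le> k"
  unfolding h_def by (rule Least_le)

lemma h_step: "x \<in> K \<Longrightarrow> (x, y) \<in> R \<Longrightarrow> h y \<le> Suc (h x)"
  using h_pow by (intro h_le) auto

lemma h_adj: "u \<in> K \<Longrightarrow> v \<in> K \<Longrightarrow> adj E u v \<Longrightarrow> h u \<le> Suc (h v)"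
  using KH by (intro h_step) (auto simp: R_def adj_sym)

lemma h_zero: "x \<in> K \<Longrightarrow> h x = 0 \<Longrightarrow> x = r"
  using h_pow[of x] by simp

lemma parent_exists:
  assumes x: "x \<in> K" "x \<noteq> r"
  shows "\<exists>y. y \<in> K \<and> (y, x) \<in> R \<and> h x = Suc (h y)"
proof -
  obtain k where k: "h x = Suc k" using x h_zero by (cases "h x") auto
  then have "(r, x) \<in> R ^^ Suc k" using h_pow[OF x(1)] by simp
  then obtain y where y: "(r, y) \<in> R ^^ k" "(y, x) \<in> R" by auto
  have yK: "y \<in> K" using y by (auto simp: K_def dest: relpow_imp_rtrancl)
  have "h y \<le> k" by (rule h_le[OF y(1)])
  moreover have "h x \<le> Suc (h y)" by (rule h_step[OF yK y(2)])
  ultimately show ?thesis using k yK y by auto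
qed

definition "par x = (SOME y. y \<in> K \<and> (y, x) \<in> R \<and> h x = Suc (h y))"

lemma par:
  assumes "x \<in> K" "x \<noteq> r"
  shows "par x \<in> K" "adj E (par x) x" "h x = Suc (h (par x))"
proof -
  have "par x \<in> K \<and> (par x, x) \<in> R \<and> h x = Suc (h (par x))"
    unfolding par_def by (rule someI_ex) (rule parent_exists[OF assms])
  then show "par x \<in> K" "adj E (par x) x" "h x = Suc (h (par x))" by (auto simp: R_def)
qed

text \<open>One vertex per level gives \<open>card Q = h x + 1\<close> and so turns depth into size.
  Closure under \<open>par\<close> prepares the edge count in \<open>nontree_unique\<close>: in a
  union of such paths every vertex except \<open>r\<close> brings its own parent edge.\<close>

lemma root_path:
  "x \<in> K \<Longrightarrow> \<exists>Q. conn E Q \<and> Q \<subseteq> K \<and> x \<in> Q \<and> r \<in> Q \<and> inj_on h Q \<and> h ` Q = {..h x} \<and>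
    (\<forall>y\<in>Q. y \<noteq> r \<longrightarrow> par y \<in> Q)"
proof (induction "h x" arbitrary: x)
  case 0
  then have "x = r" using h_zero by simp
  then show ?case using 0 r_K by (intro exI[of _ "{r}"]) (auto intro: conn.single)
next
  case (Suc k)
  have xr: "x \<noteq> r" using Suc.hyps(2) h_le[of r 0] by auto
  note px = par[OF Suc.prems xr]
  obtain Q where Q: "conn E Q" "Q \<subseteq> K" "par x \<in> Q" "r \<in> Q" "inj_on h Q" "h ` Q = {..h (par x)}"
    "\<forall>y\<in>Q. y \<noteq> r \<longrightarrow> par y \<in> Q"
    using Suc.hyps(1)[of "par x"] px Suc.hyps(2) by auto
  have hx: "h x \<notin> h ` Q" using Q px by simp
  have "conn E (insert x Q)" using Q px by (intro conn_insert) auto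
  moreover have "inj_on h (insert x Q)" using Q hx by (auto simp: inj_on_insert)
  moreover have "h ` insert x Q = {..h x}" using Q px by auto
  ultimately show ?case using Q px Suc.prems by (intro exI[of _ "insert x Q"]) auto
qed

text \<open>The levels of the vertices of a set of large average degree differ by less than its size, so the
  Vitali subfamily has at least a third as many vertices as the path \<open>Q\<close>.\<close>

lemma depth_less:
  assumes x: "x \<in> K"
  shows "h x < L"
proof (rule ccontr)
  assume nl: "\<not> h x < L"
  obtain Q where Q: "conn E Q" "Q \<subseteq> K" "inj_on h Q" "h ` Q = {..h x}"
    using root_path[OF x] by blast
  have cQ: "card Q = Suc (h x)" using card_image[OF Q(3)] Q(4) by simp
  have finQ: "finite Q" by (rule conn_finite[OF Q(1)])
  have "\<exists>U. heavy n E D U \<and> q \<in> U" if "q \<in> Q" for q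
    using that Q KH by (auto simp: H_def hset_def)
  then obtain U where U: "\<And>q. q \<in> Q \<Longrightarrow> heavy n E D (U q) \<and> q \<in> U q" by metis
  \<comment> \<open>Heavy sets lie in \<open>H\<close> and are connected, so one that meets the
    component \<open>K\<close> stays inside it, where \<open>h\<close> is defined by
    distances.\<close>
  have UK: "W \<subseteq> K" if "heavy n E D W" "q \<in> W" "q \<in> K" for W q
  proof -
    have WH: "W \<subseteq> H" using that by (auto simp: H_def hset_def)
    have "conn E W" using that by (simp add: heavy_def)
    then have "W \<subseteq> H \<Longrightarrow> W \<inter> K \<noteq> {} \<Longrightarrow> W \<subseteq> K"
    proof (induction rule: conn.induct)
      case (step U u v)
      have uv: "(u, v) \<in> R" "(v, u) \<in> R" using step by (auto simp: R_def adj_sym)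
      show ?case
      proof (cases "v \<in> K")
        case True
        then have "u \<in> K" using K_step uv by blast
        then show ?thesis using step True by blast
      next
        case False
        then have "U \<subseteq> K" using step by blast
        then show ?thesis using K_step uv step by blast
      qed
    qed auto
    then show ?thesis using WH that by blast
  qed
  have fam: "finite A \<and> A \<noteq> {}" if A: "A \<in> U ` Q" for A
  proof -
    obtain q where "q \<in> Q" "A = U q" using A by blast
    then have "conn E A" using U by (auto simp: heavy_def)
    then show ?thesis using conn_finite conn_nonempty by blast
  qed
  obtain G where G: "G \<subseteq> U ` Q" "pairwise disjnt G"
    "\<forall>A\<in>U ` Q. \<exists>B\<in>G. A \<inter> B \<noteq> {} \<and> card A \<le> card B"
    using vitali_finite[of "U ` Q"] finQ fam by blast
  have finG: "finite G" by (rule finite_subset[OF G(1)]) (simp add: finQ)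
  have Gp: "heavy n E D B \<and> Q \<inter> B \<noteq> {} \<and> B \<subseteq> K" if B: "B \<in> G" for B
  proof -
    obtain q where q: "q \<in> Q" "B = U q" using B G by auto
    then show ?thesis using U[of q] UK[of "U q" q] Q by auto
  qed
  have Gfin: "finite B" if "B \<in> G" for B
    using Gp[OF that] conn_finite by (auto simp: heavy_def)
  define QB where "QB B = {q \<in> Q. U q \<inter> B \<noteq> {} \<and> card (U q) \<le> card B}" for B
  have QB: "card (QB B) \<le> 3 * card B" if B: "B \<in> G" for B
  proof -
    have lev: "h a + 1 \<le> h b + card W" if "heavy n E D W" "W \<subseteq> K" "a \<in> W" "b \<in> W" for W a b
      using that h_adj[OF subsetD[OF that(2)] subsetD[OF that(2)]]
      by (intro conn_levels[of E W h a b]) (auto simp: heavy_def)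
    \<comment> \<open>The chain \<open>q\<close>, \<open>c\<close>, \<open>c'\<close>,
      \<open>q'\<close> runs through \<open>U q\<close>, \<open>B\<close> and \<open>U q'\<close>,
      none larger than \<open>B\<close>.\<close>
    have "h q + 1 \<le> h q' + 3 * card B" if q: "q \<in> QB B" "q' \<in> QB B" for q q'
    proof -
      obtain c c' where c: "c \<in> U q" "c \<in> B" "c' \<in> U q'" "c' \<in> B"
        using q by (auto simp: QB_def)
      have q': "q \<in> Q" "q' \<in> Q" "card (U q) \<le> card B" "card (U q') \<le> card B"
        using q by (auto simp: QB_def)
      have "U q \<subseteq> K" "U q' \<subseteq> K" using UK U q' Q by blast+
      then have "h q + 1 \<le> h c + card (U q)" "h c + 1 \<le> h c' + card B" "h c' + 1 \<le> h q' + card (U q')"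
        using lev U q' c Gp[OF B] by blast+
      then show ?thesis using q' by linarith
    qed
    then have "card (h ` QB B) \<le> 3 * card B"
      using finQ by (intro card_le_spread) (auto simp: QB_def)
    moreover have "inj_on h (QB B)" using Q(3) by (rule inj_on_subset) (auto simp: QB_def)
    ultimately show ?thesis by (simp add: card_image)
  qed
  have cU: "card (\<Union>G) = (\<Sum>B\<in>G. card B)"
    using G(2) Gfin by (intro card_Union_disjoint)
  have "Q \<subseteq> (\<Union>B\<in>G. QB B)" using G(3) by (auto simp: QB_def)
  then have "card Q \<le> card (\<Union>B\<in>G. QB B)"
    using finG finQ by (intro card_mono) (auto simp: QB_def)
  also have "\<dots> \<le> (\<Sum>B\<in>G. card (QB B))" by (rule card_UN_le[OF finG])
  also have "\<dots> \<le> (\<Sum>B\<in>G. 3 * card B)" by (intro sum_mono QB)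
  also have "\<dots> = 3 * card (\<Union>G)" by (simp add: cU sum_distrib_left)
  finally have c3: "card Q \<le> 3 * card (\<Union>G)" .
  \<comment> \<open>\<open>Q\<close> links the disjoint heavy sets. As \<open>card Q\<close> is at
    most 3 times their total size, \<open>card S\<close> is at most 4 times that size, the ratio in
    \<open>dense_free\<close>.\<close>
  define S where "S = Q \<union> \<Union>G"
  have S: "conn E S" unfolding S_def using finG Q Gp by (intro conn_Union) (auto simp: heavy_def)
  have "card S \<le> card Q + card (\<Union>G)" unfolding S_def by (rule card_Un_le)
  with c3 have S4: "card S \<le> 4 * card (\<Union>G)" by simp
  have "card Q \<le> card S" using conn_finite[OF S] by (intro card_mono) (auto simp: S_def)
  then have LS: "L \<le> card S" using cQ nl by simp
  have "G \<noteq> {}" using c3 cQ by auto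
  then have "(\<Sum>B\<in>G. D * card B) < (\<Sum>B\<in>G. real (\<Sum>v\<in>B. deg E v))"
    using finG Gp by (intro sum_strict_mono) (auto simp: heavy_def)
  moreover have "(\<Sum>v\<in>\<Union>G. deg E v) = (\<Sum>B\<in>G. \<Sum>v\<in>B. deg E v)"
    using G(2) Gfin by (subst sum.Union_disjoint) (auto simp: pairwise_def disjnt_def)
  ultimately have dG: "D * card (\<Union>G) < (\<Sum>v\<in>\<Union>G. deg E v)"
    by (simp add: cU sum_distrib_left)
  have "S \<subseteq> {0..<n}" unfolding S_def using Q Gp KH HV by blast
  then show False using dense S S4 LS dG unfolding dense_free_def S_def by blast
qed

definition "nontree e = (e \<in> E \<and> fst e \<in> K \<and> snd e \<in> K \<and>
  \<not> (fst e \<noteq> r \<and> par (fst e) = snd e) \<and> \<not> (snd e \<noteq> r \<and> par (snd e) = fst e))"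

text \<open>The root paths of the at most four endpoints share \<open>r\<close>, so their union
  \<open>S\<close> is connected and has at most \<open>4 * L\<close> vertices. It contains
  \<open>card S - 1\<close> parent edges and both non-tree edges, one edge more than
  \<open>bicycle_free\<close> permits.\<close>

lemma nontree_unique:
  assumes e: "nontree e1" "nontree e2"
  shows "e1 = e2"
proof (rule ccontr)
  assume ne: "e1 \<noteq> e2"
  have "\<exists>Q. conn E Q \<and> Q \<subseteq> K \<and> x \<in> Q \<and> r \<in> Q \<and> card Q \<le> L \<and> (\<forall>y\<in>Q. y \<noteq> r \<longrightarrow> par y \<in> Q)"
    if x: "x \<in> K" for x
  proof -
    obtain Q where Q: "conn E Q" "Q \<subseteq> K" "x \<in> Q" "r \<in> Q" "inj_on h Q" "h ` Q = {..h x}"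
      "\<forall>y\<in>Q. y \<noteq> r \<longrightarrow> par y \<in> Q"
      using root_path[OF x] by blast
    have "card Q = Suc (h x)" using card_image[OF Q(5)] Q(6) by simp
    then have "card Q \<le> L" using depth_less[OF x] by simp
    then show ?thesis using Q by blast
  qed
  then obtain Q where Q: "\<And>x. x \<in> K \<Longrightarrow> conn E (Q x) \<and> Q x \<subseteq> K \<and> x \<in> Q x \<and> r \<in> Q x \<and>
      card (Q x) \<le> L \<and> (\<forall>y\<in>Q x. y \<noteq> r \<longrightarrow> par y \<in> Q x)"
    by metis
  define W where "W = {fst e1, snd e1, fst e2, snd e2}"
  have WK: "W \<subseteq> K" using e by (auto simp: W_def nontree_def)
  define S where "S = (\<Union>x\<in>W. Q x)"
  have finW: "finite W" by (simp add: W_def)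
  have "card W \<le> 4" unfolding W_def by (simp add: card_insert_if)
  have "S = Q (fst e1) \<union> \<Union>(Q ` W)" by (auto simp: S_def W_def)
  moreover have "conn E (Q (fst e1) \<union> \<Union>(Q ` W))"
  proof (rule conn_Union)
    fix B assume "B \<in> Q ` W"
    then obtain x where x: "x \<in> K" "B = Q x" using WK by blast
    have "r \<in> Q (fst e1) \<inter> B" using Q[OF x(1)] Q[of "fst e1"] e x by (auto simp: nontree_def)
    then show "conn E B \<and> Q (fst e1) \<inter> B \<noteq> {}" using Q[OF x(1)] x by blast
  qed (use Q finW e in \<open>auto simp: nontree_def\<close>)
  ultimately have cS: "conn E S" by simp
  have SK: "S \<subseteq> K" using Q WK by (auto simp: S_def)
  have WS: "W \<subseteq> S" using Q WK by (auto simp: S_def)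
  have rS: "r \<in> S" using Q WK by (auto simp: S_def W_def)
  have parS: "par y \<in> S" if "y \<in> S" "y \<noteq> r" for y using Q WK that by (auto simp: S_def)
  have "card S \<le> (\<Sum>x\<in>W. card (Q x))" unfolding S_def by (rule card_UN_le[OF finW])
  also have "\<dots> \<le> (\<Sum>x\<in>W. L)" using Q WK by (intro sum_mono) auto
  also have "\<dots> \<le> 4 * L" using \<open>card W \<le> 4\<close> by simp
  finally have S4: "card S \<le> 4 * L" .
  \<comment> \<open>The parent edge in the orientation used by \<open>E\<close>. It determines
    \<open>y\<close>, because two vertices cannot be parents of each other when levels drop by
    one.\<close>
  define t where "t y = (min y (par y), max y (par y))" for y
  have tE: "t y \<in> E \<inter> S \<times> S" if y: "y \<in> S - {r}" for y
  proof -
    have "adj E (par y) y" "par y \<in> S" using par[of y] y SK parS by auto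
    then have "(y, par y) \<in> E \<or> (par y, y) \<in> E" by (auto simp: adj_def)
    then show ?thesis using y \<open>par y \<in> S\<close> E_sub by (auto simp: t_def vertex_pairs_def min_def max_def)
  qed
  have "y = z" if "t y = t z" "y \<in> S - {r}" "z \<in> S - {r}" for y z
  proof (rule ccontr)
    assume "y \<noteq> z"
    then have "y = par z" "z = par y" using that(1) by (auto simp: t_def min_def max_def split: if_splits)
    moreover have "y \<in> K" "z \<in> K" using that SK by blast+
    ultimately show False using par(3)[of y] par(3)[of z] that by auto
  qed
  then have inj: "inj_on t (S - {r})" by (auto intro: inj_onI)
  have nt: "t y \<noteq> e" if "nontree e" "y \<in> S - {r}" for y e
  proof
    assume "t y = e"
    then have "fst e = y \<and> snd e = par y \<or> fst e = par y \<and> snd e = y"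
      by (cases "y \<le> par y") (auto simp: t_def)
    then show False using that by (auto simp: nontree_def)
  qed
  have finE: "finite (E \<inter> S \<times> S)" using conn_finite[OF cS] by simp
  have "insert e1 (insert e2 (t ` (S - {r}))) \<subseteq> E \<inter> S \<times> S"
  proof -
    have "e \<in> E \<inter> S \<times> S" if "nontree e" "fst e \<in> W" "snd e \<in> W" for e
      using that(1) subsetD[OF WS that(2)] subsetD[OF WS that(3)] by (simp add: nontree_def mem_Times_iff)
    then have "e1 \<in> E \<inter> S \<times> S" "e2 \<in> E \<inter> S \<times> S" using e by (simp_all add: W_def)
    moreover have "t ` (S - {r}) \<subseteq> E \<inter> S \<times> S" by (rule image_subsetI) (rule tE)
    ultimately show ?thesis by (simp only: insert_subset)
  qed
  then have "card (insert e1 (insert e2 (t ` (S - {r})))) \<le> card (E \<inter> S \<times> S)"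
    by (rule card_mono[OF finE])
  moreover have "card (insert e1 (insert e2 (t ` (S - {r})))) = Suc (Suc (card (S - {r})))"
  proof -
    have "e1 \<notin> t ` (S - {r})" "e2 \<notin> t ` (S - {r})" using nt e by blast+
    then show ?thesis using ne conn_finite[OF cS] by (simp add: card_image[OF inj])
  qed
  moreover have "card S = Suc (card (S - {r}))"
    using rS conn_finite[OF cS] by (metis card_Suc_Diff1)
  ultimately have "card S + 1 \<le> card (E \<inter> S \<times> S)" by simp
  then show False using bicycle cS S4 SK KH HV unfolding bicycle_free_def by blast
qed

text \<open>Removing one end of the only possible non-tree edge leaves a forest of parent edges on
  at most \<open>L\<close> levels; that vertex accounts for the extra factor 3.\<close>

lemma PC_K: "PC K (4 * 3 ^ Suc L)"
proof -
  obtain z where z: "z \<in> K" "\<And>e. nontree e \<Longrightarrow> z = fst e"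
  proof (cases "\<exists>e. nontree e")
    case True
    then obtain e where e: "nontree e" by blast
    show ?thesis
    proof (rule that[of "fst e"])
      show "fst e \<in> K" using e by (simp add: nontree_def)
      show "fst e = fst e'" if "nontree e'" for e'
        by (rule arg_cong[OF nontree_unique[OF e that]])
    qed
  \<comment> \<open>If all edges are tree edges, the choice of \<open>z\<close> is
    arbitrary.\<close>
  qed (use that[of r] r_K in auto)
  have edge: "par u = v \<and> h u = Suc (h v) \<or> par v = u \<and> h v = Suc (h u)"
    if uv: "u \<in> K - {z}" "v \<in> K - {z}" "adj E u v" for u v
  proof -
    have *: "par u = v \<and> h u = Suc (h v) \<or> par v = u \<and> h v = Suc (h u)"
      if "(u, v) \<in> E" "u \<in> K - {z}" "v \<in> K - {z}" for u v
    proof -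
      have "\<not> nontree (u, v)" using z(2)[of "(u, v)"] that by auto
      then show ?thesis using that par(3) by (auto simp: nontree_def)
    qed
    show ?thesis using uv *[of u v] *[of v u] by (auto simp: adj_def)
  qed
  have "PC (K - {z}) (4 * 3 ^ L)"
    by (rule PC_forest[OF lam1, of "K - {z}" par h, OF edge, where a = 0 and k = L]) (use depth_less finite_K in auto)
  then show ?thesis
  proof (rule PC_delete[OF _ z(1) finite_K])
    have "(1 + 2 * lam) * (4 * 3 ^ L) \<le> 3 * (4 * 3 ^ L)"
      using lam1 by (intro mult_right_mono) auto
    then show "(1 + 2 * lam) * (4 * 3 ^ L) \<le> 4 * 3 ^ Suc L" by simp
    have "(1::real) \<le> 3 ^ Suc L" by (rule one_le_power) simp
    then have "4 * (1::real) \<le> 4 * 3 ^ Suc L" by (intro mult_left_mono) auto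
    then show "2 * (1 + lam) \<le> 4 * 3 ^ Suc L" using lam1 by argo
  qed simp
qed

end

text \<open>Components are split off one by one; since \<open>PC_union\<close> keeps the constant,
  their number does not enter.\<close>

lemma PC_hset:
  assumes lam1: "lam \<le> 1" and L: "1 \<le> L"
    and dense: "dense_free n E D L" and bicycle: "bicycle_free n E (4 * L)"
  shows "PC (hset n E D) (4 * 3 ^ Suc L)"
proof -
  let ?H = "hset n E D"
  define Q where "Q = {(u, v). u \<in> ?H \<and> v \<in> ?H \<and> adj E u v}"
  have HV: "?H \<subseteq> V" by (auto simp: hset_def heavy_def)
  have "B \<subseteq> ?H \<Longrightarrow> (\<And>u v. u \<in> B \<Longrightarrow> (u, v) \<in> Q \<Longrightarrow> v \<in> B) \<Longrightarrow> PC B (4 * 3 ^ Suc L)" for B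
  proof (induction "card B" arbitrary: B rule: less_induct)
    case less
    have finB: "finite B"
      by (rule finite_subset[OF subset_trans[OF less.prems(1) HV]]) simp
    show ?case
    proof (cases "B = {}")
      case True
      then show ?thesis by (simp add: PC_empty)
    next
      case False
      then obtain r where r: "r \<in> B" by blast
      define C where "C = Q\<^sup>* `` {r}"
      have PK: "PC C (4 * 3 ^ Suc L)"
      proof -
        have rH: "r \<in> ?H" using r less.prems by blast
        note a = lam1 L dense bicycle rH
        have "K D r = C"
          by (simp add: K_def[OF a] R_def[OF a] H_def[OF a] C_def Q_def)
        then show ?thesis using PC_K[OF a] by simp
      qed
      have CB: "C \<subseteq> B"
      proof
        fix x assume "x \<in> C"
        then have "(r, x) \<in> Q\<^sup>*" by (simp add: C_def)
        then show "x \<in> B" using r less.prems(2) by (induction rule: rtrancl_induct) auto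
      qed
      have rC: "r \<in> C" by (simp add: C_def)
      have Cs: "v \<in> C" if "u \<in> C" "(u, v) \<in> Q" for u v
        using that unfolding C_def by (auto intro: rtrancl_into_rtrancl)
      have c1: "card (B - C) < card B"
        using r rC finB by (intro psubset_card_mono) auto
      have c2: "v \<in> B - C" if "u \<in> B - C" "(u, v) \<in> Q" for u v
      proof -
        have "(v, u) \<in> Q" using that by (auto simp: Q_def adj_sym)
        then show ?thesis using that Cs less.prems(2) by blast
      qed
      have PB: "PC (B - C) (4 * 3 ^ Suc L)"
        by (rule less.hyps[OF c1 _ c2]) (use less.prems(1) in blast)
      have ne: "\<not> adj E u v" if "u \<in> C" "v \<in> B - C" for u v
      proof
        assume "adj E u v"
        moreover have "u \<in> ?H" "v \<in> ?H" using that CB less.prems(1) by blast+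
        ultimately have "(u, v) \<in> Q" by (simp add: Q_def)
        then show False using Cs that by blast
      qed
      have "PC (C \<union> (B - C)) (4 * 3 ^ Suc L)"
        using finite_subset[OF CB finB] finB by (intro PC_union ne PK PB) auto
      then show ?thesis using CB by (simp add: Un_absorb1)
    qed
  qed
  from this[of ?H] show ?thesis by (auto simp: Q_def)
qed

end

section \<open>Sparse random graphs\<close>

lemma finite_vertex_pairs [simp]: "finite (vertex_pairs n)"
  by (rule finite_subset[of _ "{0..<n} \<times> {0..<n}"]) (auto simp: vertex_pairs_def)

section \<open>Spanning trees and their enumeration\<close>

definition edge :: "nat \<Rightarrow> nat \<Rightarrow> nat \<times> nat" where
  "edge u v = (min u v, max u v)"

lemma adj_edge: "E \<subseteq> vertex_pairs n \<Longrightarrow> adj E u v \<Longrightarrow> edge u v \<in> E"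
  by (auto simp: adj_def edge_def vertex_pairs_def min_def max_def)

text \<open>A tree is cut at an edge of its root into two rooted trees, the recursion of the Catalan
  numbers. A tree may be cut in several ways; the counting draws only an upper bound from
  this.\<close>

inductive rtree :: "nat \<Rightarrow> nat set \<Rightarrow> (nat \<times> nat) set \<Rightarrow> bool" where
  leaf: "rtree v {v} {}"
| join: "rtree v U1 T1 \<Longrightarrow> rtree u U2 T2 \<Longrightarrow> U1 \<inter> U2 = {} \<Longrightarrow>
    rtree v (U1 \<union> U2) (insert (edge v u) (T1 \<union> T2))"

lemma rtree_props:
  "rtree v U T \<Longrightarrow> v \<in> U \<and> finite U \<and> T \<subseteq> U \<times> U \<and> finite T \<and> card U = Suc (card T) \<and>
     (U \<subseteq> {0..<n} \<longrightarrow> T \<subseteq> vertex_pairs n)"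
proof (induction rule: rtree.induct)
  case (join v U1 T1 u U2 T2)
  have uv: "v \<in> U1" "u \<in> U2" "v \<noteq> u" using join by auto
  have e: "edge v u \<notin> T1 \<union> T2" "edge v u \<in> (U1 \<union> U2) \<times> (U1 \<union> U2)"
    using join uv by (auto simp: edge_def min_def max_def)
  have "T1 \<inter> T2 = {}" using join by blast
  then have "card (insert (edge v u) (T1 \<union> T2)) = Suc (card T1 + card T2)"
    using e join by (simp add: card_Un_disjoint)
  moreover have "card (U1 \<union> U2) = card U1 + card U2"
    using join by (simp add: card_Un_disjoint)
  moreover have "edge v u \<in> vertex_pairs n" if "U1 \<union> U2 \<subseteq> {0..<n}"
    using that uv by (auto simp: edge_def vertex_pairs_def min_def max_def)
  ultimately show ?case using join e by auto
qed auto

text \<open>A new vertex may hang from any vertex, while \<open>join\<close> works at the root only;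
  the induction descends into the part that contains \<open>u\<close>.\<close>

lemma rtree_attach:
  assumes "rtree r U T"
  shows "u \<in> U \<Longrightarrow> v \<notin> U \<Longrightarrow> T \<subseteq> E \<Longrightarrow> edge u v \<in> E \<Longrightarrow> \<exists>T'. rtree r (insert v U) T' \<and> T' \<subseteq> E"
  using assms
proof (induction rule: rtree.induct)
  case (leaf r)
  have "rtree r ({r} \<union> {v}) (insert (edge r v) ({} \<union> {}))"
    using leaf by (intro rtree.intros) auto
  then show ?case using leaf by (intro exI[of _ "{edge r v}"]) (auto simp: insert_commute)
next
  case (join r U1 T1 w U2 T2)
  show ?case
  proof (cases "u \<in> U1")
    case True
    then obtain T' where T': "rtree r (insert v U1) T'" "T' \<subseteq> E" using join by auto
    have "rtree r (insert v U1 \<union> U2) (insert (edge r w) (T' \<union> T2))"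
      using T' join by (intro rtree.join) auto
    then show ?thesis using T' join.prems by (intro exI[of _ "insert (edge r w) (T' \<union> T2)"]) auto
  next
    case False
    then obtain T' where T': "rtree w (insert v U2) T'" "T' \<subseteq> E" using join by auto
    have "rtree r (U1 \<union> insert v U2) (insert (edge r w) (T1 \<union> T'))"
      using T' join by (intro rtree.join) auto
    then show ?thesis using T' join.prems by (intro exI[of _ "insert (edge r w) (T1 \<union> T')"]) auto
  qed
qed

definition trees :: "nat \<Rightarrow> nat \<Rightarrow> nat \<Rightarrow> (nat set \<times> (nat \<times> nat) set) set" where
  "trees n m v = {(U, T). rtree v U T \<and> U \<subseteq> {0..<n} \<and> card U = m}"

lemma conn_spanning_tree:
  assumes "E \<subseteq> vertex_pairs n" "conn E U" "U \<subseteq> {0..<n}"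
  shows "\<exists>v\<in>{0..<n}. \<exists>T \<subseteq> E. (U, T) \<in> trees n (card U) v"
proof -
  have "\<exists>v T. rtree v U T \<and> T \<subseteq> E"
    using assms(2)
  proof (induction rule: conn.induct)
    case (single v)
    then show ?case using rtree.leaf by blast
  next
    case (step U u v)
    then show ?case using rtree_attach adj_edge[OF assms(1)] by metis
  qed
  then obtain v T where T: "rtree v U T" "T \<subseteq> E" by blast
  then have "v \<in> {0..<n}" using rtree_props[OF T(1)] assms(3) by blast
  then show ?thesis using T assms(3) by (intro bexI[of _ v] exI[of _ T]) (auto simp: trees_def)
qed

lemma trees_sub: "trees n m v \<subseteq> Pow {0..<n} \<times> Pow (vertex_pairs n)"
proof
  fix z assume "z \<in> trees n m v"
  then obtain U T where z: "z = (U, T)" "rtree v U T" "U \<subseteq> {0..<n}" by (auto simp: trees_def)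
  then have "T \<subseteq> vertex_pairs n" using rtree_props[OF z(2), of n] by blast
  then show "z \<in> Pow {0..<n} \<times> Pow (vertex_pairs n)" using z by simp
qed

lemma finite_trees: "finite (trees n m v)"
  by (rule finite_subset[OF trees_sub]) simp

text \<open>The generating function of \<open>c\<close>, evaluated at \<open>1/4\<close>, stays below \<open>1/2\<close>, the fixed point of
  \<open>x \<mapsto> 1/4 + x\<^sup>2\<close>.\<close>

lemma catalan_bound:
  fixes c :: "nat \<Rightarrow> real"
  assumes nn: "\<And>m. 0 \<le> c m" and c0: "c 0 = 0" and c1: "c 1 \<le> 1"
    and rec: "\<And>m. 2 \<le> m \<Longrightarrow> c m \<le> (\<Sum>k\<in>{1..<m}. c k * c (m - k))"
  shows "c m \<le> 4 ^ m / 2"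
proof -
  define x where "x m = c m / 4 ^ m" for m
  have x0: "0 \<le> x m" for m using nn by (simp add: x_def)
  have S: "(\<Sum>m\<in>{1..M}. x m) \<le> 1 / 2" for M
  proof (induction M)
    case (Suc M)
    have "(\<Sum>m\<in>{2..Suc M}. x m) \<le> (\<Sum>m\<in>{2..Suc M}. \<Sum>k\<in>{1..<m}. x k * x (m - k))"
    proof (rule sum_mono)
      fix m assume m: "m \<in> {2..Suc M}"
      have "x m \<le> (\<Sum>k\<in>{1..<m}. c k * c (m - k)) / 4 ^ m"
        unfolding x_def using rec[of m] m by (intro divide_right_mono) auto
      also have "\<dots> = (\<Sum>k\<in>{1..<m}. x k * x (m - k))"
        unfolding sum_divide_distrib x_def by (intro sum.cong) (auto simp flip: power_add)
      finally show "x m \<le> (\<Sum>k\<in>{1..<m}. x k * x (m - k))" .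
    qed
    also have "\<dots> = (\<Sum>(m, k)\<in>(SIGMA m:{2..Suc M}. {1..<m}). x k * x (m - k))"
      by (rule sum.Sigma) auto
    also have "\<dots> = (\<Sum>(k, l)\<in>(\<lambda>(m, k). (k, m - k)) ` (SIGMA m:{2..Suc M}. {1..<m}). x k * x l)"
      by (subst sum.reindex) (auto simp: inj_on_def intro!: sum.cong)
    also have "\<dots> \<le> (\<Sum>(k, l)\<in>{1..M} \<times> {1..M}. x k * x l)"
      using x0 by (intro sum_mono2) auto
    also have "\<dots> = (\<Sum>k\<in>{1..M}. x k) * (\<Sum>k\<in>{1..M}. x k)"
      by (simp add: sum_product sum.cartesian_product)
    also have "\<dots> \<le> 1 / 2 * (1 / 2)"
      using Suc x0 by (intro mult_mono sum_nonneg) auto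
    finally have "(\<Sum>m\<in>{2..Suc M}. x m) \<le> 1 / 4" by simp
    moreover have "(\<Sum>m\<in>{1..Suc M}. x m) = x 1 + (\<Sum>m\<in>{2..Suc M}. x m)"
      by (subst sum.atLeast_Suc_atMost) (auto simp: numeral_2_eq_2)
    moreover have "x 1 \<le> 1 / 4" using c1 by (simp add: x_def)
    ultimately show ?case by simp
  qed simp
  have "x m \<le> 1 / 2"
  proof (cases "m = 0")
    case False
    then have "x m \<le> (\<Sum>m\<in>{1..m}. x m)" using x0 by (intro member_le_sum) auto
    then show ?thesis using S[of m] by linarith
  qed (simp add: x_def c0)
  then show ?thesis by (simp add: x_def field_simps)
qed

definition all_trees :: "nat \<Rightarrow> nat \<Rightarrow> (nat set \<times> (nat \<times> nat) set) set" where
  "all_trees n m = (\<Union>v\<in>{0..<n}. trees n m v)"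

lemma finite_all_trees: "finite (all_trees n m)"
  by (simp add: all_trees_def finite_trees)

text \<open>Splitting trees at an edge of the root bounds their number by Catalan numbers, without the factor
  \<open>m!\<close> that orderings of the vertices would cost.\<close>

lemma card_all_trees:
  assumes n: "n > 0"
  shows "real (card (all_trees n m)) \<le> (4 * real n) ^ m"
proof -
  define C where "C m = Max ((\<lambda>v. card (trees n m v)) ` {0..<n})" for m
  have C: "card (trees n m v) \<le> C m" if "v \<in> {0..<n}" for v m
    using that by (simp add: C_def)
  have Cle: "C m \<le> b" if "\<And>v. v \<in> {0..<n} \<Longrightarrow> card (trees n m v) \<le> b" for m b
    using that n by (auto simp: C_def)
  \<comment> \<open>Each cut costs a factor \<open>n\<close> for the root \<open>u\<close> of the
    second part. Scaling by \<open>n / n ^ m\<close> absorbs it and leaves the pure Catalan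
    recursion.\<close>
  define c where "c m = real n * C m / real n ^ m" for m
  have "c m \<le> 4 ^ m / 2" for m
  proof (rule catalan_bound)
    have "trees n 0 v = {}" for v using rtree_props[of v _ _ n] by (auto simp: trees_def)
    then have "C 0 \<le> 0" by (intro Cle) simp
    then show "c 0 = 0" by (simp add: c_def)
    have "trees n 1 v \<subseteq> {({v}, {})}" for v
    proof
      fix z assume "z \<in> trees n 1 v"
      then obtain U T where z: "z = (U, T)" "rtree v U T" "card U = 1" by (auto simp: trees_def)
      have "v \<in> U" "card T = 0" "finite T" using rtree_props[OF z(2)] z(3) by auto
      then show "z \<in> {({v}, {})}" using z by (auto simp: card_1_singleton_iff)
    qed
    then have "card (trees n 1 v) \<le> card {({v}, {} :: (nat \<times> nat) set)}" for v by (intro card_mono) auto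
    then have "C 1 \<le> 1" by (intro Cle) simp
    then show "c 1 \<le> 1" using n by (simp add: c_def)
    show "0 \<le> c m" for m by (simp add: c_def)
    fix m :: nat assume m: "2 \<le> m"
    have "C m \<le> (\<Sum>k\<in>{1..<m}. n * (C k * C (m - k)))"
    proof (rule Cle)
      fix v assume v: "v \<in> {0..<n}"
      let ?f = "\<lambda>u ((U1, T1), (U2, T2)). (U1 \<union> U2, insert (edge v u) (T1 \<union> T2))"
      have "trees n m v \<subseteq> (\<Union>k\<in>{1..<m}. \<Union>u\<in>{0..<n}. ?f u ` (trees n k v \<times> trees n (m - k) u))"
      proof
        fix z assume "z \<in> trees n m v"
        then obtain U T where z: "z = (U, T)" and t: "rtree v U T" and U: "U \<subseteq> {0..<n}" "card U = m"
          by (auto simp: trees_def)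
        from t show "z \<in> (\<Union>k\<in>{1..<m}. \<Union>u\<in>{0..<n}. ?f u ` (trees n k v \<times> trees n (m - k) u))"
        proof cases
          case leaf
          then show ?thesis using U m by simp
        next
          case (join U1 T1 u U2 T2)
          have fin: "finite U1" "finite U2" "u \<in> U2" "v \<in> U1"
            using rtree_props[OF join(3)] rtree_props[OF join(4)] by auto
          have "card U1 + card U2 = m" using U join fin by (simp add: card_Un_disjoint)
          moreover have "card U1 \<noteq> 0" "card U2 \<noteq> 0" using fin by auto
          ultimately have k: "card U1 \<in> {1..<m}" "card U2 = m - card U1" by auto
          have "(U1, T1) \<in> trees n (card U1) v" "(U2, T2) \<in> trees n (m - card U1) u" "u \<in> {0..<n}"
            using join U k fin by (auto simp: trees_def)
          then show ?thesis using k z join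
            by (intro UN_I[of "card U1"] UN_I[of u] image_eqI[of _ _ "((U1, T1), (U2, T2))"]) auto
        qed
      qed
      then have "card (trees n m v) \<le> card (\<Union>k\<in>{1..<m}. \<Union>u\<in>{0..<n}. ?f u ` (trees n k v \<times> trees n (m - k) u))"
        by (intro card_mono) (auto simp: finite_trees)
      also have "\<dots> \<le> (\<Sum>k\<in>{1..<m}. card (\<Union>u\<in>{0..<n}. ?f u ` (trees n k v \<times> trees n (m - k) u)))"
        by (rule card_UN_le) simp
      also have "\<dots> \<le> (\<Sum>k\<in>{1..<m}. \<Sum>u\<in>{0..<n}. card (?f u ` (trees n k v \<times> trees n (m - k) u)))"
        by (intro sum_mono card_UN_le) simp
      also have "\<dots> \<le> (\<Sum>k\<in>{1..<m}. \<Sum>u\<in>{0..<n}. C k * C (m - k))"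
      proof (intro sum_mono)
        fix k u assume "u \<in> {0..<n}"
        have "card (?f u ` (trees n k v \<times> trees n (m - k) u)) \<le> card (trees n k v \<times> trees n (m - k) u)"
          by (rule card_image_le) (simp add: finite_trees)
        also have "\<dots> \<le> C k * C (m - k)"
          using C[OF v] C[OF \<open>u \<in> {0..<n}\<close>] by (simp add: card_cartesian_product mult_le_mono)
        finally show "card (?f u ` (trees n k v \<times> trees n (m - k) u)) \<le> C k * C (m - k)" .
      qed
      finally show "card (trees n m v) \<le> (\<Sum>k\<in>{1..<m}. n * (C k * C (m - k)))" by simp
    qed
    then have "real (C m) \<le> real (\<Sum>k\<in>{1..<m}. n * (C k * C (m - k)))" by (rule of_nat_mono)
    then have "c m \<le> real n * real (\<Sum>k\<in>{1..<m}. n * (C k * C (m - k))) / real n ^ m"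
      unfolding c_def by (intro divide_right_mono mult_left_mono) auto
    also have "\<dots> = (\<Sum>k\<in>{1..<m}. c k * c (m - k))"
      unfolding c_def of_nat_sum sum_distrib_left sum_divide_distrib
      by (intro sum.cong) (auto simp flip: power_add)
    finally show "c m \<le> (\<Sum>k\<in>{1..<m}. c k * c (m - k))" .
  qed
  then have "c m \<le> 4 ^ m / 2" .
  also have "\<dots> \<le> 4 ^ m" by simp
  finally have "real n * C m \<le> 4 ^ m * real n ^ m" using n by (simp add: c_def divide_le_eq)
  moreover have "card (all_trees n m) \<le> n * C m"
  proof -
    have "card (all_trees n m) \<le> (\<Sum>v\<in>{0..<n}. card (trees n m v))"
      unfolding all_trees_def by (rule card_UN_le) simp
    also have "\<dots> \<le> (\<Sum>v\<in>{0..<n}. C m)" by (intro sum_mono C)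
    finally show ?thesis by simp
  qed
  then have "real (card (all_trees n m)) \<le> real n * C m" using of_nat_mono by fastforce
  ultimately show ?thesis by (simp add: power_mult_distrib)
qed

section \<open>Exponential moments of degree sums\<close>

definition inc :: "nat set \<Rightarrow> nat \<times> nat \<Rightarrow> nat" where
  "inc U e = of_bool (fst e \<in> U) + of_bool (snd e \<in> U)"

lemma sum_deg:
  assumes E: "E \<subseteq> vertex_pairs n" and U: "finite U"
  shows "(\<Sum>v\<in>U. deg E v) = (\<Sum>e\<in>E. inc U e)"
proof -
  have fin: "finite E" by (rule finite_subset[OF E finite_vertex_pairs])
  have "deg E v = (\<Sum>e\<in>E. of_bool (fst e = v) + of_bool (snd e = v))" for v
  proof -
    let ?A = "{e \<in> E. fst e = v}" and ?B = "{e \<in> E. snd e = v}"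
    have "{u. adj E v u} = snd ` ?A \<union> fst ` ?B" by (force simp: adj_def)
    moreover have "snd ` ?A \<inter> fst ` ?B = {}"
    proof (rule equals0I)
      fix w assume "w \<in> snd ` ?A \<inter> fst ` ?B"
      then have "(v, w) \<in> E" "(w, v) \<in> E" by auto
      then have "(v, w) \<in> vertex_pairs n" "(w, v) \<in> vertex_pairs n" using E by blast+
      then show False by (auto simp: vertex_pairs_def)
    qed
    ultimately have "deg E v = card (snd ` ?A) + card (fst ` ?B)"
      using fin by (simp add: deg_def card_Un_disjoint)
    also have "card (snd ` ?A) = card ?A" by (rule card_image) (auto simp: inj_on_def prod_eq_iff)
    also have "card (fst ` ?B) = card ?B" by (rule card_image) (auto simp: inj_on_def prod_eq_iff)
    also have "card ?A + card ?B = (\<Sum>e\<in>E. of_bool (fst e = v) + of_bool (snd e = v))"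
      using fin by (simp add: sum.distrib sum_of_bool_eq Int_def)
    finally show ?thesis .
  qed
  then have "(\<Sum>v\<in>U. deg E v) = (\<Sum>v\<in>U. \<Sum>e\<in>E. of_bool (fst e = v) + of_bool (snd e = v))" by simp
  also have "\<dots> = (\<Sum>e\<in>E. \<Sum>v\<in>U. of_bool (fst e = v) + of_bool (snd e = v))" by (rule sum.swap)
  also have "\<dots> = (\<Sum>e\<in>E. inc U e)"
    using U by (intro sum.cong) (simp_all add: sum.distrib inc_def of_bool_def)
  finally show ?thesis .
qed

text \<open>Convexity: \<open>inc\<close> takes only the values \<open>0\<close>, \<open>1\<close> and \<open>2\<close>. This makes edges inside \<open>U\<close> cost no more than
  two edges leaving \<open>U\<close>.\<close>

lemma exp_inc_le:
  fixes s :: real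
  shows "exp (s * inc U e) - 1 \<le> (exp (2 * s) - 1) / 2 * inc U e"
proof -
  have "0 \<le> (exp s - 1)\<^sup>2" by simp
  then have "exp s - 1 \<le> (exp (2 * s) - 1) / 2"
    by (simp add: power2_eq_square algebra_simps flip: exp_add)
  moreover have "inc U e = 0 \<or> inc U e = 1 \<or> inc U e = 2" by (auto simp: inc_def)
  ultimately show ?thesis by (auto simp: mult.commute)
qed

text \<open>Chernoff bound with tilt \<open>s\<close>, carried out jointly with the event that
  \<open>T\<close> is present. A tree edge contributes at most \<open>q * exp (2 * s)\<close>,
  having at most two ends in \<open>U\<close>. For \<open>s = 0\<close> and empty \<open>U\<close>
  this is the plain bound \<open>q ^ card T\<close>.\<close>

lemma prob_heavy_tree:
  fixes s q D :: real
  assumes q: "0 \<le> q" "q \<le> 1" and s: "0 \<le> s" and T: "T \<subseteq> vertex_pairs n" and U: "U \<subseteq> {0..<n}"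
  shows "measure_pmf.prob (erdos_renyi n q) {E. T \<subseteq> E \<and> D * card U \<le> (\<Sum>v\<in>U. deg E v)}
    \<le> (q * exp (2 * s)) ^ card T * exp ((q * (exp (2 * s) - 1) / 2 * n - s * D) * card U)"
proof -
  let ?vp = "vertex_pairs n"
  define \<kappa> where "\<kappa> = q * (exp (2 * s) - 1) / 2"
  have k0: "0 \<le> \<kappa>" using q s by (simp add: \<kappa>_def)
  have finU: "finite U" using U finite_subset by blast
  \<comment> \<open>One factor per potential edge: the indicator that a tree edge is present, times
    the exponential tilt. Independence then turns the expectation into a product.\<close>
  define F where "F e b = (if e \<in> T \<and> \<not> b then 0 else 1) * (if b then exp (s * inc U e) else 1)" for e b
  have F0: "0 \<le> F e b" for e b by (simp add: F_def)
  define G where "G f = {e \<in> ?vp. f e}" for f :: "nat \<times> nat \<Rightarrow> bool"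
  have key: "indicator {E. T \<subseteq> E \<and> D * card U \<le> (\<Sum>v\<in>U. deg E v)} (G f)
      \<le> exp (- s * D * card U) * (\<Prod>e\<in>?vp. F e (f e))" for f
  proof (cases "T \<subseteq> G f \<and> D * card U \<le> (\<Sum>v\<in>U. deg (G f) v)")
    case True
    have Gvp: "G f \<subseteq> ?vp" by (auto simp: G_def)
    have "(\<Prod>e\<in>?vp. F e (f e)) = (\<Prod>e\<in>?vp. if f e then exp (s * inc U e) else 1)"
      using True by (intro prod.cong) (auto simp: F_def G_def)
    also have "\<dots> = (\<Prod>e\<in>G f. exp (s * inc U e))"
      unfolding G_def by (rule prod.inter_filter[symmetric]) simp
    also have "\<dots> = exp (\<Sum>e\<in>G f. s * inc U e)"
      using finite_subset[OF Gvp] by (subst exp_sum) auto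
    also have "(\<Sum>e\<in>G f. s * inc U e) = s * (\<Sum>v\<in>U. deg (G f) v)"
      unfolding sum_deg[OF Gvp finU] by (simp add: sum_distrib_left)
    finally have "exp (- s * D * card U) * (\<Prod>e\<in>?vp. F e (f e)) = exp (s * ((\<Sum>v\<in>U. deg (G f) v) - D * card U))"
      by (simp add: algebra_simps flip: exp_add)
    moreover have "1 \<le> exp (s * ((\<Sum>v\<in>U. deg (G f) v) - D * card U))"
      using True s by simp
    ultimately show ?thesis by (simp add: indicator_def)
  next
    case False
    then show ?thesis using F0 by (auto intro!: mult_nonneg_nonneg prod_nonneg)
  qed
  have int: "integrable (measure_pmf (Pi_pmf ?vp False (\<lambda>_. bernoulli_pmf q))) h" for h :: "_ \<Rightarrow> real"
    by (rule integrable_measure_pmf_finite) (simp add: set_Pi_pmf finite_PiE_dflt)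
  have bern: "measure_pmf.expectation (bernoulli_pmf q) (F e) \<le>
      (if e \<in> T then q * exp (2 * s) else exp (\<kappa> * inc U e))" for e
  proof (cases "e \<in> T")
    case True
    have "s * inc U e \<le> s * 2" using s by (intro mult_left_mono) (auto simp: inc_def)
    then show ?thesis using True q by (simp add: F_def mult.commute mult_left_mono)
  next
    case False
    have "measure_pmf.expectation (bernoulli_pmf q) (F e) = 1 + q * (exp (s * inc U e) - 1)"
      using False q by (simp add: F_def algebra_simps)
    also have "\<dots> \<le> 1 + q * ((exp (2 * s) - 1) / 2 * inc U e)"
      using q exp_inc_le by (intro add_left_mono mult_left_mono) auto
    also have "\<dots> = 1 + \<kappa> * inc U e" by (simp add: \<kappa>_def)
    also have "\<dots> \<le> exp (\<kappa> * inc U e)" by (rule exp_ge_add_one_self)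
    finally show ?thesis using False by simp
  qed
  \<comment> \<open>The degree sum of \<open>U\<close> in the complete graph.\<close>
  have inctot: "(\<Sum>e\<in>?vp. real (inc U e)) \<le> real n * card U"
  proof -
    have "(\<Sum>e\<in>?vp. inc U e) = (\<Sum>v\<in>U. deg ?vp v)" using sum_deg[OF subset_refl finU] by simp
    also have "\<dots> \<le> (\<Sum>v\<in>U. n)"
    proof (rule sum_mono)
      fix v
      have "deg ?vp v \<le> card {0..<n}"
        unfolding deg_def by (rule card_mono) (auto simp: adj_def vertex_pairs_def)
      then show "deg ?vp v \<le> n" by simp
    qed
    finally have "real (\<Sum>e\<in>?vp. inc U e) \<le> real (card U * n)" by (simp only: of_nat_le_iff sum_constant of_nat_id)
    then show ?thesis by (simp add: mult.commute)
  qed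
  let ?X = "{E. T \<subseteq> E \<and> D * card U \<le> (\<Sum>v\<in>U. deg E v)}"
  have "measure_pmf.prob (erdos_renyi n q) ?X = measure_pmf.expectation (erdos_renyi n q) (indicator ?X)"
    by simp
  also have "\<dots> = measure_pmf.expectation (Pi_pmf ?vp False (\<lambda>_. bernoulli_pmf q)) (\<lambda>f. indicator ?X (G f))"
    unfolding erdos_renyi_def G_def by (rule integral_map_pmf)
  also have "\<dots> \<le> measure_pmf.expectation (Pi_pmf ?vp False (\<lambda>_. bernoulli_pmf q))
          (\<lambda>f. exp (- s * D * card U) * (\<Prod>e\<in>?vp. F e (f e)))"
    by (intro integral_mono int key)
  also have "\<dots> = exp (- s * D * card U) * (\<Prod>e\<in>?vp. measure_pmf.expectation (bernoulli_pmf q) (F e))"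
    using F0 by (simp add: expectation_prod_Pi_pmf integrable_measure_pmf_finite)
  also have "\<dots> \<le> exp (- s * D * card U) * (\<Prod>e\<in>?vp. if e \<in> T then q * exp (2 * s) else exp (\<kappa> * inc U e))"
    using F0 bern by (intro mult_left_mono prod_mono conjI Bochner_Integration.integral_nonneg) auto
  also have "(\<Prod>e\<in>?vp. if e \<in> T then q * exp (2 * s) else exp (\<kappa> * inc U e))
      = (q * exp (2 * s)) ^ card T * (\<Prod>e\<in>?vp - T. exp (\<kappa> * inc U e))"
  proof -
    have "?vp \<inter> {x. x \<in> T} = T" "?vp \<inter> - {x. x \<in> T} = ?vp - T" using T by auto
    then show ?thesis by (simp add: prod.If_cases)
  qed
  also have "(\<Prod>e\<in>?vp - T. exp (\<kappa> * inc U e)) \<le> exp (\<kappa> * (real n * card U))"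
  proof -
    have "(\<Prod>e\<in>?vp - T. exp (\<kappa> * inc U e)) = exp (\<kappa> * (\<Sum>e\<in>?vp - T. real (inc U e)))"
      by (simp add: exp_sum sum_distrib_left)
    also have "\<dots> \<le> exp (\<kappa> * (\<Sum>e\<in>?vp. real (inc U e)))"
      using k0 by (simp add: mult_left_mono sum_mono2)
    also have "\<dots> \<le> exp (\<kappa> * (real n * card U))"
      using k0 inctot by (simp add: mult_left_mono)
    finally show ?thesis .
  qed
  finally have "measure_pmf.prob (erdos_renyi n q) {E. T \<subseteq> E \<and> D * card U \<le> (\<Sum>v\<in>U. deg E v)}
     \<le> exp (- s * D * card U) * ((q * exp (2 * s)) ^ card T * exp (\<kappa> * (real n * card U)))"
    using q by (simp add: mult_left_mono)
  also have "\<dots> = (q * exp (2 * s)) ^ card T * exp ((\<kappa> * n - s * D) * card U)"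
    by (simp add: algebra_simps flip: exp_add)
  finally show ?thesis by (simp add: \<kappa>_def)
qed

section \<open>First-moment bounds for dense sets and bicycles\<close>

lemma set_erdos_renyi: "E \<in> set_pmf (erdos_renyi n q) \<Longrightarrow> E \<subseteq> vertex_pairs n"
  by (auto simp: erdos_renyi_def)

lemma prob_le_cover:
  assumes "finite I" "\<And>x. x \<in> set_pmf M \<Longrightarrow> x \<in> X \<Longrightarrow> \<exists>i\<in>I. x \<in> A i"
    and "\<And>i. i \<in> I \<Longrightarrow> measure_pmf.prob M (A i) \<le> b i"
  shows "measure_pmf.prob M X \<le> (\<Sum>i\<in>I. b i)"
proof -
  have "measure_pmf.prob M X = measure_pmf.prob M (X \<inter> set_pmf M)" by (simp add: measure_Int_set_pmf)
  also have "\<dots> \<le> measure_pmf.prob M (\<Union>i\<in>I. A i)"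
    using assms(2) by (intro measure_pmf.finite_measure_mono) auto
  also have "\<dots> \<le> (\<Sum>i\<in>I. measure_pmf.prob M (A i))"
    using assms(1) by (intro measure_pmf.finite_measure_subadditive_finite) auto
  also have "\<dots> \<le> (\<Sum>i\<in>I. b i)" by (intro sum_mono assms(3))
  finally show ?thesis .
qed

lemma sum_SIGMA_fst:
  assumes "finite X" "\<And>m. m \<in> X \<Longrightarrow> finite (Y m)" "\<And>m z. m \<in> X \<Longrightarrow> z \<in> Y m \<Longrightarrow> finite (W m z)"
  shows "(\<Sum>i\<in>(SIGMA m:X. SIGMA z:Y m. W m z). f (fst i)) = (\<Sum>m\<in>X. \<Sum>z\<in>Y m. \<Sum>u\<in>W m z. f m)"
proof -
  have "(\<Sum>m\<in>X. \<Sum>z\<in>Y m. \<Sum>u\<in>W m z. f m) = (\<Sum>m\<in>X. \<Sum>y\<in>(SIGMA z:Y m. W m z). f m)"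
  proof (rule sum.cong[OF refl])
    fix m assume "m \<in> X"
    then show "(\<Sum>z\<in>Y m. \<Sum>u\<in>W m z. f m) = (\<Sum>y\<in>(SIGMA z:Y m. W m z). f m)"
      using assms sum.Sigma[of "Y m" "W m" "\<lambda>_ _. f m"] by (simp add: case_prod_unfold)
  qed
  also have "\<dots> = (\<Sum>(m, y)\<in>(SIGMA m:X. SIGMA z:Y m. W m z). f m)"
    using assms by (intro sum.Sigma ballI finite_SigmaI) auto
  finally show ?thesis by (simp add: case_prod_unfold)
qed

lemma all_trees_props:
  assumes "(S, T) \<in> all_trees n m"
  shows "finite S" "S \<subseteq> {0..<n}" "card S = m" "finite T" "T \<subseteq> vertex_pairs n" "T \<subseteq> S \<times> S"
    "card T = m - 1" "1 \<le> m"
proof -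
  obtain v where v: "rtree v S T" "S \<subseteq> {0..<n}" "card S = m"
    using assms by (auto simp: all_trees_def trees_def)
  show "finite S" "S \<subseteq> {0..<n}" "card S = m" "finite T" "T \<subseteq> vertex_pairs n" "T \<subseteq> S \<times> S"
    "card T = m - 1" "1 \<le> m"
    using rtree_props[OF v(1), of n] v(2,3) by auto
qed

text \<open>Union bound over spanning trees of \<open>S\<close> and subsets \<open>U\<close>. Per
  vertex the entropy is \<open>8 * (d * exp 1)\<close>, at most \<open>exp \<gamma>\<close> by
  \<open>large\<close>, against a gain \<open>exp (- (2 * \<gamma>))\<close>; half of the gain
  survives.\<close>

lemma prob_not_dense_free:
  fixes d e :: real
  assumes n: "n > 0" and d: "1 \<le> d" "d \<le> n" and e: "0 < e" "e \<le> 1"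
    and large: "8 * (d * exp 1) \<le> exp (e\<^sup>2 * d / 64)" and L: "1 \<le> L"
  shows "measure_pmf.prob (erdos_renyi n (d / n)) {E. \<not> dense_free n E ((1 + e) * d) L}
    \<le> real n ^ 2 * exp (- (e\<^sup>2 * d / 64) * L)"
proof -
  define \<gamma> where "\<gamma> = e\<^sup>2 * d / 64"
  define q where "q = d / n"
  define D where "D = (1 + e) * d"
  \<comment> \<open>Up to second order the exponent per vertex of \<open>U\<close> is
    \<open>d * (2 * s\<^sup>2 - e * s)\<close>, minimal here with value
    \<open>- (8 * \<gamma>)\<close>. As \<open>m \<le> 4 * card U\<close>, this leaves
    \<open>2 * \<gamma>\<close> per vertex of \<open>S\<close>.\<close>
  define s where "s = e / 4"
  have g0: "0 \<le> \<gamma>" using d by (simp add: \<gamma>_def)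
  have q: "0 \<le> q" "q \<le> 1" "q * n = d" using d n by (auto simp: q_def)
  have s: "0 \<le> s" "2 * s \<le> 1" using e by (auto simp: s_def)
  define b where "b m = (q * exp 1) ^ (m - 1) * exp (- (2 * \<gamma>) * m)" for m :: nat
  define I where "I = (SIGMA m:{L..n}. SIGMA z:all_trees n m. {U \<in> Pow (fst z). m \<le> 4 * card U})"
  define A where "A i = (case i of (m, (S, T), U) \<Rightarrow> {E. T \<subseteq> E \<and> D * card U \<le> (\<Sum>v\<in>U. deg E v)})"
    for i :: "nat \<times> (nat set \<times> (nat \<times> nat) set) \<times> nat set"
  have exponent: "q * (exp (2 * s) - 1) / 2 * n - s * D \<le> - (8 * \<gamma>)"
  proof -
    have "exp (2 * s) \<le> 1 + 2 * s + (2 * s)\<^sup>2" using s by (intro exp_bound) auto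
    then have le: "d * (exp (2 * s) - 1) \<le> d * (2 * s + (2 * s)\<^sup>2)" using d by (intro mult_left_mono) auto
    have "q * (exp (2 * s) - 1) / 2 * n = (q * n) * (exp (2 * s) - 1) / 2" by simp
    then have eq: "q * (exp (2 * s) - 1) / 2 * n = d * (exp (2 * s) - 1) / 2" by (simp only: q(3))
    have "q * (exp (2 * s) - 1) / 2 * n - s * D \<le> d * (2 * s + (2 * s)\<^sup>2) / 2 - s * D"
      unfolding eq by (intro diff_right_mono divide_right_mono le) simp
    also have "\<dots> = - (8 * \<gamma>)" by (simp add: s_def D_def \<gamma>_def power2_eq_square field_simps)
    finally show ?thesis .
  qed
  have "measure_pmf.prob (erdos_renyi n q) {E. \<not> dense_free n E D L} \<le> (\<Sum>i\<in>I. b (fst i))"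
  proof (rule prob_le_cover[where A = A])
    show "finite I" unfolding I_def
      by (intro finite_SigmaI) (use all_trees_props(1) finite_all_trees in auto)
  next
    fix E assume E: "E \<in> set_pmf (erdos_renyi n q)" and "E \<in> {E. \<not> dense_free n E D L}"
    then obtain S U where S: "conn E S" "S \<subseteq> {0..<n}" "U \<subseteq> S" "card S \<le> 4 * card U" "L \<le> card S"
        "D * card U < (\<Sum>v\<in>U. deg E v)"
      by (auto simp: dense_free_def)
    obtain v T where T: "v \<in> {0..<n}" "T \<subseteq> E" "(S, T) \<in> trees n (card S) v"
      using conn_spanning_tree[OF set_erdos_renyi[OF E] S(1,2)] by blast
    have "card S \<le> n" using card_mono[OF _ S(2)] by simp
    then have "(card S, (S, T), U) \<in> I" using T S by (auto simp: I_def all_trees_def)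
    moreover have "E \<in> A (card S, (S, T), U)" using T S by (simp add: A_def)
    ultimately show "\<exists>i\<in>I. E \<in> A i" by blast
  next
    fix i assume "i \<in> I"
    then obtain m S T U where i: "i = (m, (S, T), U)" "(S, T) \<in> all_trees n m" "U \<subseteq> S" "m \<le> 4 * card U"
      by (auto simp: I_def)
    note t = all_trees_props[OF i(2)]
    have "measure_pmf.prob (erdos_renyi n q) (A i)
        \<le> (q * exp (2 * s)) ^ card T * exp ((q * (exp (2 * s) - 1) / 2 * n - s * D) * card U)"
    proof -
      have "A i = {E. T \<subseteq> E \<and> D * card U \<le> (\<Sum>v\<in>U. deg E v)}" by (simp add: i(1) A_def)
      then show ?thesis
        using prob_heavy_tree[OF q(1,2) s(1) t(5) subset_trans[OF i(3) t(2)], of D] by simp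
    qed
    also have "\<dots> \<le> (q * exp 1) ^ (m - 1) * exp (- (2 * \<gamma>) * m)"
    proof (intro mult_mono)
      show "(q * exp (2 * s)) ^ card T \<le> (q * exp 1) ^ (m - 1)"
        unfolding t(7) using q s by (intro power_mono mult_left_mono) auto
      have "(q * (exp (2 * s) - 1) / 2 * n - s * D) * card U \<le> - (8 * \<gamma>) * card U"
        by (rule mult_right_mono[OF exponent]) simp
      also have "\<dots> \<le> - (2 * \<gamma>) * m"
        using mult_left_mono[of "real m" "4 * card U" "2 * \<gamma>"] g0 i(4) by simp
      finally show "exp ((q * (exp (2 * s) - 1) / 2 * n - s * D) * card U) \<le> exp (- (2 * \<gamma>) * m)" by simp
    qed (use q in auto)
    finally show "measure_pmf.prob (erdos_renyi n q) (A i) \<le> b (fst i)" by (simp add: i(1) b_def)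
  qed
  also have "\<dots> = (\<Sum>m\<in>{L..n}. \<Sum>z\<in>all_trees n m. \<Sum>U\<in>{U \<in> Pow (fst z). m \<le> 4 * card U}. b m)"
  proof -
    have fin: "finite {U \<in> Pow (fst z). m \<le> 4 * card U}" if "z \<in> all_trees n m" for m z
      using all_trees_props(1)[of "fst z" "snd z" n m] that by auto
    show ?thesis unfolding I_def by (rule sum_SIGMA_fst) (use fin finite_all_trees in auto)
  qed
  also have "\<dots> \<le> (\<Sum>m\<in>{L..n}. real n * exp (- \<gamma> * L))"
  proof (rule sum_mono)
    fix m assume m: "m \<in> {L..n}"
    have b0: "0 \<le> b m" using q by (simp add: b_def)
    have "(\<Sum>z\<in>all_trees n m. \<Sum>U\<in>{U \<in> Pow (fst z). m \<le> 4 * card U}. b m) \<le> (\<Sum>z\<in>all_trees n m. 2 ^ m * b m)"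
    proof (rule sum_mono)
      fix z assume z: "z \<in> all_trees n m"
      have t: "finite (fst z)" "card (fst z) = m"
        using all_trees_props(1,3)[of "fst z" "snd z" n m] z by auto
      have "card {U \<in> Pow (fst z). m \<le> 4 * card U} \<le> card (Pow (fst z))"
        using t by (intro card_mono) auto
      also have "\<dots> = 2 ^ m" using t by (simp add: card_Pow)
      finally have "real (card {U \<in> Pow (fst z). m \<le> 4 * card U}) \<le> 2 ^ m"
        by (metis of_nat_le_iff of_nat_numeral of_nat_power)
      then show "(\<Sum>U\<in>{U \<in> Pow (fst z). m \<le> 4 * card U}. b m) \<le> 2 ^ m * b m"
        using b0 by (simp add: mult_right_mono)
    qed
    also have "\<dots> = real (card (all_trees n m)) * (2 ^ m * b m)" by simp
    also have "\<dots> \<le> (4 * real n) ^ m * (2 ^ m * b m)"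
      using card_all_trees[OF n] b0 by (intro mult_right_mono) auto
    \<comment> \<open>With \<open>m\<close> vertices but only \<open>m - 1\<close> tree edges, one
      power of \<open>n\<close> is not compensated by \<open>q\<close>.\<close>
    also have "\<dots> = real n * ((8 ^ m * (d * exp 1) ^ (m - 1)) * exp (- (2 * \<gamma>) * m))"
    proof -
      obtain k where k: "m = Suc k" using m L by (cases m) auto
      have "(4 * real n) ^ m * (2 ^ m * b m) = real n * (8 ^ m * (real n * (q * exp 1)) ^ k * exp (- (2 * \<gamma>) * m))"
        by (simp add: b_def k power_mult_distrib) (simp flip: power_mult_distrib)
      also have "real n * (q * exp 1) = d * exp 1" using q(3) by (simp add: mult.commute)
      finally show ?thesis by (simp add: k)
    qed
    also have "\<dots> \<le> real n * (exp (\<gamma> * m) * exp (- (2 * \<gamma>) * m))"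
    proof (intro mult_left_mono mult_right_mono)
      have "1 * 1 \<le> d * exp 1" using d by (intro mult_mono) auto
      then have "(d * exp 1) ^ (m - 1) \<le> (d * exp 1) ^ m" by (intro power_increasing) auto
      then have "8 ^ m * (d * exp 1) ^ (m - 1) \<le> (8 * (d * exp 1)) ^ m" by (simp add: power_mult_distrib)
      also have "\<dots> \<le> exp \<gamma> ^ m" using large d by (intro power_mono) (auto simp: \<gamma>_def)
      also have "\<dots> = exp (\<gamma> * m)" by (simp add: exp_of_nat2_mult)
      finally show "8 ^ m * (d * exp 1) ^ (m - 1) \<le> exp (\<gamma> * m)" .
    qed auto
    also have "exp (\<gamma> * m) * exp (- (2 * \<gamma>) * m) = exp (- \<gamma> * m)"
      by (simp flip: exp_add)
    also have "real n * exp (- \<gamma> * m) \<le> real n * exp (- \<gamma> * L)"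
      using m g0 by (intro mult_left_mono) (auto intro: mult_left_mono)
    finally show "(\<Sum>z\<in>all_trees n m. \<Sum>U\<in>{U \<in> Pow (fst z). m \<le> 4 * card U}. b m) \<le> real n * exp (- \<gamma> * L)" .
  qed
  also have "\<dots> = real (card {L..n}) * (real n * exp (- \<gamma> * L))" by simp
  also have "\<dots> \<le> real n * (real n * exp (- \<gamma> * L))"
    using L by (intro mult_right_mono) auto
  finally show ?thesis by (simp add: power2_eq_square q_def D_def \<gamma>_def)
qed

text \<open>Two edges beyond a spanning tree mean \<open>m + 1\<close> edges on \<open>m\<close>
  vertices, so one factor \<open>d / n\<close> remains. The power 5 is 4 for the ends of the extra
  edges and 1 for the sum over sizes.\<close>

lemma prob_not_bicycle_free:
  fixes d :: real
  assumes n: "n > 0" and d: "1 \<le> d" "d \<le> n"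
  shows "measure_pmf.prob (erdos_renyi n (d / n)) {E. \<not> bicycle_free n E M}
    \<le> d / n * (real M + 1) ^ 5 * (4 * d) ^ M"
proof -
  define q where "q = d / n"
  have q: "0 \<le> q" "q \<le> 1" "q * n = d" using d n by (auto simp: q_def)
  define I where "I = (SIGMA m:{..M}. SIGMA z:all_trees n m. (fst z \<times> fst z) \<times> (fst z \<times> fst z) - Id - (snd z \<times> UNIV) - (UNIV \<times> snd z))"
  define A where "A i = (case i of (m, (S, T), (a, b)) \<Rightarrow> {E. insert a (insert b T) \<subseteq> E})"
    for i :: "nat \<times> (nat set \<times> (nat \<times> nat) set) \<times> ((nat \<times> nat) \<times> (nat \<times> nat))"
  define X where "X = (\<lambda>z :: nat set \<times> (nat \<times> nat) set. (fst z \<times> fst z) \<times> (fst z \<times> fst z) - Id - (snd z \<times> UNIV) - (UNIV \<times> snd z))"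
  have I: "I = (SIGMA m:{..M}. SIGMA z:all_trees n m. X z)" by (simp add: I_def X_def)
  have finX: "finite (X z)" "card (X z) \<le> m ^ 4" if "z \<in> all_trees n m" for m z
  proof -
    have t: "finite (fst z)" "card (fst z) = m"
      using all_trees_props(1,3)[of "fst z" "snd z" n m] that by auto
    have sub: "X z \<subseteq> (fst z \<times> fst z) \<times> (fst z \<times> fst z)" by (auto simp: X_def)
    show "finite (X z)" by (rule finite_subset[OF sub]) (simp add: t)
    have "card (X z) \<le> card ((fst z \<times> fst z) \<times> (fst z \<times> fst z))" by (rule card_mono[OF _ sub]) (simp add: t)
    also have "\<dots> = m ^ 4" by (simp add: card_cartesian_product t power4_eq_xxxx mult.assoc)
    finally show "card (X z) \<le> m ^ 4" .
  qed
  have "measure_pmf.prob (erdos_renyi n q) {E. \<not> bicycle_free n E M} \<le> (\<Sum>i\<in>I. q ^ Suc (fst i))"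
  proof (rule prob_le_cover[where A = A])
    show "finite I" unfolding I by (intro finite_SigmaI) (use finX finite_all_trees in auto)
  next
    fix E assume E: "E \<in> set_pmf (erdos_renyi n q)" and "E \<in> {E. \<not> bicycle_free n E M}"
    then obtain S where S: "conn E S" "S \<subseteq> {0..<n}" "card S \<le> M" "card S + 1 \<le> card (E \<inter> S \<times> S)"
      by (auto simp: bicycle_free_def)
    obtain v T where T: "v \<in> {0..<n}" "T \<subseteq> E" "(S, T) \<in> trees n (card S) v"
      using conn_spanning_tree[OF set_erdos_renyi[OF E] S(1,2)] by blast
    then have ST: "(S, T) \<in> all_trees n (card S)" by (auto simp: all_trees_def)
    note t = all_trees_props[OF ST]
    have "card (E \<inter> S \<times> S - T) = card (E \<inter> S \<times> S) - card T"
      using t T by (intro card_Diff_subset) auto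
    then have "2 \<le> card (E \<inter> S \<times> S - T)" using S t by simp
    then obtain Y where Y: "Y \<subseteq> E \<inter> S \<times> S - T" "card Y = 2"
      by (rule obtain_subset_with_card_n)
    then obtain a b where "Y = {a, b}" and ne: "a \<noteq> b" by (auto simp: card_2_iff)
    with Y have ab: "a \<in> E \<inter> S \<times> S - T" "b \<in> E \<inter> S \<times> S - T" by simp_all
    have "(card S, (S, T), (a, b)) \<in> I" using ST S(3) ab ne unfolding I by (simp add: X_def)
    moreover have "E \<in> A (card S, (S, T), (a, b))" using T ab by (auto simp: A_def)
    ultimately show "\<exists>i\<in>I. E \<in> A i" by blast
  next
    fix i assume "i \<in> I"
    then obtain m S T a b where i: "i = (m, (S, T), (a, b))" "(S, T) \<in> all_trees n m" "(a, b) \<in> X (S, T)"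
      unfolding I by auto
    note t = all_trees_props[OF i(2)]
    have ab: "a \<noteq> b" "a \<notin> T" "b \<notin> T" using i(3) by (auto simp: X_def)
    have c: "card (insert a (insert b T)) = Suc m" using ab t by simp
    show "measure_pmf.prob (erdos_renyi n q) (A i) \<le> q ^ Suc (fst i)"
    \<comment> \<open>\<open>X\<close> admits arbitrary ordered pairs from \<open>S\<close>; choices
      that are not potential edges have probability 0.\<close>
    proof (cases "insert a (insert b T) \<subseteq> vertex_pairs n")
      case True
      then have "measure_pmf.prob (erdos_renyi n q)
          {E. insert a (insert b T) \<subseteq> E \<and> 0 * real (card ({} :: nat set)) \<le> (\<Sum>v\<in>{}. deg E v)}
          \<le> (q * exp (2 * 0)) ^ card (insert a (insert b T)) * exp ((q * (exp (2 * 0) - 1) / 2 * n - 0 * 0) * card ({} :: nat set))"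
        using q by (intro prob_heavy_tree) auto
      then show ?thesis unfolding c by (simp add: i(1) A_def)
    next
      case False
      have "A i \<inter> set_pmf (erdos_renyi n q) = {}"
      proof (rule equals0I)
        fix E assume "E \<in> A i \<inter> set_pmf (erdos_renyi n q)"
        then have "insert a (insert b T) \<subseteq> E" "E \<subseteq> vertex_pairs n"
          using set_erdos_renyi[of E n q] by (simp_all add: i(1) A_def)
        then show False using False by (metis subset_trans)
      qed
      then have "measure_pmf.prob (erdos_renyi n q) (A i) = 0"
        using measure_Int_set_pmf[of "erdos_renyi n q" "A i"] by simp
      then show ?thesis using q by simp
    qed
  qed
  also have "\<dots> = (\<Sum>m\<in>{..M}. \<Sum>z\<in>all_trees n m. \<Sum>x\<in>X z. q ^ Suc m)"
    unfolding I
    by (rule sum_SIGMA_fst) (use finX finite_all_trees in auto)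
  also have "\<dots> \<le> (\<Sum>m\<in>{..M}. d / n * ((4 * d) ^ M * (real M + 1) ^ 4))"
  proof (rule sum_mono)
    fix m assume m: "m \<in> {..M}"
    have "(\<Sum>z\<in>all_trees n m. \<Sum>x\<in>X z. q ^ Suc m) \<le> (\<Sum>z\<in>all_trees n m. real (m ^ 4) * q ^ Suc m)"
    proof (rule sum_mono)
      fix z assume z: "z \<in> all_trees n m"
      have "(\<Sum>x\<in>X z. q ^ Suc m) = real (card (X z)) * q ^ Suc m" by simp
      also have "\<dots> \<le> real (m ^ 4) * q ^ Suc m"
        using finX(2)[OF z] q by (intro mult_right_mono of_nat_mono) auto
      finally show "(\<Sum>x\<in>X z. q ^ Suc m) \<le> real (m ^ 4) * q ^ Suc m" .
    qed
    also have "\<dots> = real (card (all_trees n m)) * (real m ^ 4 * q ^ Suc m)" by simp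
    also have "\<dots> \<le> (4 * real n) ^ m * (real m ^ 4 * q ^ Suc m)"
      using card_all_trees[OF n] q by (intro mult_right_mono) auto
    also have "\<dots> = q * ((4 * (q * real n)) ^ m * real m ^ 4)"
      by (simp add: power_mult_distrib)
    also have "\<dots> \<le> q * ((4 * d) ^ M * (real M + 1) ^ 4)"
      unfolding q(3) using m d q
      by (intro mult_left_mono mult_mono power_increasing power_mono) auto
    finally show "(\<Sum>z\<in>all_trees n m. \<Sum>x\<in>X z. q ^ Suc m) \<le> d / n * ((4 * d) ^ M * (real M + 1) ^ 4)"
      by (simp add: q_def)
  qed
  also have "\<dots> = (real M + 1) * (d / n * ((4 * d) ^ M * (real M + 1) ^ 4))" by simp
  also have "\<dots> = d / n * (real M + 1) ^ 5 * (4 * d) ^ M"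
  proof -
    have "x * (a * (y * x ^ 4)) = a * x ^ 5 * y" for a x y :: real by algebra
    then show ?thesis .
  qed
  finally show ?thesis by (simp add: q_def)
qed

section \<open>Choice of parameters and conclusion\<close>

text \<open>The exponent \<open>e\<^sup>2 * d / 64\<close> is linear in \<open>d\<close> while the
  entropies are logarithmic. The first condition pays for trees and subsets of dense sets; the
  second keeps \<open>(4 * d) ^ (4 * L)\<close> of order at most sqrt n when \<open>L\<close> is
  about \<open>3 * ln n\<close> divided by that exponent.\<close>

lemma parameter_threshold:
  fixes e :: real
  assumes "e > 0"
  shows "\<exists>d0 > 1. \<forall>d > d0. 8 * (d * exp 1) \<le> exp (e\<^sup>2 * d / 64) \<and> 12 * ln (4 * d) / (e\<^sup>2 * d / 64) \<le> 1 / 2"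
proof -
  define g where "g = e\<^sup>2 / 64"
  have g: "g > 0" using assms by (simp add: g_def)
  have "eventually (\<lambda>d. 8 * (d * exp 1) \<le> exp (g * d)) at_top" using g by real_asymp
  moreover have "((\<lambda>d. 12 * ln (4 * d) / (g * d)) \<longlongrightarrow> 0) at_top" using g by real_asymp
  then have "eventually (\<lambda>d. 12 * ln (4 * d) / (g * d) < 1 / 2) at_top"
    by (rule order_tendstoD) simp
  ultimately have "eventually (\<lambda>d. 8 * (d * exp 1) \<le> exp (g * d) \<and> 12 * ln (4 * d) / (g * d) \<le> 1 / 2) at_top"
    by eventually_elim simp
  then obtain d1 where d1: "\<And>d. d \<ge> d1 \<Longrightarrow> 8 * (d * exp 1) \<le> exp (g * d) \<and> 12 * ln (4 * d) / (g * d) \<le> 1 / 2"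
    by (auto simp: eventually_at_top_linorder)
  have "g * d = e\<^sup>2 * d / 64" for d by (simp add: g_def)
  with d1 show ?thesis by (intro exI[of _ "max d1 2"]) auto
qed

text \<open>Of the square in \<open>lam * (1 + e)\<^sup>2 * d \<le> 1\<close>, one factor belongs to
  the density threshold \<open>D\<close> and the other is the contraction slack
  \<open>del = e\<close>.\<close>

lemma mixing_time_bound:
  fixes e d lam \<gamma> :: real and L :: nat
  assumes E: "E \<subseteq> vertex_pairs n" and n: "n > 0" and e: "0 < e" and d: "0 < d"
    and lam: "0 < lam" "lam \<le> 1" "lam * (1 + e)\<^sup>2 * d \<le> 1" and L: "1 \<le> L"
    and good: "dense_free n E ((1 + e) * d) L" "bicycle_free n E (4 * L)"
    and t: "(n * ln (2 / lam) + ln 16) * (4 * 3 ^ Suc L * n / (1 - 1 / sqrt (1 + e))) \<le> t"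
  shows "mixing_time n E lam \<le> nat \<lceil>t\<rceil>"
proof -
  interpret hardcore_graph n E lam using E lam by unfold_locales
  let ?D = "(1 + e) * d"
  have D: "?D > 0" using e d by simp
  have "lam / (1 + lam) \<le> lam" using lam by (simp add: divide_le_eq)
  then have "p * (?D * (1 + e)) \<le> lam * (?D * (1 + e))" using e d by (intro mult_right_mono) auto
  also have "lam * (?D * (1 + e)) = lam * (1 + e)\<^sup>2 * d" by algebra
  also have "\<dots> \<le> 1" by (rule lam(3))
  finally have pD: "p * ?D * (1 + e) \<le> 1" by (simp only: mult.assoc)
  have H: "hset n E ?D \<subseteq> V" by (auto simp: hset_def heavy_def)
  have "(1::real) \<le> 3 ^ Suc L" by (rule one_le_power) simp
  then have c: "(1::real) \<le> 4 * 3 ^ Suc L" by simp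
  show ?thesis
    by (rule mixing_time_le[OF n lam(2) H D e pD hset_light[OF D] PC_hset[OF lam(2) L good] c])
       (use t real_nat_ceiling_ge[of t] in auto)
qed

theorem theoremL1:
  fixes \<epsilon> :: real
  assumes "\<epsilon> > 0"
  shows "\<exists>d0 > 1. \<forall>d :: real. d > d0 \<longrightarrow>
           (\<exists>C > (0::real). \<forall>lam :: real. 0 < lam \<and> lam \<le> (1 - \<epsilon>) / d \<longrightarrow>
              (\<exists>K > (0::real).
                 (\<lambda>n. measure_pmf.prob (erdos_renyi n (d / real n))
                        {E. real (mixing_time n E lam) \<le> K * real n powr C})
                 \<longlonglongrightarrow> 1))"
proof (cases "\<epsilon> < 1")
  \<comment> \<open>For \<epsilon> at least 1 no positive fugacity is admissible, so any constants
    do.\<close>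
  case False
  have "\<not> (0 < lam \<and> lam \<le> (1 - \<epsilon>) / d)" if "d > 2" for lam d :: real
  proof -
    have "(1 - \<epsilon>) / d \<le> 0" using False that by (simp add: divide_nonpos_pos)
    then show ?thesis by linarith
  qed
  then show ?thesis by (intro exI[of _ 2] conjI allI impI exI[of _ 1]) auto
next
  case True
  \<comment> \<open>With half of \<epsilon>, the product of 1 - 2e and the square of 1 + e is still
    below 1.\<close>
  define e where "e = \<epsilon> / 2"
  have e: "0 < e" "e \<le> 1" using assms True by (auto simp: e_def)
  obtain d0 where d0: "d0 > 1" "\<And>d. d > d0 \<Longrightarrow> 8 * (d * exp 1) \<le> exp (e\<^sup>2 * d / 64) \<and> 12 * ln (4 * d) / (e\<^sup>2 * d / 64) \<le> 1 / 2"
    using parameter_threshold[OF e(1)] by blast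
  show ?thesis
  proof (rule exI[of _ d0], intro conjI allI impI)
    fix d :: real assume dd: "d > d0"
    have d: "1 < d" using dd d0(1) by simp
    define \<gamma> where "\<gamma> = e\<^sup>2 * d / 64"
    have g: "\<gamma> > 0" using e d by (simp add: \<gamma>_def)
    have large: "8 * (d * exp 1) \<le> exp (e\<^sup>2 * d / 64)" "12 * ln (4 * d) / \<gamma> \<le> 1 / 2"
      using d0(2)[OF dd] by (auto simp: \<gamma>_def)
    \<comment> \<open>\<open>3 ^ L n\<close> is at most \<open>9 * real n powr \<alpha>\<close>. The
      two further powers of \<open>n\<close> in the final exponent come from the starting point and
      from the single-site averaging; \<open>lam\<close> does not occur.\<close>
    define \<alpha> where "\<alpha> = 3 * ln 3 / \<gamma>"
    have a: "\<alpha> > 0" using g by (simp add: \<alpha>_def)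
    \<comment> \<open>The factor 3 turns the prefactor \<open>n ^ 2\<close> of the dense-set bound
      into \<open>1 / n\<close>; \<open>Suc\<close> guarantees \<open>1 \<le> L n\<close> for every
      \<open>n\<close>.\<close>
    define L where "L n = Suc (nat \<lceil>3 * ln (real n) / \<gamma>\<rceil>)" for n
    have L: "1 \<le> L n" "3 * ln (real n) / \<gamma> \<le> L n" for n
      unfolding L_def by linarith+
    have L2: "L n \<le> 3 * ln (real n) / \<gamma> + 2" if "n > 0" for n
    proof -
      have "0 \<le> 3 * ln (real n) / \<gamma>" using that g by simp
      then show ?thesis unfolding L_def by linarith
    qed
    show "\<exists>C > (0::real). \<forall>lam :: real. 0 < lam \<and> lam \<le> (1 - \<epsilon>) / d \<longrightarrow>
              (\<exists>K > (0::real).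
                 (\<lambda>n. measure_pmf.prob (erdos_renyi n (d / real n))
                        {E. real (mixing_time n E lam) \<le> K * real n powr C})
                 \<longlonglongrightarrow> 1)"
    proof (rule exI[of _ "2 + \<alpha>"], intro conjI allI impI)
      show "2 + \<alpha> > 0" using a by simp
      fix lam :: real assume lam': "0 < lam \<and> lam \<le> (1 - \<epsilon>) / d"
      then have lam: "0 < lam" "lam * d \<le> 1 - \<epsilon>" using d by (auto simp: pos_le_divide_eq)
      have "lam * 1 \<le> lam * d" using lam d by (intro mult_left_mono) auto
      then have lam1: "lam \<le> 1" using lam assms by linarith
      have "lam * (1 + e)\<^sup>2 * d = lam * d * (1 + e)\<^sup>2" by simp
      also have "\<dots> \<le> (1 - \<epsilon>) * (1 + e)\<^sup>2" using lam by (intro mult_right_mono) auto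
      also have "\<dots> = 1 - 3 * e\<^sup>2 - 2 * e ^ 3" by (simp add: e_def power2_eq_square power3_eq_cube field_simps)
      also have "\<dots> \<le> 1"
        using zero_le_power[of e 2] zero_le_power[of e 3] e by linarith
      finally have lamD: "lam * (1 + e)\<^sup>2 * d \<le> 1" .
      define \<kappa> where "\<kappa> = 1 - 1 / sqrt (1 + e)"
      have k: "\<kappa> > 0" using e by (simp add: \<kappa>_def)
      \<comment> \<open>108 is \<open>4 * 3 * 9\<close>, from \<open>4 * 3 ^ Suc L\<close> and the
        bound on \<open>3 ^ L\<close>; the summand 1 pays for rounding up.\<close>
      define K where "K = 1 + (ln (2 / lam) + ln 16) * (108 / \<kappa>)"
      have ll: "ln (2 / lam) \<ge> 0" using lam lam1 by simp
      have K: "K > 0" unfolding K_def using ll k by (intro add_pos_nonneg mult_nonneg_nonneg) auto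
      have mix: "real (mixing_time n E lam) \<le> K * real n powr (2 + \<alpha>)"
        if n: "n > 0" and E: "E \<subseteq> vertex_pairs n"
          and good: "dense_free n E ((1 + e) * d) (L n)" "bicycle_free n E (4 * L n)" for n E
      proof -
        have n1: "real n \<ge> 1" using n by simp
        have "3 ^ L n = (3::real) powr L n" by (simp add: powr_realpow)
        also have "\<dots> \<le> 3 powr (3 * ln n / \<gamma> + 2)" using L2[OF n] by (intro powr_mono) auto
        also have "\<dots> = 9 * real n powr \<alpha>"
        proof -
          have "(3::real) powr (3 * ln n / \<gamma>) = real n powr \<alpha>"
            using n by (simp add: powr_def \<alpha>_def)
          then show ?thesis by (simp add: powr_add)
        qed
        finally have L3: "3 ^ L n \<le> 9 * real n powr \<alpha>" .
        define t where "t = (n * ln (2 / lam) + ln 16) * (4 * 3 ^ Suc (L n) * n / \<kappa>)"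
        have "t \<le> (n * ln (2 / lam) + n * ln 16) * (108 * real n powr \<alpha> * n / \<kappa>)"
          unfolding t_def
        proof (rule mult_mono)
          show "n * ln (2 / lam) + ln 16 \<le> n * ln (2 / lam) + n * ln 16" using n1 by simp
          have "4 * 3 ^ Suc (L n) \<le> 108 * real n powr \<alpha>" using L3 by simp
          from mult_right_mono[OF this, of "real n"]
          show "4 * 3 ^ Suc (L n) * n / \<kappa> \<le> 108 * real n powr \<alpha> * n / \<kappa>"
            using k by (intro divide_right_mono) auto
        qed (use ll k n1 in auto)
        also have "\<dots> = (ln (2 / lam) + ln 16) * (108 / \<kappa>) * (real n powr \<alpha> * (n * n))"
          by (simp add: algebra_simps)
        also have "real n powr \<alpha> * (n * n) = real n powr (2 + \<alpha>)"
          using n by (simp add: powr_add power2_eq_square)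
        finally have t: "t \<le> (ln (2 / lam) + ln 16) * (108 / \<kappa>) * real n powr (2 + \<alpha>)" .
        have t0: "t \<ge> 0" unfolding t_def using ll k by (intro mult_nonneg_nonneg) auto
        have "mixing_time n E lam \<le> nat \<lceil>t\<rceil>"
          using mixing_time_bound[OF E n e(1) _ lam(1) lam1 lamD L(1) good] d by (simp add: t_def \<kappa>_def)
        then have "real (mixing_time n E lam) \<le> t + 1" using t0 by linarith
        moreover have "1 \<le> real n powr (2 + \<alpha>)" using n1 a by (simp add: ge_one_powr_ge_zero)
        ultimately show ?thesis using t by (simp add: K_def distrib_right)
      qed
      define err where "err n = real n ^ 2 * exp (- \<gamma> * L n) + d / n * (real (4 * L n) + 1) ^ 5 * (4 * d) ^ (4 * L n)" for n
      have low: "1 - err n \<le> measure_pmf.prob (erdos_renyi n (d / real n))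
                  {E. real (mixing_time n E lam) \<le> K * real n powr (2 + \<alpha>)}"
        if n: "n > 0" "d \<le> n" for n
      proof -
        let ?M = "erdos_renyi n (d / real n)"
        let ?A = "{E. \<not> dense_free n E ((1 + e) * d) (L n)}" and ?B = "{E. \<not> bicycle_free n E (4 * L n)}"
        let ?X = "{E. real (mixing_time n E lam) \<le> K * real n powr (2 + \<alpha>)}"
        have "1 = measure_pmf.prob ?M (set_pmf ?M)" by (simp add: measure_pmf.prob_eq_1 AE_measure_pmf)
        also have "\<dots> \<le> measure_pmf.prob ?M (?X \<union> (?A \<union> ?B))"
          using mix n set_erdos_renyi by (intro measure_pmf.finite_measure_mono) auto
        also have "\<dots> \<le> measure_pmf.prob ?M ?X + measure_pmf.prob ?M (?A \<union> ?B)"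
          by (rule measure_Un_le) auto
        also have "measure_pmf.prob ?M (?A \<union> ?B) \<le> measure_pmf.prob ?M ?A + measure_pmf.prob ?M ?B"
          by (rule measure_Un_le) auto
        also have "measure_pmf.prob ?M ?A \<le> real n ^ 2 * exp (- \<gamma> * L n)"
          unfolding \<gamma>_def using n d e large L by (intro prob_not_dense_free) auto
        also have "measure_pmf.prob ?M ?B \<le> d / n * (real (4 * L n) + 1) ^ 5 * (4 * d) ^ (4 * L n)"
          using n d by (intro prob_not_bicycle_free) auto
        finally show ?thesis by (simp add: err_def)
      qed
      \<comment> \<open>Four times \<open>L n \<le> 3 * ln n / \<gamma> + 2\<close> leaves the
        exponent 8 and, with the added 1, the constant 9. The power \<open>- 1 / 2\<close> is the
        factor \<open>1 / n\<close> against the growth \<open>n powr (1 / 2)\<close> of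
        \<open>(4 * d) ^ (4 * L n)\<close>.\<close>
      define bd where "bd n = 1 / real n + d * (12 * (ln (real n) / \<gamma>) + 9) ^ 5 * (4 * d) ^ 8 * real n powr (- 1 / 2)" for n
      have err: "err n \<le> bd n" if n: "n > 0" for n
      proof -
        have n1: "real n \<ge> 1" "ln (real n) \<ge> 0" using n by auto
        have "- \<gamma> * L n \<le> - 3 * ln n"
          using L(2)[of n] g by (simp add: divide_le_eq mult.commute)
        then have "real n ^ 2 * exp (- \<gamma> * L n) \<le> real n ^ 2 * exp (- 3 * ln n)"
          by (intro mult_left_mono) auto
        also have "exp (- 3 * ln n) = real n powr (- 3)" using n by (simp add: powr_def)
        also have "real n ^ 2 * real n powr (- 3) = 1 / real n"
          using n by (simp add: powr_minus power2_eq_square power3_eq_cube divide_simps)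
        finally have 1: "real n ^ 2 * exp (- \<gamma> * L n) \<le> 1 / real n" .
        have M: "real (4 * L n) \<le> 12 * (ln n / \<gamma>) + 8" using L2[OF n] by simp
        have "(4 * d) ^ (4 * L n) = (4 * d) powr real (4 * L n)"
          by (rule powr_realpow[symmetric]) (use d in simp)
        also have "\<dots> \<le> (4 * d) powr (12 * (ln n / \<gamma>) + 8)" using M d by (intro powr_mono) auto
        also have "\<dots> = (4 * d) ^ 8 * exp (12 * ln (4 * d) / \<gamma> * ln n)"
        proof -
          have "(4 * d) powr (12 * (ln n / \<gamma>)) = exp (12 * ln (4 * d) / \<gamma> * ln n)"
            using d by (simp add: powr_def)
          moreover have "(4 * d) powr 8 = (4 * d) ^ 8"
            using d powr_realpow[of "4 * d" 8] by simp
          ultimately show ?thesis by (simp add: powr_add mult.commute)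
        qed
        also have "\<dots> \<le> (4 * d) ^ 8 * exp (1 / 2 * ln n)"
          using d n1 large(2) by (intro mult_left_mono) (auto intro: mult_right_mono simp del: times_divide_eq_left)
        also have "exp (1 / 2 * ln n) = real n powr (1 / 2)" using n by (simp add: powr_def)
        finally have P: "(4 * d) ^ (4 * L n) \<le> (4 * d) ^ 8 * real n powr (1 / 2)" .
        have "d / n * (real (4 * L n) + 1) ^ 5 * (4 * d) ^ (4 * L n)
            \<le> d / n * (12 * (ln n / \<gamma>) + 9) ^ 5 * ((4 * d) ^ 8 * real n powr (1 / 2))"
          using M P d n1 g by (intro mult_mono power_mono) auto
        also have "\<dots> = d * (12 * (ln n / \<gamma>) + 9) ^ 5 * (4 * d) ^ 8 * (real n powr (1 / 2) / n)"
          by simp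
        also have "real n powr (1 / 2) / n = real n powr (- 1 / 2)"
          using n powr_diff[of "real n" "1 / 2" 1] by simp
        finally show ?thesis using 1 by (simp add: err_def bd_def)
      qed
      have bd0: "bd \<longlonglongrightarrow> 0"
      proof -
        \<comment> \<open>\<open>- 1 / 10\<close> is a fifth of \<open>- 1 / 2\<close>, so the error
          term becomes the fifth power of one vanishing sequence.\<close>
        have l: "(\<lambda>n::nat. (12 * (ln (real n) / \<gamma>) + 9) * real n powr (- 1 / 10)) \<longlonglongrightarrow> 0"
          using g by real_asymp
        have pw: "(real n powr (- 1 / 10)) ^ 5 = real n powr (- 1 / 2)" for n :: nat
          using powr_power[of "real n" "- 1 / 10" 5] by (cases "n = 0") simp_all
        have eq: "bd = (\<lambda>n. 1 / real n + d * (4 * d) ^ 8 * ((12 * (ln (real n) / \<gamma>) + 9) * real n powr (- 1 / 10)) ^ 5)"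
          by (rule HOL.ext) (simp only: bd_def power_mult_distrib pw mult_ac)
        have "bd \<longlonglongrightarrow> 0 + d * (4 * d) ^ 8 * 0 ^ 5"
          unfolding eq by (intro tendsto_intros l lim_1_over_n)
        then show ?thesis by simp
      qed
      have "(\<lambda>n. measure_pmf.prob (erdos_renyi n (d / real n))
                        {E. real (mixing_time n E lam) \<le> K * real n powr (2 + \<alpha>)}) \<longlonglongrightarrow> 1"
      proof (rule tendsto_sandwich)
        show "(\<lambda>n. 1 - bd n) \<longlonglongrightarrow> 1" using tendsto_diff[OF tendsto_const bd0] by simp
        show "(\<lambda>n. 1 :: real) \<longlonglongrightarrow> 1" by (rule tendsto_const)
        show "\<forall>\<^sub>F n in sequentially. 1 - bd n \<le> measure_pmf.prob (erdos_renyi n (d / real n))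
                        {E. real (mixing_time n E lam) \<le> K * real n powr (2 + \<alpha>)}"
          using eventually_gt_at_top[of 0] eventually_ge_at_top[of "nat \<lceil>d\<rceil>"]
        proof eventually_elim
          case (elim n)
          then have "d \<le> n" by linarith
          then show ?case using elim low[of n] err[of n] by linarith
        qed
      qed simp
      then show "\<exists>K > (0::real). (\<lambda>n. measure_pmf.prob (erdos_renyi n (d / real n))
                        {E. real (mixing_time n E lam) \<le> K * real n powr (2 + \<alpha>)}) \<longlonglongrightarrow> 1"
        using K by blast
    qed
  qed (rule d0(1))
qed

end
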